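(* Let $J$ be a $\sigma$-invariant nilpotent subalgebra of $A$, and let $P=1+J$. Then $\{X(\lambda):\lambda\in C_J(\sigma)^\circ\}$ is a partition of $\mathrm{Irr}(C_P(\sigma))$; in particular, every irreducible character $\chi\in\mathrm{Irr}(C_P(\sigma))$ is a constituent of $\sigma_\lambda$ for some $\lambda\in C_J(\sigma)^\circ$. Furthermore, for every $\lambda,\mu\in C_J(\sigma)^\circ$ we have $\sigma_\lambda=\sigma_\mu$ if and only if $\mu\in\Omega_P(\lambda)$.
   Context: Let $k$ be a finite field of odd characteristic $p$ and $A$ a finite-dimensional associative $k$-algebra with identity, endowed with an involution $\sigma$: an additive map $\sigma:A\to A$ with $\sigma(ab)=\sigma(b)\sigma(a)$ and $\sigma^2=\mathrm{id}$, such that $\sigma(k\cdot 1)=k\cdot 1$ ($\sigma$ need not be $k$-linear). A subalgebra of $A$ is a multiplicatively closed $k$-subspace (it need not contain $1$). For a $\sigma$-invariant nilpotent subalgebra $J$, $P=1+J$ is a finite $p$-group (an algebra group). The group $\langle\sigma\rangle$ acts on $P$ by $x^\sigma=\sigma(x^{-1})$ and on $J$ by $a^\sigma=-\sigma(a)$. Put $C_P(\sigma)=\{x\in P: x^\sigma=x\}$ and $C_J(\sigma)=\{a\in J:a^\sigma=a\}$. The map $\Psi:P\to J$, $\Psi(x)=(x-1)(x+1)^{-1}$, is a bijection, inverse to the Cayley transform $\Phi(a)=(1+a)(1-a)^{-1}$. $J^\circ$ is the group of linear characters $\lambda:J^+\to\mathbb{C}^\times$ of the additive group of $J$. $P$ acts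 on $J^\circ$ on the left and on the right by $(x\lambda)(a)=\lambda(x^{-1}a)$, $(\lambda x)(a)=\lambda(ax^{-1})$. Put $\lambda^\sigma(a)=\lambda(a^\sigma)$. The dual group $C_J(\sigma)^\circ$ of $C_J(\sigma)^+$ is identified (via restriction) with $\{\lambda\in J^\circ:\lambda^\sigma=\lambda\}$. For $\lambda\in C_J(\sigma)^\circ$, $\Omega_P(\lambda)=\{\mu\in P\lambda P:\mu^\sigma=\mu\}$. For $\lambda\in J^\circ$ the supercharacter $\hat\xi_\lambda$ of $P$ is $\hat\xi_\lambda(x)=\frac{|P\lambda|}{|P\lambda P|}\sum_{\mu\in P\lambda P}\mu(\Psi(x))$, $x\in P$. $\mathrm{Irr}_\sigma(P)$ is the set of irreducible complex characters $\hat\chi$ of $P$ with $\hat\chi(x^\sigma)=\hat\chi(x)$ for all $x$. The Glauberman correspondence is the bijection $\pi_P:\mathrm{Irr}_\sigma(P)\to\mathrm{Irr}(C_P(\sigma))$ sending $\hat\chi$ to the unique irreducible constituent of the restriction $\hat\chi_{C_P(\sigma)}$ with odd multiplicity. For $\lambda\in C_J(\sigma)^\circ$, $X(\lambda)$ is the set of all $\chi\in\mathrm{Irr}(C_P(\sigma))$ whose Glauberman correspondent $\hat\chi=\pi_P^{-1}(\chi)$ is a constituent of $\hat\xi_\lambda$, and $\sigma_\lambda=\sum_{\chi\in X(\lambda)}\chi(1)\chi$. The parts of a partition are required to be non-empty. *)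

theory Defs
  imports
    "HOL-Algebra.Group"
    "HOL-Library.Disjoint_Sets"
    "Jordan_Normal_Form.VS_Connect"
begin

definition mat_trace :: "'r::comm_monoid_add mat \<Rightarrow> 'r" where
  "mat_trace M = (\<Sum>i<dim_row M. M $$ (i, i))"

definition matrix_rep :: "('g, 'm) monoid_scheme \<Rightarrow> nat \<Rightarrow> ('g \<Rightarrow> complex mat) \<Rightarrow> bool" where
  "matrix_rep G n \<rho> \<longleftrightarrow>
     (\<forall>x\<in>carrier G. \<rho> x \<in> carrier_mat n n) \<and>
     \<rho> \<one>\<^bsub>G\<^esub> = 1\<^sub>m n \<and>
     (\<forall>x\<in>carrier G. \<forall>y\<in>carrier G. \<rho> (x \<otimes>\<^bsub>G\<^esub> y) = \<rho> x * \<rho> y)"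

definition irreducible_rep :: "('g, 'm) monoid_scheme \<Rightarrow> nat \<Rightarrow> ('g \<Rightarrow> complex mat) \<Rightarrow> bool" where
  "irreducible_rep G n \<rho> \<longleftrightarrow>
     matrix_rep G n \<rho> \<and> n > 0 \<and>
     (\<forall>W. subspace class_ring W (module_vec TYPE(complex) n) \<longrightarrow>
          (\<forall>x\<in>carrier G. \<forall>w\<in>W. \<rho> x *\<^sub>v w \<in> W) \<longrightarrow>
          W = {0\<^sub>v n} \<or> W = carrier_vec n)"

text \<open>Functions on a group are total functions that vanish off the carrier, so that two
  of them agree on the carrier iff they are equal, also after taking linear combinations.\<close>

definition rep_character :: "('g, 'm) monoid_scheme \<Rightarrow> ('g \<Rightarrow> complex mat) \<Rightarrow> 'g \<Rightarrow> complex" where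
  "rep_character G \<rho> x = (if x \<in> carrier G then mat_trace (\<rho> x) else 0)"

definition Irr :: "('g, 'm) monoid_scheme \<Rightarrow> ('g \<Rightarrow> complex) set" where
  "Irr G = {rep_character G \<rho> | n \<rho>. irreducible_rep G n \<rho>}"

text \<open>The multiplicity of an irreducible character \<open>\<chi>\<close> in \<open>\<phi>\<close> is the scalar product
  \<open>char_inner G \<phi> \<chi>\<close>.\<close>

definition char_inner ::
    "('g, 'm) monoid_scheme \<Rightarrow> ('g \<Rightarrow> complex) \<Rightarrow> ('g \<Rightarrow> complex) \<Rightarrow> complex" where
  "char_inner G \<phi> \<psi> = (\<Sum>x\<in>carrier G. \<phi> x * cnj (\<psi> x)) / of_nat (card (carrier G))"

definition constituent ::
    "('g, 'm) monoid_scheme \<Rightarrow> ('g \<Rightarrow> complex) \<Rightarrow> ('g \<Rightarrow> complex) \<Rightarrow> bool" where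
  "constituent G \<chi> \<phi> \<longleftrightarrow> \<chi> \<in> Irr G \<and> char_inner G \<phi> \<chi> \<noteq> 0"

definition odd_constituent ::
    "('g, 'm) monoid_scheme \<Rightarrow> ('g \<Rightarrow> complex) \<Rightarrow> ('g \<Rightarrow> complex) \<Rightarrow> bool" where
  "odd_constituent G \<chi> \<phi> \<longleftrightarrow>
     \<chi> \<in> Irr G \<and> (\<exists>m::nat. odd m \<and> char_inner G \<phi> \<chi> = of_nat m)"

definition char_restrict ::
    "('g, 'm) monoid_scheme \<Rightarrow> ('g \<Rightarrow> complex) \<Rightarrow> 'g \<Rightarrow> complex" where
  "char_restrict H \<phi> x = (if x \<in> carrier H then \<phi> x else 0)"

text \<open>The sort \<open>{ring, monoid_mult}\<close> is that of associative rings with identity; unlike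
  \<open>ring_1\<close> it does not exclude the zero ring.\<close>

locale involution_algebra = vector_space scale
  for scale :: "'k::{field,finite} \<Rightarrow> 'a::{ring,monoid_mult} \<Rightarrow> 'a" +
  fixes \<sigma> :: "'a \<Rightarrow> 'a"
  assumes odd_char: "odd CHAR('k)"
    and finite_dimensional: "\<exists>B. finite B \<and> span B = UNIV"
    and scale_mult_left: "scale c a * b = scale c (a * b)"
    and scale_mult_right: "a * scale c b = scale c (a * b)"
    and \<sigma>_add: "\<sigma> (a + b) = \<sigma> a + \<sigma> b"
    and \<sigma>_mult: "\<sigma> (a * b) = \<sigma> b * \<sigma> a"
    and \<sigma>_\<sigma>: "\<sigma> (\<sigma> a) = a"
    and \<sigma>_scalars: "\<sigma> ` range (\<lambda>c. scale c 1) = range (\<lambda>c. scale c 1)"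

definition nilpotent_subalgebra ::
    "('k::field \<Rightarrow> 'a::{ring,monoid_mult} \<Rightarrow> 'a) \<Rightarrow> 'a set \<Rightarrow> bool" where
  "nilpotent_subalgebra scale J \<longleftrightarrow>
     module.subspace scale J \<and>
     (\<forall>a\<in>J. \<forall>b\<in>J. a * b \<in> J) \<and>
     (\<exists>n>0. \<forall>as. length as = n \<longrightarrow> set as \<subseteq> J \<longrightarrow> prod_list as = 0)"

abbreviation mult_monoid :: "'a::monoid_mult monoid" where
  "mult_monoid \<equiv> \<lparr>carrier = UNIV, mult = (*), one = 1\<rparr>"

text \<open>Inverse of a unit of the algebra. For an element of the group \<open>1 + J\<close> it is also the inverse
  in that group, but \<open>x + 1\<close> in the Cayley transform below is a unit outside \<open>1 + J\<close>.\<close>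

abbreviation uinv :: "'a::monoid_mult \<Rightarrow> 'a" where
  "uinv x \<equiv> inv\<^bsub>mult_monoid\<^esub> x"

definition algebra_group :: "'a::{ring,monoid_mult} set \<Rightarrow> 'a monoid" where
  "algebra_group J = \<lparr>carrier = {1 + a | a. a \<in> J}, mult = (*), one = 1\<rparr>"

definition group_act :: "('a::monoid_mult \<Rightarrow> 'a) \<Rightarrow> 'a \<Rightarrow> 'a" where
  "group_act \<sigma> x = \<sigma> (uinv x)"

definition alg_act :: "('a::ring \<Rightarrow> 'a) \<Rightarrow> 'a \<Rightarrow> 'a" where
  "alg_act \<sigma> a = - \<sigma> a"

definition fixed_group :: "('a::{ring,monoid_mult} \<Rightarrow> 'a) \<Rightarrow> 'a set \<Rightarrow> 'a monoid" where
  "fixed_group \<sigma> J =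
     (algebra_group J)\<lparr>carrier := {x \<in> carrier (algebra_group J). group_act \<sigma> x = x}\<rparr>"

definition cayley_inv :: "'a::{ring,monoid_mult} \<Rightarrow> 'a" where
  "cayley_inv x = (x - 1) * uinv (x + 1)"

text \<open>Linear characters of the additive group of \<open>J\<close> also vanish off \<open>J\<close>. If \<open>x \<in> 1 + J\<close>, then
  \<open>a \<in> J \<longleftrightarrow> uinv x * a \<in> J \<longleftrightarrow> a * uinv x \<in> J\<close>, and similarly
  \<open>a \<in> J \<longleftrightarrow> alg_act \<sigma> a \<in> J\<close>, so the actions below preserve this convention.\<close>

definition dual :: "'a::ring set \<Rightarrow> ('a \<Rightarrow> complex) set" where
  "dual J = {l. (\<forall>a\<in>J. \<forall>b\<in>J. l (a + b) = l a * l b) \<and>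
                 (\<forall>a\<in>J. l a \<noteq> 0) \<and> (\<forall>a. a \<notin> J \<longrightarrow> l a = 0)}"

definition left_act :: "'a::{ring,monoid_mult} \<Rightarrow> ('a \<Rightarrow> complex) \<Rightarrow> 'a \<Rightarrow> complex" where
  "left_act x l a = l (uinv x * a)"

definition right_act :: "('a::{ring,monoid_mult} \<Rightarrow> complex) \<Rightarrow> 'a \<Rightarrow> 'a \<Rightarrow> complex" where
  "right_act l x a = l (a * uinv x)"

definition left_orbit :: "'a::{ring,monoid_mult} set \<Rightarrow> ('a \<Rightarrow> complex) \<Rightarrow> ('a \<Rightarrow> complex) set" where
  "left_orbit J l = {left_act x l | x. x \<in> carrier (algebra_group J)}"

definition double_orbit :: "'a::{ring,monoid_mult} set \<Rightarrow> ('a \<Rightarrow> complex) \<Rightarrow> ('a \<Rightarrow> complex) set" where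
  "double_orbit J l =
     {right_act (left_act x l) y | x y.
        x \<in> carrier (algebra_group J) \<and> y \<in> carrier (algebra_group J)}"

definition dual_act :: "('a::ring \<Rightarrow> 'a) \<Rightarrow> ('a \<Rightarrow> complex) \<Rightarrow> 'a \<Rightarrow> complex" where
  "dual_act \<sigma> l a = l (alg_act \<sigma> a)"

text \<open>The dual group of the additive group of \<open>\<sigma>\<close>-fixed points of \<open>J\<close>, identified via restriction with
  the group of \<open>\<sigma>\<close>-fixed linear characters of \<open>J\<close>.\<close>

definition fixed_dual :: "('a::ring \<Rightarrow> 'a) \<Rightarrow> 'a set \<Rightarrow> ('a \<Rightarrow> complex) set" where
  "fixed_dual \<sigma> J = {l \<in> dual J. dual_act \<sigma> l = l}"

definition Omega :: "('a::{ring,monoid_mult} \<Rightarrow> 'a) \<Rightarrow> 'a set \<Rightarrow> ('a \<Rightarrow> complex) \<Rightarrow> ('a \<Rightarrow> complex) set" where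
  "Omega \<sigma> J l = {m \<in> double_orbit J l. dual_act \<sigma> m = m}"

definition superchar :: "'a::{ring,monoid_mult} set \<Rightarrow> ('a \<Rightarrow> complex) \<Rightarrow> 'a \<Rightarrow> complex" where
  "superchar J l x =
     (if x \<in> carrier (algebra_group J)
      then of_nat (card (left_orbit J l)) / of_nat (card (double_orbit J l))
             * (\<Sum>m\<in>double_orbit J l. m (cayley_inv x))
      else 0)"

definition Irr_fixed :: "('a::{ring,monoid_mult} \<Rightarrow> 'a) \<Rightarrow> 'a set \<Rightarrow> ('a \<Rightarrow> complex) set" where
  "Irr_fixed \<sigma> J =
     {\<chi> \<in> Irr (algebra_group J). \<forall>x\<in>carrier (algebra_group J). \<chi> (group_act \<sigma> x) = \<chi> x}"

definition glauberman ::
    "('a::{ring,monoid_mult} \<Rightarrow> 'a) \<Rightarrow> 'a set \<Rightarrow> ('a \<Rightarrow> complex) \<Rightarrow> 'a \<Rightarrow> complex" where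
  "glauberman \<sigma> J \<chi> =
     (THE \<psi>. odd_constituent (fixed_group \<sigma> J) \<psi> (char_restrict (fixed_group \<sigma> J) \<chi>))"

definition X_set :: "('a::{ring,monoid_mult} \<Rightarrow> 'a) \<Rightarrow> 'a set \<Rightarrow> ('a \<Rightarrow> complex) \<Rightarrow> ('a \<Rightarrow> complex) set" where
  "X_set \<sigma> J l =
     {\<chi> \<in> Irr (fixed_group \<sigma> J).
        constituent (algebra_group J) (the_inv_into (Irr_fixed \<sigma> J) (glauberman \<sigma> J) \<chi>)
          (superchar J l)}"

definition \<sigma>_char :: "('a::{ring,monoid_mult} \<Rightarrow> 'a) \<Rightarrow> 'a set \<Rightarrow> ('a \<Rightarrow> complex) \<Rightarrow> 'a \<Rightarrow> complex" where
  "\<sigma>_char \<sigma> J l x = (\<Sum>\<chi>\<in>X_set \<sigma> J l. \<chi> 1 * \<chi> x)"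

end

theory Submission
  imports
    "Jordan_Normal_Form.Char_Poly"
    "HOL-Computational_Algebra.Fundamental_Theorem_Algebra"
    "HOL-Algebra.Multiplicative_Group"
    Defs
begin

text \<open>Write \<open>s(x)\<close> for the sum of \<open>\<mu>((x - 1)/2)\<close> over \<open>\<mu>\<close> in an orbit \<open>P\<lambda>P\<close>. The supercharacter of \<open>\<lambda>\<close> is a
  positive multiple of \<open>s\<close>. By orthogonality of the characters of \<open>J\<close>, the functions \<open>s\<close> of distinct
  orbits annihilate each other under convolution, and all of them together sum to a multiple of the
  delta function at 1. Being class functions, they act by scalars on an irreducible representation, so
  every irreducible character of \<open>P\<close> is a constituent of exactly one supercharacter, and the squares of
  the degrees of the constituents of the supercharacter of \<open>\<lambda>\<close> add up to \<open>|P\<lambda>P|\<close>.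

  This number is odd. Hence an orbit stable under \<open>\<sigma>\<close> contains a fixed point of \<open>\<sigma>\<close>, and \<open>\<sigma>\<close> also fixes some
  constituent of its supercharacter. Together with the bijectivity of the Glauberman correspondence,
  which is proved here for an involution through the values of the extended characters on the coset of
  the involution in the semidirect product, this gives the theorem.\<close>

text \<open>All parity comes from 2 being invertible on \<open>J\<close>: hence
  \<open>|J| = |P|\<close> is odd, orbits of \<open>P x P\<close> have odd size because it divides
  \<open>|J|^2\<close>, and squaring is injective on \<open>P\<close>. Involutions are then forced
  to have fixed points by counting with weight 1 (orbits) or with squared degrees (constituents).
  The second count makes every \<open>X_set\<close> non-empty; without it two values of
  \<open>\<sigma>_char\<close> could agree merely because both vanish. The expression
  \<open>(x - 1)/2\<close> is chosen because \<open>z x^-1 - 1 = (z - x) x^-1\<close> and an orbit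
  sum ignores the factor \<open>x^-1\<close> from \<open>P\<close>: convolution on the group becomes
  convolution on the additive group \<open>J\<close>. \<open>glauberman\<close> is a definite
  description and \<open>X_set\<close> applies its inverse, so existence, uniqueness and bijectivity
  must all be settled first. The device is that \<open>x c \<tau>(x)^-1\<close>, with
  \<open>c\<close> in the fixed subgroup \<open>C\<close>, takes each value in \<open>G\<close>
  exactly \<open>|C|\<close> times. Orthogonality on the coset thus becomes orthogonality on
  \<open>C\<close>. Surjectivity comes from an explicit twisted average.\<close>

section \<open>Subspaces, traces and sums of matrices\<close>

abbreviation vec_subspace :: "nat \<Rightarrow> complex vec set \<Rightarrow> bool" where
  "vec_subspace n W \<equiv> VectorSpace.subspace class_ring W (module_vec TYPE(complex) n)"

lemma subspace_vecI:
  assumes "W \<subseteq> carrier_vec n" "0\<^sub>v n \<in> W"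
    and "\<And>v w. v \<in> W \<Longrightarrow> w \<in> W \<Longrightarrow> v + w \<in> W"
    and "\<And>c v. v \<in> W \<Longrightarrow> c \<cdot>\<^sub>v v \<in> W"
  shows "vec_subspace n W"
  using assms vec_vs[where 'a=complex and n=n] vec_module[where 'a=complex and n=n]
  by (auto simp: VectorSpace.subspace_def LinearCombinations.submodule_def module_vec_simps class_ring_simps)

lemma subspace_vecD:
  assumes "vec_subspace n W"
  shows "W \<subseteq> carrier_vec n" "0\<^sub>v n \<in> W"
    and "\<And>v w. v \<in> W \<Longrightarrow> w \<in> W \<Longrightarrow> v + w \<in> W"
    and "\<And>c v. v \<in> W \<Longrightarrow> c \<cdot>\<^sub>v v \<in> W"
  using assms by (auto simp: VectorSpace.subspace_def LinearCombinations.submodule_def module_vec_simps class_ring_simps)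

lemma mat_trace_mult:
  fixes A B :: "'r::comm_semiring_0 mat"
  assumes "A \<in> carrier_mat n m" "B \<in> carrier_mat m n"
  shows "mat_trace (A * B) = (\<Sum>i<n. \<Sum>j<m. A $$ (i,j) * B $$ (j,i))"
  using assms by (auto simp: mat_trace_def scalar_prod_def atLeast0LessThan intro!: sum.cong)

lemma mat_trace_comm:
  fixes A B :: "'r::comm_semiring_0 mat"
  assumes "A \<in> carrier_mat n m" "B \<in> carrier_mat m n"
  shows "mat_trace (A * B) = mat_trace (B * A)"
  unfolding mat_trace_mult[OF assms] mat_trace_mult[OF assms(2,1)]
  by (subst sum.swap) (simp add: mult.commute)

text \<open>Cyclicity of the trace. \<open>P\<close> and \<open>Q\<close> may be rectangular, so
  that characters can be compared through an intertwiner between representations whose degrees are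
  not yet known to agree.\<close>

lemma mat_trace_similar:
  fixes A P Q :: "'r::comm_semiring_1 mat"
  assumes "A \<in> carrier_mat n n" "P \<in> carrier_mat m n" "Q \<in> carrier_mat n m" "Q * P = 1\<^sub>m n"
  shows "mat_trace (P * A * Q) = mat_trace A"
proof -
  have "mat_trace (P * A * Q) = mat_trace (Q * (P * A))"
    using assms by (intro mat_trace_comm[of _ m n]) auto
  also have "Q * (P * A) = A" using assms by (simp add: assoc_mult_mat[symmetric])
  finally show ?thesis .
qed

lemma mat_trace_smult:
  fixes A :: "'r::comm_semiring_0 mat"
  shows "A \<in> carrier_mat n n \<Longrightarrow> mat_trace (c \<cdot>\<^sub>m A) = c * mat_trace A"
  by (auto simp: mat_trace_def sum_distrib_left)

lemma mat_trace_one [simp]: "mat_trace (1\<^sub>m n :: 'r::comm_semiring_1 mat) = of_nat n"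
  by (simp add: mat_trace_def)

text \<open>Matrices of all sizes share one type that has no common zero, so a sum over a family
  needs its size as an argument. The empty family yields the zero matrix of that size.\<close>

definition mat_sum :: "nat \<Rightarrow> nat \<Rightarrow> ('x \<Rightarrow> 'r::comm_monoid_add mat) \<Rightarrow> 'x set \<Rightarrow> 'r mat" where
  "mat_sum n m f S = mat n m (\<lambda>ij. \<Sum>x\<in>S. f x $$ ij)"

lemma mat_sum_carrier [simp]: "mat_sum n m f S \<in> carrier_mat n m"
  by (simp add: mat_sum_def)

lemma index_mat_sum [simp]:
  "i < n \<Longrightarrow> j < m \<Longrightarrow> mat_sum n m f S $$ (i,j) = (\<Sum>x\<in>S. f x $$ (i,j))"
  by (simp add: mat_sum_def)

lemma dim_mat_sum [simp]: "dim_row (mat_sum n m f S) = n" "dim_col (mat_sum n m f S) = m"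
  by (simp_all add: mat_sum_def)

lemma mat_sum_cong:
  "(\<And>x. x \<in> S \<Longrightarrow> f x = g x) \<Longrightarrow> mat_sum n m f S = mat_sum n m g S"
  unfolding mat_sum_def by (intro cong_mat refl) (simp cong: sum.cong)

lemma mat_sum_reindex_bij_betw:
  "bij_betw h S T \<Longrightarrow> mat_sum n m (\<lambda>x. f (h x)) S = mat_sum n m f T"
  unfolding mat_sum_def by (intro cong_mat refl sum.reindex_bij_betw)

lemma mult_mat_sum:
  fixes A :: "'r::comm_semiring_0 mat"
  assumes "A \<in> carrier_mat k n" "\<And>x. x \<in> S \<Longrightarrow> f x \<in> carrier_mat n m"
  shows "A * mat_sum n m f S = mat_sum k m (\<lambda>x. A * f x) S"
proof (rule eq_matI)
  fix i j assume ij: "i < dim_row (mat_sum k m (\<lambda>x. A * f x) S)" "j < dim_col (mat_sum k m (\<lambda>x. A * f x) S)"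
  have "(A * mat_sum n m f S) $$ (i,j) = (\<Sum>l<n. A $$ (i,l) * (\<Sum>x\<in>S. f x $$ (l,j)))"
    using ij assms by (auto simp: scalar_prod_def atLeast0LessThan intro!: sum.cong)
  also have "\<dots> = (\<Sum>x\<in>S. \<Sum>l<n. A $$ (i,l) * f x $$ (l,j))"
    by (subst sum.swap) (simp add: sum_distrib_left)
  also have "\<dots> = (\<Sum>x\<in>S. (A * f x) $$ (i,j))"
  proof (rule sum.cong[OF refl])
    fix x assume "x \<in> S"
    from assms(2)[OF this] ij assms(1)
    show "(\<Sum>l<n. A $$ (i,l) * f x $$ (l,j)) = (A * f x) $$ (i,j)"
      by (auto simp: scalar_prod_def atLeast0LessThan intro!: sum.cong)
  qed
  finally show "(A * mat_sum n m f S) $$ (i,j) = mat_sum k m (\<lambda>x. A * f x) S $$ (i,j)"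
    using ij by simp
qed (use assms in auto)

lemma mat_sum_mult:
  fixes A :: "'r::comm_semiring_0 mat"
  assumes "A \<in> carrier_mat m k" "\<And>x. x \<in> S \<Longrightarrow> f x \<in> carrier_mat n m"
  shows "mat_sum n m f S * A = mat_sum n k (\<lambda>x. f x * A) S"
proof (rule eq_matI)
  fix i j assume ij: "i < dim_row (mat_sum n k (\<lambda>x. f x * A) S)" "j < dim_col (mat_sum n k (\<lambda>x. f x * A) S)"
  have "(mat_sum n m f S * A) $$ (i,j) = (\<Sum>l<m. (\<Sum>x\<in>S. f x $$ (i,l)) * A $$ (l,j))"
    using ij assms by (auto simp: scalar_prod_def atLeast0LessThan intro!: sum.cong)
  also have "\<dots> = (\<Sum>x\<in>S. \<Sum>l<m. f x $$ (i,l) * A $$ (l,j))"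
    by (subst sum.swap) (simp add: sum_distrib_right)
  also have "\<dots> = (\<Sum>x\<in>S. (f x * A) $$ (i,j))"
  proof (rule sum.cong[OF refl])
    fix x assume "x \<in> S"
    from assms(2)[OF this] ij assms(1)
    show "(\<Sum>l<m. f x $$ (i,l) * A $$ (l,j)) = (f x * A) $$ (i,j)"
      by (auto simp: scalar_prod_def atLeast0LessThan intro!: sum.cong)
  qed
  finally show "(mat_sum n m f S * A) $$ (i,j) = mat_sum n k (\<lambda>x. f x * A) S $$ (i,j)"
    using ij by simp
qed (use assms in auto)

lemma mat_trace_mat_sum:
  fixes f :: "'x \<Rightarrow> 'r::comm_monoid_add mat"
  assumes "\<And>x. x \<in> S \<Longrightarrow> f x \<in> carrier_mat n n"
  shows "mat_trace (mat_sum n n f S) = (\<Sum>x\<in>S. mat_trace (f x))"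
proof -
  have "mat_trace (mat_sum n n f S) = (\<Sum>x\<in>S. \<Sum>i<n. f x $$ (i,i))"
    by (simp add: mat_trace_def) (subst sum.swap, simp)
  also have "\<dots> = (\<Sum>x\<in>S. mat_trace (f x))"
    using assms by (intro sum.cong refl) (auto simp: mat_trace_def)
  finally show ?thesis .
qed

section \<open>Schur's lemma and the orthogonality relations\<close>

lemma matrix_repD:
  assumes "matrix_rep G n \<rho>"
  shows "x \<in> carrier G \<Longrightarrow> \<rho> x \<in> carrier_mat n n" "\<rho> \<one>\<^bsub>G\<^esub> = 1\<^sub>m n"
    "x \<in> carrier G \<Longrightarrow> y \<in> carrier G \<Longrightarrow> \<rho> (x \<otimes>\<^bsub>G\<^esub> y) = \<rho> x * \<rho> y"
  using assms by (auto simp: matrix_rep_def)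

lemma irreducible_repD:
  assumes "irreducible_rep G n \<rho>"
  shows "matrix_rep G n \<rho>" "n > 0"
    "vec_subspace n W \<Longrightarrow>
      (\<And>x w. x \<in> carrier G \<Longrightarrow> w \<in> W \<Longrightarrow> \<rho> x *\<^sub>v w \<in> W) \<Longrightarrow>
      W = {0\<^sub>v n} \<or> W = carrier_vec n"
  using assms by (auto simp: irreducible_rep_def)

lemma mult_mat_vec_unit_vec:
  fixes A :: "'r::semiring_1 mat"
  assumes "A \<in> carrier_mat n m" "j < m"
  shows "A *\<^sub>v unit_vec m j = col A j"
  using assms by (intro eq_vecI) auto

lemma mult_mat_vec_zero_imp_zero:
  fixes A :: "'r::semiring_1 mat"
  assumes "A \<in> carrier_mat n m" "\<And>v. v \<in> carrier_vec m \<Longrightarrow> A *\<^sub>v v = 0\<^sub>v n"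
  shows "A = 0\<^sub>m n m"
proof (rule eq_matI)
  fix i j assume "i < dim_row (0\<^sub>m n m :: 'r mat)" "j < dim_col (0\<^sub>m n m :: 'r mat)"
  then have ij: "i < n" "j < m" by auto
  have "col A j = 0\<^sub>v n"
    using mult_mat_vec_unit_vec[OF assms(1) ij(2)] assms(2)[of "unit_vec m j"] by simp
  then have "col A j $ i = 0" using ij by simp
  then show "A $$ (i,j) = 0\<^sub>m n m $$ (i,j)" using ij assms(1) by simp
qed (use assms in auto)

text \<open>The kernel of \<open>T\<close> is invariant under \<open>\<rho>'\<close> and its image
  under \<open>\<rho>\<close>, so \<open>T \<noteq> 0\<close> leaves only kernel zero and full
  image. As \<open>n = m\<close> is not known in advance, the inverse is assembled from preimages of
  the unit vectors; that it is also a left inverse follows from injectivity of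
  \<open>T\<close>.\<close>

theorem schur_lemma:
  assumes \<rho>: "irreducible_rep G n \<rho>" and \<rho>': "irreducible_rep G m \<rho>'"
    and T: "T \<in> carrier_mat n m" "T \<noteq> 0\<^sub>m n m"
    and comm: "\<And>x. x \<in> carrier G \<Longrightarrow> \<rho> x * T = T * \<rho>' x"
  obtains S where "S \<in> carrier_mat m n" "T * S = 1\<^sub>m n" "S * T = 1\<^sub>m m"
proof -
  note r = matrix_repD[OF irreducible_repD(1)[OF \<rho>]] and r' = matrix_repD[OF irreducible_repD(1)[OF \<rho>']]
  let ?K = "{v \<in> carrier_vec m. T *\<^sub>v v = 0\<^sub>v n}"
  let ?I = "(*\<^sub>v) T ` carrier_vec m"
  have "?K = {0\<^sub>v m} \<or> ?K = carrier_vec m"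
  proof (rule irreducible_repD(3)[OF \<rho>'])
    show "vec_subspace m ?K"
      by (rule subspace_vecI) (use T(1) in \<open>auto simp: mult_add_distrib_mat_vec mult_mat_vec\<close>)
  next
    fix x w assume x: "x \<in> carrier G" and w: "w \<in> ?K"
    have "T *\<^sub>v (\<rho>' x *\<^sub>v w) = (T * \<rho>' x) *\<^sub>v w"
      using T(1) r'(1)[OF x] w by (subst assoc_mult_mat_vec) auto
    also have "\<dots> = \<rho> x *\<^sub>v (T *\<^sub>v w)"
      unfolding comm[OF x, symmetric] using T(1) r(1)[OF x] w by (subst assoc_mult_mat_vec) auto
    also have "\<dots> = 0\<^sub>v n" using w r(1)[OF x] by auto
    finally show "\<rho>' x *\<^sub>v w \<in> ?K" using r'(1)[OF x] w by auto
  qed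
  moreover have "?K \<noteq> carrier_vec m"
    using mult_mat_vec_zero_imp_zero[OF T(1)] T(2) by blast
  ultimately have K: "?K = {0\<^sub>v m}" by blast
  have "?I = {0\<^sub>v n} \<or> ?I = carrier_vec n"
  proof (rule irreducible_repD(3)[OF \<rho>])
    show "vec_subspace n ?I"
    proof (rule subspace_vecI)
      show "0\<^sub>v n \<in> ?I" using T(1) by (intro image_eqI[of _ _ "0\<^sub>v m"]) auto
      show "v + w \<in> ?I" if "v \<in> ?I" "w \<in> ?I" for v w
        using that T(1) by (auto simp: mult_add_distrib_mat_vec[symmetric])
      show "c \<cdot>\<^sub>v v \<in> ?I" if "v \<in> ?I" for c v
        using that T(1) by (auto simp: mult_mat_vec[symmetric])
    qed (use T(1) in auto)
  next
    fix x w assume x: "x \<in> carrier G" and w: "w \<in> ?I"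
    then obtain v where v: "v \<in> carrier_vec m" "w = T *\<^sub>v v" by auto
    have "\<rho> x *\<^sub>v w = (\<rho> x * T) *\<^sub>v v"
      unfolding v(2) using T(1) r(1)[OF x] v by (subst assoc_mult_mat_vec) auto
    also have "\<dots> = T *\<^sub>v (\<rho>' x *\<^sub>v v)"
      unfolding comm[OF x] using T(1) r'(1)[OF x] v by (subst assoc_mult_mat_vec) auto
    finally show "\<rho> x *\<^sub>v w \<in> ?I" using r'(1)[OF x] v by auto
  qed
  moreover have "?I \<noteq> {0\<^sub>v n}"
    using mult_mat_vec_zero_imp_zero[OF T(1)] T(2) by blast
  ultimately have I: "?I = carrier_vec n" by blast
  have "\<exists>v. v \<in> carrier_vec m \<and> T *\<^sub>v v = unit_vec n j" for j
  proof -
    have "unit_vec n j \<in> ?I" unfolding I by simp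
    then show ?thesis by auto
  qed
  then obtain s where s: "\<And>j. s j \<in> carrier_vec m" "\<And>j. T *\<^sub>v s j = unit_vec n j" by metis
  define S where "S = mat_of_cols m (map s [0..<n])"
  have S: "S \<in> carrier_mat m n" using mat_of_cols_carrier(1)[of m "map s [0..<n]"] by (simp add: S_def)
  have colS: "col S j = s j" if "j < n" for j using that s by (simp add: S_def)
  have TS: "T * S = 1\<^sub>m n"
  proof (rule eq_matI)
    fix i j assume ij: "i < dim_row (1\<^sub>m n :: complex mat)" "j < dim_col (1\<^sub>m n :: complex mat)"
    have "(T * S) $$ (i,j) = (T *\<^sub>v s j) $ i" using ij T(1) S by (simp add: colS)
    then show "(T * S) $$ (i,j) = 1\<^sub>m n $$ (i,j)" using ij by (auto simp: s)
  qed (use T(1) S in auto)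
  have "S * T = 1\<^sub>m m"
  proof -
    have "v = w" if "T *\<^sub>v v = T *\<^sub>v w" "v \<in> carrier_vec m" "w \<in> carrier_vec m" for v w
    proof -
      have "v - w \<in> ?K" using that T(1) by (simp add: mult_minus_distrib_mat_vec)
      then have "v - w = 0\<^sub>v m" using K by blast
      then have "(v - w) + w = w" using that by simp
      moreover have "(v - w) + w = v" using that by (intro eq_vecI) auto
      ultimately show ?thesis by simp
    qed note inj = this
    have "(S * T) *\<^sub>v v = v" if v: "v \<in> carrier_vec m" for v
    proof (rule inj)
      have "T *\<^sub>v ((S * T) *\<^sub>v v) = (T * S) *\<^sub>v (T *\<^sub>v v)"
        using T(1) S v by (simp add: assoc_mult_mat_vec[of _ n m _ n] assoc_mult_mat_vec[of _ m n _ m])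
      then show "T *\<^sub>v ((S * T) *\<^sub>v v) = T *\<^sub>v v" using TS T(1) v by simp
    qed (use v S T(1) in auto)
    then have "col (S * T) j = unit_vec m j" if "j < m" for j
      using mult_mat_vec_unit_vec[of "S * T" m m j] that S T(1) by simp
    then show ?thesis using S T(1)
      by (intro eq_matI) (simp_all add: col_def vec_eq_iff unit_vec_def)
  qed
  with TS S show thesis using that by blast
qed

text \<open>Over the complex numbers \<open>T\<close> has an eigenvalue \<open>c\<close>. The matrix
  \<open>T - c 1\<close> commutes with \<open>\<rho>\<close> and kills an eigenvector, so it is not
  invertible and must be zero. The scalar is expressed through the trace because the trace is what
  every application can compute.\<close>

lemma schur_lemma_scalar:
  assumes \<rho>: "irreducible_rep G n \<rho>" and T: "T \<in> carrier_mat n n"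
    and comm: "\<And>x. x \<in> carrier G \<Longrightarrow> \<rho> x * T = T * \<rho> x"
  shows "T = (mat_trace T / of_nat n) \<cdot>\<^sub>m 1\<^sub>m n"
proof -
  note r = matrix_repD[OF irreducible_repD(1)[OF \<rho>]]
  have n: "n > 0" using irreducible_repD(2)[OF \<rho>] .
  have "\<not> constant (poly (char_poly T))"
    using degree_monic_char_poly[OF T] n by (simp add: constant_degree)
  then obtain c where "eigenvalue T c"
    using fundamental_theorem_of_algebra eigenvalue_root_char_poly[OF T] by blast
  then obtain v where v: "v \<in> carrier_vec n" "v \<noteq> 0\<^sub>v n" "T *\<^sub>v v = c \<cdot>\<^sub>v v"
    using T by (auto simp: eigenvalue_def eigenvector_def)
  let ?D = "T - c \<cdot>\<^sub>m 1\<^sub>m n"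
  have D: "?D \<in> carrier_mat n n" using T by auto
  have "?D = 0\<^sub>m n n"
  proof (rule ccontr)
    assume "?D \<noteq> 0\<^sub>m n n"
    moreover have "\<rho> x * ?D = ?D * \<rho> x" if x: "x \<in> carrier G" for x
      using T r(1)[OF x] comm[OF x]
      by (simp add: mult_minus_distrib_mat[of _ n n _ n] minus_mult_distrib_mat[of _ n n _ _ n]
        mult_smult_distrib[of _ n n _ n] mult_smult_assoc_mat[of _ n n _ n])
    ultimately obtain S where S: "S \<in> carrier_mat n n" "S * ?D = 1\<^sub>m n"
      using schur_lemma[OF \<rho> \<rho> D] by metis
    have "?D *\<^sub>v v = T *\<^sub>v v - (c \<cdot>\<^sub>m 1\<^sub>m n) *\<^sub>v v"
      using T v by (subst minus_mult_distrib_mat_vec) auto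
    also have "(c \<cdot>\<^sub>m 1\<^sub>m n) *\<^sub>v v = c \<cdot>\<^sub>v v" using v(1) by (intro eq_vecI) (auto simp: row_def scalar_prod_def if_distrib sum.If_cases if_distribR cong: if_cong)
    also have "T *\<^sub>v v - c \<cdot>\<^sub>v v = 0\<^sub>v n" using v by simp
    finally have "?D *\<^sub>v v = 0\<^sub>v n" .
    then have "(S * ?D) *\<^sub>v v = 0\<^sub>v n" using S D v(1) by (subst assoc_mult_mat_vec[of _ n n _ n]) auto
    then show False using S(2) v by simp
  qed
  have eq: "T = c \<cdot>\<^sub>m 1\<^sub>m n"
  proof (rule eq_matI)
    fix i j assume ij: "i < dim_row (c \<cdot>\<^sub>m 1\<^sub>m n)" "j < dim_col (c \<cdot>\<^sub>m 1\<^sub>m n)"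
    have "?D $$ (i,j) = 0" using \<open>?D = 0\<^sub>m n n\<close> ij by simp
    then show "T $$ (i,j) = (c \<cdot>\<^sub>m 1\<^sub>m n) $$ (i,j)" using ij T by simp
  qed (use T in auto)
  then have "mat_trace T = c * of_nat n" using mat_trace_smult[of "1\<^sub>m n" n c] by simp
  then show ?thesis using eq n by simp
qed

lemma invertible_matI:
  fixes A :: "'r::field mat"
  assumes A: "A \<in> carrier_mat n n"
    and "\<And>v. v \<in> carrier_vec n \<Longrightarrow> A *\<^sub>v v = 0\<^sub>v n \<Longrightarrow> v = 0\<^sub>v n"
  obtains B where "B \<in> carrier_mat n n" "A * B = 1\<^sub>m n" "B * A = 1\<^sub>m n"
proof -
  have "det A \<noteq> 0" using assms(2) by (auto simp: det_0_iff_vec_prod_zero_field[OF A])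
  then have "A \<in> Units (ring_mat TYPE('r) n ())" by (rule det_non_zero_imp_unit[OF A])
  then show ?thesis using that by (auto simp: Units_def ring_mat_simps)
qed

lemma mult3_carrier_mat:
  "A \<in> carrier_mat n n \<Longrightarrow> E \<in> carrier_mat n m \<Longrightarrow> B \<in> carrier_mat m m \<Longrightarrow> A * E * B \<in> carrier_mat n m"
  by auto

text \<open>Elementary matrices. Their averages over the group are the intertwiners whose entries
  are the sums of products of matrix coefficients that occur in the orthogonality relations.\<close>

definition unit_mat :: "nat \<Rightarrow> nat \<Rightarrow> nat \<Rightarrow> nat \<Rightarrow> complex mat" where
  "unit_mat n m j k = mat n m (\<lambda>(a,b). if a = j \<and> b = k then 1 else 0)"

lemma unit_mat_carrier [simp]: "unit_mat n m j k \<in> carrier_mat n m"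
  by (simp add: unit_mat_def)

lemma mult_unit_mat_mult:
  assumes "A \<in> carrier_mat n n" "B \<in> carrier_mat m m" "i < n" "j < n" "k < m" "l < m"
  shows "(A * unit_mat n m j k * B) $$ (i,l) = A $$ (i,j) * B $$ (k,l)"
proof -
  have "(A * unit_mat n m j k) $$ (i,b) = (if b = k then A $$ (i,j) else 0)" if "b < m" for b
  proof -
    have "(A * unit_mat n m j k) $$ (i,b) = (\<Sum>a<n. A $$ (i,a) * (if a = j \<and> b = k then 1 else 0))"
      using assms that by (auto simp: unit_mat_def scalar_prod_def atLeast0LessThan intro!: sum.cong)
    also have "\<dots> = (\<Sum>a<n. if a = j then (if b = k then A $$ (i,a) else 0) else 0)"
      by (intro sum.cong) auto
    also have "\<dots> = (if b = k then A $$ (i,j) else 0)" using assms by (subst sum.delta) auto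
    finally show ?thesis .
  qed
  note * = this
  have "(A * unit_mat n m j k * B) $$ (i,l) = (\<Sum>b<m. (A * unit_mat n m j k) $$ (i,b) * B $$ (b,l))"
    using assms by (auto simp: scalar_prod_def atLeast0LessThan unit_mat_def intro!: sum.cong)
  also have "\<dots> = (\<Sum>b<m. if b = k then A $$ (i,j) * B $$ (b,l) else 0)"
    by (intro sum.cong) (auto simp: *)
  also have "\<dots> = A $$ (i,j) * B $$ (k,l)" using assms by (subst sum.delta) auto
  finally show ?thesis .
qed

locale fin_group = group G for G (structure) +
  assumes finite_carrier: "finite (carrier G)"
begin

lemma card_carrier_pos: "card (carrier G) > 0"
  using finite_carrier by (auto simp: card_gt_0_iff)

lemma bij_betw_left_mult: "a \<in> carrier G \<Longrightarrow> bij_betw ((\<otimes>) a) (carrier G) (carrier G)"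
  by (rule bij_betwI[where g="(\<otimes>) (inv a)"]) (auto simp: m_assoc[symmetric])

lemma bij_betw_right_mult: "a \<in> carrier G \<Longrightarrow> bij_betw (\<lambda>x. x \<otimes> a) (carrier G) (carrier G)"
  by (rule bij_betwI[where g="\<lambda>x. x \<otimes> inv a"]) (auto simp: m_assoc)

lemma rep_inv:
  assumes "matrix_rep G n \<rho>" "x \<in> carrier G"
  shows "\<rho> x * \<rho> (inv x) = 1\<^sub>m n" "\<rho> (inv x) * \<rho> x = 1\<^sub>m n"
  using matrix_repD(2)[OF assms(1)] matrix_repD(3)[OF assms(1), of x "inv x"]
    matrix_repD(3)[OF assms(1), of "inv x" x] assms(2) by auto

text \<open>Replacing \<open>x\<close> by \<open>y \<otimes> x\<close> in the average trades
  \<open>\<rho> y\<close> on the left for \<open>\<rho>' y\<close> on the right.\<close>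

lemma intertwiner_average:
  assumes \<rho>: "matrix_rep G n \<rho>" and \<rho>': "matrix_rep G m \<rho>'" and E: "E \<in> carrier_mat n m"
    and y: "y \<in> carrier G"
  defines "T \<equiv> mat_sum n m (\<lambda>x. \<rho> x * E * \<rho>' (inv x)) (carrier G)"
  shows "\<rho> y * T = T * \<rho>' y"
proof -
  note r = matrix_repD[OF \<rho>] and r' = matrix_repD[OF \<rho>']
  have "\<rho> y * T = mat_sum n m (\<lambda>x. \<rho> y * (\<rho> x * E * \<rho>' (inv x))) (carrier G)"
    unfolding T_def using r(1)[OF y] r(1) r'(1) E by (intro mult_mat_sum mult3_carrier_mat) auto
  also have "\<dots> = mat_sum n m (\<lambda>x. \<rho> (y \<otimes> x) * E * \<rho>' (inv (y \<otimes> x)) * \<rho>' y) (carrier G)"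
  proof (rule mat_sum_cong)
    fix x assume x: "x \<in> carrier G"
    have 1: "\<rho> (y \<otimes> x) = \<rho> y * \<rho> x" using r(3) x y by auto
    have 2: "\<rho>' (inv (y \<otimes> x)) * \<rho>' y = \<rho>' (inv x)"
      using r'(3)[of "inv (y \<otimes> x)" y] x y by (simp add: inv_mult_group m_assoc)
    have "\<rho> (y \<otimes> x) * E * \<rho>' (inv (y \<otimes> x)) * \<rho>' y = \<rho> (y \<otimes> x) * E * \<rho>' (inv x)"
      using r(1)[of "y \<otimes> x"] r'(1)[of "inv (y \<otimes> x)"] r'(1)[OF y] E x y
      by (subst assoc_mult_mat[of _ n m _ m _ m]) (auto simp: 2)
    also have "\<dots> = \<rho> y * (\<rho> x * E * \<rho>' (inv x))"
      unfolding 1 using r(1)[OF x] r(1)[OF y] r'(1)[of "inv x"] E x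
      by (simp add: assoc_mult_mat[of _ n n _ n] assoc_mult_mat[of _ n n _ m] assoc_mult_mat[of _ n m _ m])
    finally show "\<rho> y * (\<rho> x * E * \<rho>' (inv x)) = \<rho> (y \<otimes> x) * E * \<rho>' (inv (y \<otimes> x)) * \<rho>' y" ..
  qed
  also have "\<dots> = mat_sum n m (\<lambda>x. \<rho> x * E * \<rho>' (inv x) * \<rho>' y) (carrier G)"
    by (rule mat_sum_reindex_bij_betw[OF bij_betw_left_mult[OF y], where f="\<lambda>x. \<rho> x * E * \<rho>' (inv x) * \<rho>' y"])
  also have "\<dots> = T * \<rho>' y"
    unfolding T_def using r'(1)[OF y] r(1) r'(1) E by (intro mat_sum_mult[symmetric] mult3_carrier_mat) auto
  finally show ?thesis .
qed

text \<open>After expanding both traces, the sum over \<open>x\<close> of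
  \<open>\<rho>(x)_ij \<rho>'(x^-1)_kl\<close> is the entry \<open>(i,l)\<close> of the average of
  the elementary matrix at \<open>(j,k)\<close>, so Schur's lemma decides everything. The factors
  \<open>A\<close> and \<open>B\<close> are there because the relations are needed for traces
  against a twisting matrix as well as for plain characters.\<close>

lemma trace_product_sum:
  assumes \<rho>: "matrix_rep G n \<rho>" and \<rho>': "matrix_rep G m \<rho>'"
    and A: "A \<in> carrier_mat n n" and B: "B \<in> carrier_mat m m"
  defines "T \<equiv> \<lambda>j k. mat_sum n m (\<lambda>x. \<rho> x * unit_mat n m j k * \<rho>' (inv x)) (carrier G)"
  shows "(\<Sum>x\<in>carrier G. mat_trace (\<rho> x * A) * mat_trace (\<rho>' (inv x) * B)) =
    (\<Sum>i<n. \<Sum>j<n. \<Sum>k<m. \<Sum>l<m. A $$ (j,i) * B $$ (l,k) * T j k $$ (i,l))"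
proof -
  note r = matrix_repD[OF \<rho>] and r' = matrix_repD[OF \<rho>']
  have "(\<Sum>x\<in>carrier G. mat_trace (\<rho> x * A) * mat_trace (\<rho>' (inv x) * B)) =
      (\<Sum>x\<in>carrier G. \<Sum>i<n. \<Sum>j<n. \<Sum>k<m. \<Sum>l<m.
        A $$ (j,i) * B $$ (l,k) * (\<rho> x $$ (i,j) * \<rho>' (inv x) $$ (k,l)))"
  proof (rule sum.cong[OF refl])
    fix x assume x: "x \<in> carrier G"
    have 1: "mat_trace (\<rho> x * A) = (\<Sum>i<n. \<Sum>j<n. \<rho> x $$ (i,j) * A $$ (j,i))"
      using r(1)[OF x] A by (intro mat_trace_mult) auto
    have 2: "mat_trace (\<rho>' (inv x) * B) = (\<Sum>k<m. \<Sum>l<m. \<rho>' (inv x) $$ (k,l) * B $$ (l,k))"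
      using r'(1)[of "inv x"] x B by (intro mat_trace_mult) auto
    show "mat_trace (\<rho> x * A) * mat_trace (\<rho>' (inv x) * B) = (\<Sum>i<n. \<Sum>j<n. \<Sum>k<m. \<Sum>l<m.
        A $$ (j,i) * B $$ (l,k) * (\<rho> x $$ (i,j) * \<rho>' (inv x) $$ (k,l)))"
      unfolding 1 2
      by (simp only: sum_distrib_right, simp only: sum_distrib_left) (simp only: mult_ac)
  qed
  also have "\<dots> = (\<Sum>i<n. \<Sum>j<n. \<Sum>k<m. \<Sum>l<m. \<Sum>x\<in>carrier G.
        A $$ (j,i) * B $$ (l,k) * (\<rho> x $$ (i,j) * \<rho>' (inv x) $$ (k,l)))"
    by (simp only: sum.swap[where A="carrier G"])
  also have "\<dots> = (\<Sum>i<n. \<Sum>j<n. \<Sum>k<m. \<Sum>l<m. A $$ (j,i) * B $$ (l,k) * T j k $$ (i,l))"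
  proof (intro sum.cong refl)
    fix i j k l assume ij: "i \<in> {..<n}" "j \<in> {..<n}" "k \<in> {..<m}" "l \<in> {..<m}"
    have "T j k $$ (i,l) = (\<Sum>x\<in>carrier G. \<rho> x $$ (i,j) * \<rho>' (inv x) $$ (k,l))"
      unfolding T_def using ij r(1) r'(1) by (simp add: mult_unit_mat_mult cong: sum.cong)
    then show "(\<Sum>x\<in>carrier G. A $$ (j,i) * B $$ (l,k) * (\<rho> x $$ (i,j) * \<rho>' (inv x) $$ (k,l))) =
        A $$ (j,i) * B $$ (l,k) * T j k $$ (i,l)"
      by (simp add: sum_distrib_left)
  qed
  finally show ?thesis .
qed

text \<open>The absence of nonzero intertwiners is taken as the hypothesis since the lemma is used
  in two directions: for distinct characters, and contrapositively to produce an intertwiner from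
  equal characters.\<close>

lemma trace_orthogonality_distinct:
  assumes \<rho>: "irreducible_rep G n \<rho>" and \<rho>': "irreducible_rep G m \<rho>'"
    and A: "A \<in> carrier_mat n n" and B: "B \<in> carrier_mat m m"
    and no: "\<And>T. T \<in> carrier_mat n m \<Longrightarrow> (\<And>x. x \<in> carrier G \<Longrightarrow> \<rho> x * T = T * \<rho>' x) \<Longrightarrow> T = 0\<^sub>m n m"
  shows "(\<Sum>x\<in>carrier G. mat_trace (\<rho> x * A) * mat_trace (\<rho>' (inv x) * B)) = 0"
proof -
  note m = irreducible_repD(1)[OF \<rho>] and m' = irreducible_repD(1)[OF \<rho>']
  have "mat_sum n m (\<lambda>x. \<rho> x * unit_mat n m j k * \<rho>' (inv x)) (carrier G) = 0\<^sub>m n m" for j k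
    by (rule no) (auto intro!: intertwiner_average m m')
  then show ?thesis unfolding trace_product_sum[OF m m' A B] by simp
qed

text \<open>The average of the elementary matrix at \<open>(j,k)\<close> is a scalar matrix whose
  trace is \<open>|G|\<close> if \<open>j = k\<close> and 0 otherwise, which fixes all its
  entries.\<close>

lemma trace_orthogonality_same:
  assumes \<rho>: "irreducible_rep G n \<rho>"
    and A: "A \<in> carrier_mat n n" and B: "B \<in> carrier_mat n n"
  shows "(\<Sum>x\<in>carrier G. mat_trace (\<rho> x * A) * mat_trace (\<rho> (inv x) * B)) =
    of_nat (card (carrier G)) * mat_trace (A * B) / of_nat n"
proof -
  note m = irreducible_repD(1)[OF \<rho>]
  note r = matrix_repD[OF m]
  let ?T = "\<lambda>j k. mat_sum n n (\<lambda>x. \<rho> x * unit_mat n n j k * \<rho> (inv x)) (carrier G)"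
  let ?N = "of_nat (card (carrier G)) :: complex"
  have T: "?T j k $$ (i,l) = (if j = k \<and> i = l then ?N / of_nat n else 0)"
    if "i < n" "j < n" "k < n" "l < n" for i j k l
  proof -
    have "mat_trace (?T j k) = (\<Sum>x\<in>carrier G. mat_trace (\<rho> x * unit_mat n n j k * \<rho> (inv x)))"
    proof (rule mat_trace_mat_sum)
      fix x assume x: "x \<in> carrier G"
      show "\<rho> x * unit_mat n n j k * \<rho> (inv x) \<in> carrier_mat n n"
        using r(1)[OF x] r(1)[of "inv x"] x by auto
    qed
    also have "\<dots> = (\<Sum>x\<in>carrier G. mat_trace (unit_mat n n j k))"
    proof (rule sum.cong[OF refl])
      fix x assume x: "x \<in> carrier G"
      show "mat_trace (\<rho> x * unit_mat n n j k * \<rho> (inv x)) = mat_trace (unit_mat n n j k)"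
        by (rule mat_trace_similar[of _ n]) (use r(1)[OF x] r(1)[of "inv x"] x rep_inv[OF m x] in auto)
    qed
    also have "mat_trace (unit_mat n n j k) = (if j = k then 1 else 0)"
      using that by (auto simp: mat_trace_def unit_mat_def intro!: sum.neutral)
    finally have tr: "mat_trace (?T j k) = (if j = k then ?N else 0)" by simp
    have "?T j k = (mat_trace (?T j k) / of_nat n) \<cdot>\<^sub>m 1\<^sub>m n"
      by (rule schur_lemma_scalar[OF \<rho>]) (auto intro!: intertwiner_average m)
    then have "?T j k $$ (i,l) = ((mat_trace (?T j k) / of_nat n) \<cdot>\<^sub>m 1\<^sub>m n) $$ (i,l)" by (rule arg_cong)
    also have "\<dots> = (if j = k \<and> i = l then ?N / of_nat n else 0)" unfolding tr using that by auto
    finally show ?thesis .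
  qed
  have "(\<Sum>x\<in>carrier G. mat_trace (\<rho> x * A) * mat_trace (\<rho> (inv x) * B)) =
      (\<Sum>i<n. \<Sum>j<n. \<Sum>k<n. \<Sum>l<n. A $$ (j,i) * B $$ (l,k) * ?T j k $$ (i,l))"
    by (rule trace_product_sum[OF m m A B])
  also have "\<dots> = (\<Sum>i<n. \<Sum>j<n. A $$ (j,i) * B $$ (i,j) * (?N / of_nat n))"
  proof (intro sum.cong refl)
    fix i j assume ij: "i \<in> {..<n}" "j \<in> {..<n}"
    have "(\<Sum>k<n. \<Sum>l<n. A $$ (j,i) * B $$ (l,k) * ?T j k $$ (i,l)) =
      (\<Sum>k<n. \<Sum>l<n. if l = i then (if k = j then A $$ (j,i) * B $$ (l,k) * (?N / of_nat n) else 0) else 0)"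
      using ij by (intro sum.cong refl) (subst T, auto)
    also have "\<dots> = A $$ (j,i) * B $$ (i,j) * (?N / of_nat n)"
      using ij by (simp add: sum.delta)
    finally show "(\<Sum>k<n. \<Sum>l<n. A $$ (j,i) * B $$ (l,k) * ?T j k $$ (i,l)) =
      A $$ (j,i) * B $$ (i,j) * (?N / of_nat n)" .
  qed
  also have "\<dots> = ?N / of_nat n * (\<Sum>j<n. \<Sum>i<n. A $$ (j,i) * B $$ (i,j))"
    by (subst sum.swap) (simp add: sum_distrib_left mult_ac)
  also have "\<dots> = ?N * mat_trace (A * B) / of_nat n"
    by (simp add: mat_trace_mult[OF A B])
  finally show ?thesis .
qed

text \<open>A positive definite form invariant under the group: \<open>\<rho> y\<close> is unitary with respect to it.\<close>

lemma cnj_mat_trace: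
  assumes \<rho>: "matrix_rep G n \<rho>" and y: "y \<in> carrier G"
  shows "cnj (mat_trace (\<rho> y)) = mat_trace (\<rho> (inv y))"
proof -
  note r = matrix_repD[OF \<rho>]
  define adj :: "complex mat \<Rightarrow> complex mat" where
    "adj A = mat (dim_col A) (dim_row A) (\<lambda>(i,j). cnj (A $$ (j,i)))" for A
  have adj_carrier: "adj A \<in> carrier_mat m k" if "A \<in> carrier_mat k m" for A k m
    using that by (auto simp: adj_def)
  have adj_mult: "adj (A * B) = adj B * adj A" if "A \<in> carrier_mat n n" "B \<in> carrier_mat n n" for A B
    using that by (intro eq_matI) (auto simp: adj_def scalar_prod_def mult.commute)
  define H where "H = mat_sum n n (\<lambda>x. adj (\<rho> x) * \<rho> x) (carrier G)"
  have H: "H \<in> carrier_mat n n" by (simp add: H_def)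
  have inv_H: "adj (\<rho> y) * H * \<rho> y = H"
  proof -
    have "adj (\<rho> y) * H = mat_sum n n (\<lambda>x. adj (\<rho> y) * (adj (\<rho> x) * \<rho> x)) (carrier G)"
      unfolding H_def by (rule mult_mat_sum) (use r(1) y adj_carrier in \<open>auto intro!: mult_carrier_mat\<close>)
    then have "adj (\<rho> y) * H * \<rho> y = mat_sum n n (\<lambda>x. adj (\<rho> y) * (adj (\<rho> x) * \<rho> x)) (carrier G) * \<rho> y"
      by simp
    also have "\<dots> = mat_sum n n (\<lambda>x. adj (\<rho> y) * (adj (\<rho> x) * \<rho> x) * \<rho> y) (carrier G)"
      by (rule mat_sum_mult) (use r(1) y adj_carrier in \<open>auto intro!: mult_carrier_mat\<close>)
    also have "\<dots> = mat_sum n n (\<lambda>x. adj (\<rho> (x \<otimes> y)) * \<rho> (x \<otimes> y)) (carrier G)"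
    proof (rule mat_sum_cong)
      fix x assume x: "x \<in> carrier G"
      show "adj (\<rho> y) * (adj (\<rho> x) * \<rho> x) * \<rho> y = adj (\<rho> (x \<otimes> y)) * \<rho> (x \<otimes> y)"
        using r(1)[OF x] r(1)[OF y] adj_carrier[of "\<rho> x" n n] adj_carrier[of "\<rho> y" n n]
        by (simp add: r(3)[OF x y] adj_mult assoc_mult_mat[of _ n n _ n _ n])
    qed
    also have "\<dots> = H" unfolding H_def
      by (rule mat_sum_reindex_bij_betw[OF bij_betw_right_mult[OF y]])
    finally show ?thesis .
  qed
  obtain K where K: "K \<in> carrier_mat n n" "H * K = 1\<^sub>m n" "K * H = 1\<^sub>m n"
  proof (rule invertible_matI[OF H])
    fix v assume v: "v \<in> carrier_vec n" and Hv: "H *\<^sub>v v = 0\<^sub>v n"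
    define q where "q x k = (\<Sum>i<n. \<rho> x $$ (k,i) * v $ i)" for x k
    have Hij: "H $$ (i,j) = (\<Sum>x\<in>carrier G. \<Sum>k<n. cnj (\<rho> x $$ (k,i)) * \<rho> x $$ (k,j))"
      if "i < n" "j < n" for i j
      unfolding H_def index_mat_sum[OF that]
    proof (rule sum.cong[OF refl])
      fix x assume x: "x \<in> carrier G"
      show "(adj (\<rho> x) * \<rho> x) $$ (i,j) = (\<Sum>k<n. cnj (\<rho> x $$ (k,i)) * \<rho> x $$ (k,j))"
        using r(1)[OF x] that by (auto simp: adj_def scalar_prod_def atLeast0LessThan intro!: sum.cong)
    qed
    \<comment> \<open>The value of the Hermitian form \<open>H\<close> at \<open>v\<close> is the
      sum over \<open>x\<close> of the squared norms of \<open>\<rho>(x) v\<close>, where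
      \<open>q x k\<close> is a coordinate of \<open>\<rho>(x) v\<close>. It vanishes, so the term
      for the identity vanishes, and that term is the squared norm of \<open>v\<close>.\<close>
    have "0 = (\<Sum>i<n. cnj (v $ i) * (H *\<^sub>v v) $ i)" unfolding Hv by simp
    also have "\<dots> = (\<Sum>i<n. cnj (v $ i) * (\<Sum>j<n. H $$ (i,j) * v $ j))"
      using H v by (auto simp: scalar_prod_def atLeast0LessThan intro!: sum.cong)
    also have "\<dots> = (\<Sum>i<n. \<Sum>j<n. \<Sum>x\<in>carrier G. \<Sum>k<n.
        cnj (\<rho> x $$ (k,i) * v $ i) * (\<rho> x $$ (k,j) * v $ j))"
      by (intro sum.cong refl) (simp add: Hij sum_distrib_left sum_distrib_right mult_ac)
    also have "\<dots> = (\<Sum>x\<in>carrier G. \<Sum>i<n. \<Sum>j<n. \<Sum>k<n.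
        cnj (\<rho> x $$ (k,i) * v $ i) * (\<rho> x $$ (k,j) * v $ j))"
      by (simp only: sum.swap[where A="carrier G"])
    also have "\<dots> = (\<Sum>x\<in>carrier G. \<Sum>i<n. \<Sum>k<n. \<Sum>j<n.
        cnj (\<rho> x $$ (k,i) * v $ i) * (\<rho> x $$ (k,j) * v $ j))"
      by (intro sum.cong[OF refl] sum.swap)
    also have "\<dots> = (\<Sum>x\<in>carrier G. \<Sum>k<n. \<Sum>i<n. \<Sum>j<n.
        cnj (\<rho> x $$ (k,i) * v $ i) * (\<rho> x $$ (k,j) * v $ j))"
      by (rule sum.cong[OF refl]) (rule sum.swap)
    also have "\<dots> = (\<Sum>x\<in>carrier G. \<Sum>k<n. cnj (q x k) * q x k)"
      by (simp add: q_def sum_product)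
    also have "\<dots> = (\<Sum>x\<in>carrier G. \<Sum>k<n. of_real ((norm (q x k))\<^sup>2))"
      by (simp only: complex_norm_square mult.commute)
    also have "\<dots> = of_real (\<Sum>x\<in>carrier G. \<Sum>k<n. (norm (q x k))\<^sup>2)" by simp
    finally have "(\<Sum>x\<in>carrier G. \<Sum>k<n. (norm (q x k))\<^sup>2) = 0" using of_real_eq_0_iff by metis
    then have "(\<Sum>k<n. (norm (q \<one> k))\<^sup>2) = 0"
      using finite_carrier by (subst (asm) sum_nonneg_eq_0_iff) (auto intro: sum_nonneg)
    then have "q \<one> k = 0" if "k < n" for k
      using that by (subst (asm) sum_nonneg_eq_0_iff) auto
    moreover have "q \<one> k = v $ k" if "k < n" for k
    proof -
      have "q \<one> k = (\<Sum>i<n. if i = k then v $ i else 0)"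
        unfolding q_def r(2) using that by (intro sum.cong) auto
      then show ?thesis using that by (simp add: sum.delta)
    qed
    ultimately show "v = 0\<^sub>v n" using v by (intro eq_vecI) auto
  qed
  have iy: "\<rho> (inv y) \<in> carrier_mat n n" using r(1) y by simp
  note car = r(1)[OF y] iy adj_carrier[OF r(1)[OF y]] H K(1)
  \<comment> \<open>Invariance of \<open>H\<close> says that the adjoint of \<open>\<rho> y\<close>
    is conjugate under \<open>H\<close> to \<open>\<rho> (inv y)\<close>; hence the two have the
    same trace.\<close>
  have "adj (\<rho> y) * H = adj (\<rho> y) * H * (\<rho> y * \<rho> (inv y))"
    using car rep_inv[OF \<rho> y] by simp
  also have "\<dots> = H * \<rho> (inv y)"
    using assoc_mult_mat[of "adj (\<rho> y) * H" n n "\<rho> y" n "\<rho> (inv y)" n] car inv_H by simp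
  finally have "adj (\<rho> y) * H = H * \<rho> (inv y)" .
  then have "adj (\<rho> y) * H * K = H * \<rho> (inv y) * K" by simp
  moreover have "adj (\<rho> y) * H * K = adj (\<rho> y)"
    using car K by (simp add: assoc_mult_mat[of _ n n _ n _ n])
  ultimately have "mat_trace (adj (\<rho> y)) = mat_trace (H * \<rho> (inv y) * K)" by simp
  also have "\<dots> = mat_trace (\<rho> (inv y))" by (rule mat_trace_similar[of _ n]) (use car K in auto)
  also have "mat_trace (adj (\<rho> y)) = cnj (mat_trace (\<rho> y))"
    using car by (auto simp: mat_trace_def adj_def)
  finally show ?thesis .
qed

end

section \<open>Decomposition into irreducible characters\<close>

text \<open>A maximal independent subset of \<open>W\<close> is enlarged to one of the whole space.
  With the vectors of \<open>W\<close> listed first, these are the columns of \<open>P\<close>, and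
  \<open>Q\<close> reads off coordinates. The last two conclusions are what is needed to see that an
  invariant \<open>W\<close> makes matrices block triangular.\<close>

lemma adapted_basis:
  assumes W: "vec_subspace n W"
    and ne: "W \<noteq> {0\<^sub>v n}" "W \<noteq> carrier_vec n"
  obtains k P Q where "0 < k" "k < n" "P \<in> carrier_mat n n" "Q \<in> carrier_mat n n"
    "P * Q = 1\<^sub>m n" "Q * P = 1\<^sub>m n" "\<And>j. j < k \<Longrightarrow> col P j \<in> W"
    "\<And>w i. w \<in> W \<Longrightarrow> k \<le> i \<Longrightarrow> i < n \<Longrightarrow> (Q *\<^sub>v w) $ i = 0"
proof -
  interpret V: vec_space "TYPE(complex)" n .
  note Wc = subspace_vecD[OF W]
  have dim: "V.dim = n" by (rule V.dim_is_n)
  let ?P1 = "\<lambda>S. S \<subseteq> W \<and> V.lin_indpt S"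
  have li_empty: "V.lin_indpt {}" by (auto simp: V.lin_dep_def)
  have "\<exists>B. finite B \<and> maximal B ?P1"
  proof (rule maximal_exists[where N=n])
    show "?P1 {}" using li_empty by simp
    fix A assume "?P1 A"
    then show "finite A \<and> card A \<le> n" using V.li_le_dim[OF V.fin_dim, of A] Wc(1) dim by auto
  qed
  then obtain B where B: "finite B" "maximal B ?P1" by blast
  have BW: "B \<subseteq> W" and Bli: "V.lin_indpt B" using B(2) by (auto simp: maximal_def)
  let ?P2 = "\<lambda>S. B \<subseteq> S \<and> S \<subseteq> carrier_vec n \<and> V.lin_indpt S"
  have "\<exists>C. finite C \<and> maximal C ?P2"
  proof (rule maximal_exists[where N=n])
    show "?P2 B" using BW Bli Wc(1) by auto
    fix A assume "?P2 A"
    then show "finite A \<and> card A \<le> n" using V.li_le_dim[OF V.fin_dim, of A] dim by auto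
  qed
  then obtain C where C: "finite C" "maximal C ?P2" by blast
  have BC: "B \<subseteq> C" and Cc: "C \<subseteq> carrier_vec n" and Cli: "V.lin_indpt C"
    using C(2) by (auto simp: maximal_def)
  have "maximal C (\<lambda>S. S \<subseteq> carrier_vec n \<and> V.lin_indpt S)"
    using C(2) unfolding maximal_def by blast
  then have "V.basis C" using V.max_li_is_basis[of C] by simp
  then have Cspan: "V.span C = carrier_vec n" and "card C = n"
    using V.dim_basis[OF C(1)] dim by (auto simp: V.basis_def)
  obtain bs where bs: "set bs = B" "distinct bs" using finite_distinct_list[OF B(1)] by blast
  obtain cs where cs: "set cs = C - B" "distinct cs" using finite_distinct_list[of "C - B"] C(1) by blast
  let ?ws = "bs @ cs"
  have ws: "set ?ws = C" "distinct ?ws" using bs cs BC by auto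
  then have len: "length ?ws = n" using \<open>card C = n\<close> distinct_card by metis
  define k where "k = length bs"
  define P where "P = mat_of_cols n ?ws"
  have P: "P \<in> carrier_mat n n" unfolding P_def using mat_of_cols_carrier(1)[of n ?ws] len by simp
  have "\<exists>s. s \<in> carrier_vec n \<and> P *\<^sub>v s = v" if "v \<in> carrier_vec n" for v
  proof -
    have "v \<in> V.span C" using that Cspan by simp
    then obtain a where a: "V.lincomb a C = v" using V.finite_in_span[OF C(1)] Cc by auto
    have "V.lincomb a C = V.lincomb_list (\<lambda>i. a (?ws ! i)) ?ws"
      by (rule V.lincomb_as_lincomb_list_distinct[of ?ws a, unfolded ws(1), OF Cc ws(2)])
    also have "\<dots> = P *\<^sub>v vec n (\<lambda>i. a (?ws ! i))"
    proof -
      have "\<forall>w\<in>set ?ws. dim_vec w = n" using ws Cc by auto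
      then show ?thesis using V.lincomb_list_as_mat_mult[of ?ws "\<lambda>i. a (?ws ! i)"] by (simp only: P_def len)
    qed
    finally show ?thesis using a by (intro exI[of _ "vec n (\<lambda>i. a (?ws ! i))"]) auto
  qed
  then have "\<exists>s. s \<in> carrier_vec n \<and> P *\<^sub>v s = unit_vec n j" for j by simp
  then obtain s where s: "\<And>j. s j \<in> carrier_vec n" "\<And>j. P *\<^sub>v s j = unit_vec n j" by metis
  define Q where "Q = mat_of_cols n (map s [0..<n])"
  have Q: "Q \<in> carrier_mat n n" unfolding Q_def using mat_of_cols_carrier(1)[of n "map s [0..<n]"] by simp
  have PQ: "P * Q = 1\<^sub>m n"
  proof (rule eq_matI)
    fix i j assume ij: "i < dim_row (1\<^sub>m n :: complex mat)" "j < dim_col (1\<^sub>m n :: complex mat)"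
    have "col Q j = s j" using ij s by (simp add: Q_def)
    then have "(P * Q) $$ (i,j) = (P *\<^sub>v s j) $ i" using ij P Q by simp
    then show "(P * Q) $$ (i,j) = 1\<^sub>m n $$ (i,j)" using ij by (auto simp: s)
  qed (use P Q in auto)
  then have QP: "Q * P = 1\<^sub>m n" by (rule mat_mult_left_right_inverse[OF P Q])
  have spanBW: "W \<subseteq> V.span B"
  proof
    fix w assume w: "w \<in> W"
    show "w \<in> V.span B"
    proof (cases "w \<in> B")
      case True
      then show ?thesis using V.in_own_span[of B] BW Wc(1) by auto
    next
      case False
      have "\<not> ?P1 (B \<union> {w})" using B(2) False unfolding maximal_def by blast
      then have "V.lin_dep (B \<union> {w})" using BW w by auto
      then show ?thesis using V.lin_dep_iff_in_span[of B w] BW Wc(1) Bli w False by auto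
    qed
  qed
  have spanWB: "V.span B \<subseteq> W"
    using V.span_is_subset[of B W] BW W by (auto simp: VectorSpace.subspace_def)
  have Qw: "(Q *\<^sub>v w) $ i = 0" if w: "w \<in> W" and i: "k \<le> i" "i < n" for w i
  proof -
    have "w \<in> V.span B" using spanBW w by auto
    then obtain a where a: "V.lincomb a B = w" using V.finite_in_span[OF B(1)] BW Wc(1) by auto
    have Bc: "B \<subseteq> carrier_vec n" using BW Wc(1) by auto
    define u where "u = vec n (\<lambda>i. if i < k then a (bs ! i) else 0)"
    have "w = V.lincomb_list (\<lambda>i. a (bs ! i)) bs"
      using V.lincomb_as_lincomb_list_distinct[of bs a] bs Bc a by simp
    also have "\<dots> = mat_of_cols n bs *\<^sub>v vec k (\<lambda>i. a (bs ! i))"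
      unfolding k_def by (subst V.lincomb_list_as_mat_mult) (use bs Bc in auto)
    also have "\<dots> = P *\<^sub>v u"
    proof (rule eq_vecI)
      fix i assume "i < dim_vec (P *\<^sub>v u)"
      then have i: "i < n" using P by simp
      have "(P *\<^sub>v u) $ i = (\<Sum>j<n. (?ws ! j) $ i * (if j < k then a (bs ! j) else 0))"
        using i P len by (auto simp: P_def scalar_prod_def u_def atLeast0LessThan mat_of_cols_def intro!: sum.cong)
      also have "\<dots> = (\<Sum>j<k. (bs ! j) $ i * a (bs ! j))"
        by (rule sum.mono_neutral_cong_right) (use len in \<open>auto simp: k_def nth_append\<close>)
      also have "\<dots> = (mat_of_cols n bs *\<^sub>v vec k (\<lambda>i. a (bs ! i))) $ i"
        using i by (auto simp: scalar_prod_def atLeast0LessThan k_def mat_of_cols_def intro!: sum.cong)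
      finally show "(mat_of_cols n bs *\<^sub>v vec k (\<lambda>i. a (bs ! i))) $ i = (P *\<^sub>v u) $ i" ..
    qed (use P in simp)
    finally have "Q *\<^sub>v w = (Q * P) *\<^sub>v u"
      using P Q by (subst assoc_mult_mat_vec[of _ n n _ n]) (auto simp: u_def)
    then show ?thesis using i QP by (simp add: u_def)
  qed
  have "k > 0"
  proof (rule ccontr)
    assume "\<not> k > 0"
    then have "B = {}" using bs by (simp add: k_def)
    then have "W \<subseteq> {0\<^sub>v n}" using spanBW V.span_empty by simp
    then show False using ne(1) Wc(2) by auto
  qed
  moreover have "k < n"
  proof (rule ccontr)
    assume "\<not> k < n"
    then have "cs = []" using len by (cases cs) (auto simp: k_def)
    then have "C = B" using ws bs by simp
    then show False using spanWB Cspan ne(2) Wc(1) by auto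
  qed
  moreover have "col P j \<in> W" if "j < k" for j
  proof -
    have "j < n" using that \<open>k < n\<close> by simp
    then have "?ws ! j \<in> set ?ws" using len by (intro nth_mem) simp
    then have "?ws ! j \<in> carrier_vec n" unfolding ws(1) using Cc by blast
    then have "col P j = ?ws ! j" unfolding P_def using len \<open>j < n\<close> by (intro col_mat_of_cols) simp
    also have "\<dots> = bs ! j" using that by (simp add: k_def nth_append)
    finally show ?thesis using that bs BW by (auto simp: k_def intro!: nth_mem)
  qed
  ultimately show ?thesis using that[OF _ _ P Q PQ QP] Qw by blast
qed

lemma rep_character_mem_Irr: "irreducible_rep G n \<rho> \<Longrightarrow> rep_character G \<rho> \<in> Irr G"
  by (auto simp: Irr_def)

lemma Irr_cases:
  assumes "\<chi> \<in> Irr G"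
  obtains n \<rho> where "irreducible_rep G n \<rho>" "\<chi> = rep_character G \<rho>"
  using assms by (auto simp: Irr_def)

lemma rep_conjugate:
  assumes \<rho>: "matrix_rep G n \<rho>" and P: "P \<in> carrier_mat n n" and Q: "Q \<in> carrier_mat n n"
    and PQ: "P * Q = 1\<^sub>m n" "Q * P = 1\<^sub>m n"
  shows "matrix_rep G n (\<lambda>x. Q * \<rho> x * P)"
proof -
  note r = matrix_repD[OF \<rho>]
  have "Q * (\<rho> x * \<rho> y) * P = Q * \<rho> x * P * (Q * \<rho> y * P)" if x: "x \<in> carrier G" and y: "y \<in> carrier G" for x y
  proof -
    have "Q * \<rho> x * P * (Q * \<rho> y * P) = Q * \<rho> x * (P * (Q * \<rho> y * P))"
      using r(1)[OF x] r(1)[OF y] P Q by (intro assoc_mult_mat[of _ n n _ n _ n]) auto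
    also have "P * (Q * \<rho> y * P) = P * (Q * (\<rho> y * P))"
      using r(1)[OF y] P Q by (subst assoc_mult_mat[of _ n n _ n _ n]) auto
    also have "\<dots> = P * Q * (\<rho> y * P)"
      using r(1)[OF y] P Q by (subst assoc_mult_mat[of _ n n _ n _ n]) auto
    also have "\<dots> = \<rho> y * P" using r(1)[OF y] P PQ by simp
    also have "Q * \<rho> x * (\<rho> y * P) = Q * (\<rho> x * \<rho> y) * P"
      using r(1)[OF x] r(1)[OF y] P Q by (simp add: assoc_mult_mat[of _ n n _ n _ n])
    finally show ?thesis ..
  qed
  then show ?thesis using r P Q PQ by (auto simp: matrix_rep_def)
qed

text \<open>Induction on the degree: an invariant subspace makes the representation block
  triangular, both diagonal blocks are representations, and the trace sees only these. Working with
  traces alone, no invariant complement has to be constructed. The list records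
  multiplicities.\<close>

theorem rep_trace_decomposition:
  assumes "matrix_rep G n \<rho>"
  shows "\<exists>xs. set xs \<subseteq> Irr G \<and> (\<forall>x\<in>carrier G. mat_trace (\<rho> x) = (\<Sum>\<chi>\<leftarrow>xs. \<chi> x))"
  using assms
proof (induction n arbitrary: \<rho> rule: less_induct)
  case (less n)
  note r = matrix_repD[OF less.prems]
  consider "n = 0" | "irreducible_rep G n \<rho>" | "n > 0" "\<not> irreducible_rep G n \<rho>" by blast
  then show ?case
  proof cases
    case 1
    have "mat_trace (\<rho> x) = 0" if "x \<in> carrier G" for x using r(1)[OF that] 1 by (simp add: mat_trace_def)
    then show ?thesis by (intro exI[of _ "[]"]) simp
  next
    case 2
    then show ?thesis
      by (intro exI[of _ "[rep_character G \<rho>]"]) (auto simp: rep_character_mem_Irr rep_character_def)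
  next
    case 3
    then obtain W where W: "vec_subspace n W"
      "\<And>x w. x \<in> carrier G \<Longrightarrow> w \<in> W \<Longrightarrow> \<rho> x *\<^sub>v w \<in> W" "W \<noteq> {0\<^sub>v n}" "W \<noteq> carrier_vec n"
      using less.prems by (auto simp: irreducible_rep_def)
    obtain k P Q where k: "0 < k" "k < n" and P: "P \<in> carrier_mat n n" and Q: "Q \<in> carrier_mat n n"
      and PQ: "P * Q = 1\<^sub>m n" "Q * P = 1\<^sub>m n" and colP: "\<And>j. j < k \<Longrightarrow> col P j \<in> W"
      and Qw: "\<And>w i. w \<in> W \<Longrightarrow> k \<le> i \<Longrightarrow> i < n \<Longrightarrow> (Q *\<^sub>v w) $ i = 0"
      using adapted_basis[OF W(1,3,4)] by metis
    define \<tau> where "\<tau> x = Q * \<rho> x * P" for x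
    have \<tau>: "matrix_rep G n \<tau>" unfolding \<tau>_def by (rule rep_conjugate[OF less.prems P Q PQ])
    note t = matrix_repD[OF \<tau>]
    \<comment> \<open>The lower left block in the new basis: column \<open>j < k\<close> of
      \<open>P\<close> lies in \<open>W\<close>, so does its image under \<open>\<rho> x\<close>,
      and the coordinates from \<open>k\<close> on vanish on \<open>W\<close>.\<close>
    have zero: "\<tau> x $$ (i,j) = 0" if x: "x \<in> carrier G" and ij: "k \<le> i" "i < n" "j < k" for x i j
    proof -
      have "\<tau> x $$ (i,j) = (Q *\<^sub>v (\<rho> x *\<^sub>v col P j)) $ i"
      proof -
        have "\<tau> x $$ (i,j) = col (\<tau> x) j $ i" using t(1)[OF x] ij k by simp
        also have "col (\<tau> x) j = (Q * \<rho> x) *\<^sub>v col P j"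
          unfolding \<tau>_def using Q P r(1)[OF x] ij k by (intro col_mult2[of _ n n _ n]) auto
        also have "\<dots> = Q *\<^sub>v (\<rho> x *\<^sub>v col P j)"
          using Q P r(1)[OF x] ij k by (intro assoc_mult_mat_vec[of _ n n _ n] carrier_vecI) auto
        finally show ?thesis .
      qed
      then show ?thesis using Qw[OF W(2)[OF x colP]] ij by simp
    qed
    define A where "A x = mat k k (\<lambda>(i,j). \<tau> x $$ (i,j))" for x
    define D where "D x = mat (n - k) (n - k) (\<lambda>(i,j). \<tau> x $$ (i + k,j + k))" for x
    have split: "(\<Sum>l<n. f l) = (\<Sum>l<k. f l) + (\<Sum>l<n-k. f (l + k))" for f :: "nat \<Rightarrow> complex"
    proof -
      have "(\<Sum>l<n. f l) = (\<Sum>l\<in>{0..<k}. f l) + (\<Sum>l\<in>{k..<n}. f l)"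
        using k by (subst sum.atLeastLessThan_concat) (auto simp: atLeast0LessThan)
      also have "(\<Sum>l\<in>{k..<n}. f l) = (\<Sum>l<n-k. f (l + k))"
        using sum.shift_bounds_nat_ivl[of f 0 k "n - k"] k by (simp add: atLeast0LessThan)
      finally show ?thesis by (simp add: atLeast0LessThan)
    qed
    have prod: "\<tau> (x \<otimes>\<^bsub>G\<^esub> y) $$ (i,j) = (\<Sum>l<n. \<tau> x $$ (i,l) * \<tau> y $$ (l,j))"
      if x: "x \<in> carrier G" and y: "y \<in> carrier G" and ij: "i < n" "j < n" for x y i j
      unfolding t(3)[OF x y] using t(1)[OF x] t(1)[OF y] ij
      by (auto simp: scalar_prod_def atLeast0LessThan intro!: sum.cong)
    have A: "matrix_rep G k A"
      unfolding matrix_rep_def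
    proof (intro conjI ballI)
      show "A \<one>\<^bsub>G\<^esub> = 1\<^sub>m k" using k by (intro eq_matI) (auto simp: A_def t(2))
      fix x y assume x: "x \<in> carrier G" and y: "y \<in> carrier G"
      show "A (x \<otimes>\<^bsub>G\<^esub> y) = A x * A y"
      proof (rule eq_matI)
        fix i j assume "i < dim_row (A x * A y)" "j < dim_col (A x * A y)"
        then have ij: "i < k" "j < k" by (auto simp: A_def)
        have "A (x \<otimes>\<^bsub>G\<^esub> y) $$ (i,j) = (\<Sum>l<k. \<tau> x $$ (i,l) * \<tau> y $$ (l,j))"
          using ij k prod[OF x y, of i j] split[of "\<lambda>l. \<tau> x $$ (i,l) * \<tau> y $$ (l,j)"]
          by (simp add: A_def zero[OF y])
        then show "A (x \<otimes>\<^bsub>G\<^esub> y) $$ (i,j) = (A x * A y) $$ (i,j)"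
          using ij by (simp add: A_def scalar_prod_def atLeast0LessThan)
      qed (auto simp: A_def)
    qed (auto simp: A_def)
    have D: "matrix_rep G (n - k) D"
      unfolding matrix_rep_def
    proof (intro conjI ballI)
      show "D \<one>\<^bsub>G\<^esub> = 1\<^sub>m (n - k)" using k by (intro eq_matI) (auto simp: D_def t(2))
      fix x y assume x: "x \<in> carrier G" and y: "y \<in> carrier G"
      show "D (x \<otimes>\<^bsub>G\<^esub> y) = D x * D y"
      proof (rule eq_matI)
        fix i j assume "i < dim_row (D x * D y)" "j < dim_col (D x * D y)"
        then have ij: "i < n - k" "j < n - k" by (auto simp: D_def)
        have "D (x \<otimes>\<^bsub>G\<^esub> y) $$ (i,j) = (\<Sum>l<n-k. \<tau> x $$ (i+k,l+k) * \<tau> y $$ (l+k,j+k))"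
          using ij k prod[OF x y, of "i+k" "j+k"] split[of "\<lambda>l. \<tau> x $$ (i+k,l) * \<tau> y $$ (l,j+k)"]
          by (simp add: D_def zero[OF x])
        then show "D (x \<otimes>\<^bsub>G\<^esub> y) $$ (i,j) = (D x * D y) $$ (i,j)"
          using ij by (simp add: D_def scalar_prod_def atLeast0LessThan)
      qed (auto simp: D_def)
    qed (auto simp: D_def)
    have tr: "mat_trace (\<rho> x) = mat_trace (A x) + mat_trace (D x)" if x: "x \<in> carrier G" for x
    proof -
      have "mat_trace (\<rho> x) = mat_trace (\<tau> x)"
        unfolding \<tau>_def using mat_trace_similar[OF r(1)[OF x] Q P PQ(1)] by simp
      also have "\<dots> = mat_trace (A x) + mat_trace (D x)"
        using t(1)[OF x] split[of "\<lambda>i. \<tau> x $$ (i,i)"] by (simp add: mat_trace_def A_def D_def)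
      finally show ?thesis .
    qed
    obtain xs where xs: "set xs \<subseteq> Irr G" "\<And>x. x \<in> carrier G \<Longrightarrow> mat_trace (A x) = (\<Sum>\<chi>\<leftarrow>xs. \<chi> x)"
      using less.IH[OF k(2) A] by blast
    have "n - k < n" using k by simp
    then obtain ys where ys: "set ys \<subseteq> Irr G" "\<And>x. x \<in> carrier G \<Longrightarrow> mat_trace (D x) = (\<Sum>\<chi>\<leftarrow>ys. \<chi> x)"
      using less.IH[OF _ D] by blast
    show ?thesis using xs ys tr by (intro exI[of _ "xs @ ys"]) auto
  qed
qed

lemma Irr_outside: "\<chi> \<in> Irr G \<Longrightarrow> x \<notin> carrier G \<Longrightarrow> \<chi> x = 0"
  by (auto simp: Irr_def rep_character_def)

lemma sum_list_map_eq_sum_of_nat_count: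
  fixes f :: "'b \<Rightarrow> 'c::comm_semiring_1"
  assumes "set xs \<subseteq> X" "finite X"
  shows "sum_list (map f xs) = (\<Sum>x\<in>X. of_nat (count_list xs x) * f x)"
  using assms(1)
proof (induction xs)
  case (Cons y xs)
  have "(\<Sum>x\<in>X. of_nat (count_list (y # xs) x) * f x) =
      (\<Sum>x\<in>X. (if x = y then f x else 0) + of_nat (count_list xs x) * f x)"
    by (intro sum.cong refl) (simp add: distrib_right)
  then show ?case using Cons assms(2) by (simp add: sum.distrib sum.delta)
qed simp

context fin_group
begin

lemma Irr_one_pos:
  assumes "\<chi> \<in> Irr G"
  obtains n where "n > 0" "\<chi> \<one> = of_nat n"
proof -
  obtain n \<rho> where \<rho>: "irreducible_rep G n \<rho>" "\<chi> = rep_character G \<rho>" using Irr_cases[OF assms] .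
  have "\<chi> \<one> = of_nat n" using matrix_repD(2)[OF irreducible_repD(1)[OF \<rho>(1)]] \<rho>(2) by (simp add: rep_character_def)
  then show ?thesis using that irreducible_repD(2)[OF \<rho>(1)] by blast
qed

lemma Irr_cnj:
  assumes "\<chi> \<in> Irr G" "x \<in> carrier G"
  shows "cnj (\<chi> x) = \<chi> (inv x)"
proof -
  obtain n \<rho> where \<rho>: "irreducible_rep G n \<rho>" "\<chi> = rep_character G \<rho>" using Irr_cases[OF assms(1)] .
  then show ?thesis using cnj_mat_trace[OF irreducible_repD(1)[OF \<rho>(1)] assms(2)] assms(2) by (simp add: rep_character_def)
qed

lemma char_inner_Irr:
  assumes "\<chi> \<in> Irr G"
  shows "char_inner G f \<chi> = (\<Sum>x\<in>carrier G. f x * \<chi> (inv x)) / of_nat (card (carrier G))"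
  unfolding char_inner_def by (simp add: Irr_cnj[OF assms] cong: sum.cong)

lemma intertwiner_imp_eq_character:
  assumes \<rho>: "irreducible_rep G n \<rho>" and \<rho>': "irreducible_rep G m \<rho>'"
    and T: "T \<in> carrier_mat n m" "T \<noteq> 0\<^sub>m n m"
    and comm: "\<And>x. x \<in> carrier G \<Longrightarrow> \<rho> x * T = T * \<rho>' x"
  shows "rep_character G \<rho> = rep_character G \<rho>'"
proof (rule ext)
  fix x
  obtain S where S: "S \<in> carrier_mat m n" "T * S = 1\<^sub>m n" "S * T = 1\<^sub>m m"
    using schur_lemma[OF \<rho> \<rho>' T comm] by metis
  note r = matrix_repD[OF irreducible_repD(1)[OF \<rho>]] and r' = matrix_repD[OF irreducible_repD(1)[OF \<rho>']]
  have "mat_trace (\<rho> x) = mat_trace (\<rho>' x)" if x: "x \<in> carrier G"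
  proof -
    have "\<rho> x = \<rho> x * (T * S)" using S r(1)[OF x] by simp
    also have "\<dots> = \<rho> x * T * S" using S r(1)[OF x] T by (intro assoc_mult_mat[symmetric]) auto
    also have "\<dots> = T * \<rho>' x * S" by (simp add: comm[OF x])
    finally show ?thesis using mat_trace_similar[OF r'(1)[OF x] T(1) S(1) S(3)] by simp
  qed
  then show "rep_character G \<rho> x = rep_character G \<rho>' x" by (simp add: rep_character_def)
qed

lemma Irr_orthonormal:
  assumes "\<chi> \<in> Irr G" "\<psi> \<in> Irr G"
  shows "char_inner G \<chi> \<psi> = (if \<chi> = \<psi> then 1 else 0)"
proof -
  obtain n \<rho> where \<rho>: "irreducible_rep G n \<rho>" "\<chi> = rep_character G \<rho>" using Irr_cases[OF assms(1)] .
  obtain m \<rho>' where \<rho>': "irreducible_rep G m \<rho>'" "\<psi> = rep_character G \<rho>'" using Irr_cases[OF assms(2)] .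
  note r = matrix_repD[OF irreducible_repD(1)[OF \<rho>(1)]] and r' = matrix_repD[OF irreducible_repD(1)[OF \<rho>'(1)]]
  show ?thesis
  proof (cases "\<chi> = \<psi>")
    case True
    have "(\<Sum>x\<in>carrier G. \<chi> x * \<psi> (inv x)) =
      (\<Sum>x\<in>carrier G. mat_trace (\<rho> x * 1\<^sub>m n) * mat_trace (\<rho> (inv x) * 1\<^sub>m n))"
      unfolding True[symmetric] using r(1) by (intro sum.cong) (auto simp: \<rho>(2) rep_character_def right_mult_one_mat[of _ n n])
    also have "\<dots> = of_nat (card (carrier G))"
      using trace_orthogonality_same[OF \<rho>(1), of "1\<^sub>m n" "1\<^sub>m n"] irreducible_repD(2)[OF \<rho>(1)] by simp
    finally show ?thesis using True card_carrier_pos by (simp add: char_inner_Irr[OF assms(2)])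
  next
    case False
    have "(\<Sum>x\<in>carrier G. \<chi> x * \<psi> (inv x)) =
      (\<Sum>x\<in>carrier G. mat_trace (\<rho> x * 1\<^sub>m n) * mat_trace (\<rho>' (inv x) * 1\<^sub>m m))"
      using r(1) r'(1) by (intro sum.cong)
        (auto simp: \<rho>(2) \<rho>'(2) rep_character_def right_mult_one_mat[of _ n n] right_mult_one_mat[of _ m m])
    also have "\<dots> = 0"
      by (rule trace_orthogonality_distinct[OF \<rho>(1) \<rho>'(1)])
        (use False intertwiner_imp_eq_character[OF \<rho>(1) \<rho>'(1)] \<rho>(2) \<rho>'(2) in auto)
    finally show ?thesis using False by (simp add: char_inner_Irr[OF assms(2)])
  qed
qed

text \<open>Without a nonzero intertwiner, orthogonality would give the scalar product 0, whereas an
  irreducible character has norm 1.\<close>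

lemma eq_character_imp_intertwiner:
  assumes \<rho>: "irreducible_rep G n \<rho>" and \<rho>': "irreducible_rep G m \<rho>'"
    and eq: "rep_character G \<rho> = rep_character G \<rho>'"
  obtains T where "T \<in> carrier_mat n m" "T \<noteq> 0\<^sub>m n m" "\<And>x. x \<in> carrier G \<Longrightarrow> \<rho> x * T = T * \<rho>' x"
proof (rule ccontr)
  note r = matrix_repD[OF irreducible_repD(1)[OF \<rho>]] and r' = matrix_repD[OF irreducible_repD(1)[OF \<rho>']]
  assume "\<not> thesis"
  then have "(\<Sum>x\<in>carrier G. mat_trace (\<rho> x * 1\<^sub>m n) * mat_trace (\<rho>' (inv x) * 1\<^sub>m m)) = 0"
    using that by (intro trace_orthogonality_distinct[OF \<rho> \<rho>']) auto
  also have "(\<Sum>x\<in>carrier G. mat_trace (\<rho> x * 1\<^sub>m n) * mat_trace (\<rho>' (inv x) * 1\<^sub>m m)) =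
      (\<Sum>x\<in>carrier G. rep_character G \<rho> x * rep_character G \<rho>' (inv x))"
    using r(1) r'(1) by (intro sum.cong)
      (auto simp: rep_character_def right_mult_one_mat[of _ n n] right_mult_one_mat[of _ m m])
  finally have "char_inner G (rep_character G \<rho>) (rep_character G \<rho>') = 0"
    by (simp add: char_inner_Irr[OF rep_character_mem_Irr[OF \<rho>']])
  then show False
    using Irr_orthonormal[OF rep_character_mem_Irr[OF \<rho>] rep_character_mem_Irr[OF \<rho>']] eq by simp
qed

lemma char_inner_sum_list:
  "char_inner G (\<lambda>x. \<Sum>\<chi>\<leftarrow>xs. \<chi> x) \<psi> = (\<Sum>\<chi>\<leftarrow>xs. char_inner G \<chi> \<psi>)"
  by (induction xs) (simp_all add: char_inner_def distrib_right sum.distrib add_divide_distrib)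

lemma char_inner_cong:
  "(\<And>x. x \<in> carrier G \<Longrightarrow> f x = g x) \<Longrightarrow> char_inner G f \<psi> = char_inner G g \<psi>"
  unfolding char_inner_def by (simp cong: sum.cong)

lemma char_inner_Irr_list:
  assumes "set xs \<subseteq> Irr G" "\<psi> \<in> Irr G"
  shows "char_inner G (\<lambda>x. \<Sum>\<chi>\<leftarrow>xs. \<chi> x) \<psi> = of_nat (count_list xs \<psi>)"
  unfolding char_inner_sum_list using assms
  by (induction xs) (auto simp: Irr_orthonormal)

text \<open>\<open>R\<close> is the permutation representation on \<open>G\<close> by left
  multiplication; its trace counts fixed points. In the scalar product with \<open>\<psi>\<close>
  only the identity contributes, so \<open>\<psi>\<close> occurs with multiplicity
  \<open>\<psi> \<one>\<close>. This is positive, hence every irreducible character occurs in the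
  finite list \<open>xs\<close>.\<close>

theorem regular_character:
  shows "finite (Irr G)"
    and "x \<in> carrier G \<Longrightarrow> (\<Sum>\<chi>\<in>Irr G. \<chi> \<one> * \<chi> x) = (if x = \<one> then of_nat (card (carrier G)) else 0)"
proof -
  let ?N = "card (carrier G)"
  obtain gs where gs: "set gs = carrier G" "distinct gs" using finite_distinct_list[OF finite_carrier] by blast
  then have len: "length gs = ?N" using distinct_card by metis
  have gsc: "gs ! i \<in> carrier G" if "i < ?N" for i using that gs len by (metis nth_mem)
  have gs_inj: "gs ! i = gs ! j \<longleftrightarrow> i = j" if "i < ?N" "j < ?N" for i j
    using that gs len by (simp add: nth_eq_iff_index_eq)
  define R where "R x = mat ?N ?N (\<lambda>(i,j). if gs ! i = x \<otimes> gs ! j then 1 else 0 :: complex)" for x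
  have R: "matrix_rep G ?N R"
    unfolding matrix_rep_def
  proof (intro conjI ballI)
    show "R \<one> = 1\<^sub>m ?N" by (intro eq_matI) (auto simp: R_def gsc gs_inj)
    fix x y assume x: "x \<in> carrier G" and y: "y \<in> carrier G"
    show "R (x \<otimes> y) = R x * R y"
    proof (rule eq_matI)
      fix i j assume "i < dim_row (R x * R y)" "j < dim_col (R x * R y)"
      then have ij: "i < ?N" "j < ?N" by (auto simp: R_def)
      have "y \<otimes> gs ! j \<in> set gs" using gsc[OF ij(2)] y gs by simp
      then obtain l0 where l0: "l0 < ?N" "gs ! l0 = y \<otimes> gs ! j" using len by (metis in_set_conv_nth)
      have "(R x * R y) $$ (i,j) = (\<Sum>l<?N. (if gs ! i = x \<otimes> gs ! l then 1 else 0) * (if gs ! l = y \<otimes> gs ! j then 1 else 0))"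
        using ij by (simp add: R_def scalar_prod_def atLeast0LessThan)
      also have "\<dots> = (\<Sum>l<?N. if l = l0 then (if gs ! i = x \<otimes> gs ! l then 1 else 0) else 0)"
        unfolding l0(2)[symmetric] using l0(1) by (intro sum.cong refl) (auto simp: gs_inj)
      also have "\<dots> = (if gs ! i = x \<otimes> (y \<otimes> gs ! j) then 1 else 0)"
        using l0 by (simp add: sum.delta)
      finally show "R (x \<otimes> y) $$ (i,j) = (R x * R y) $$ (i,j)"
        using ij x y gsc by (simp add: R_def m_assoc)
    qed (auto simp: R_def)
  qed (auto simp: R_def)
  have tr: "mat_trace (R x) = (if x = \<one> then of_nat ?N else 0)" if x: "x \<in> carrier G" for x
  proof -
    have "mat_trace (R x) = (\<Sum>i<?N. if gs ! i = x \<otimes> gs ! i then 1 else 0)"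
      by (simp add: mat_trace_def R_def)
    also have "\<dots> = (\<Sum>i<?N. if x = \<one> then 1 else 0)"
      using x gsc by (intro sum.cong refl) auto
    finally show ?thesis by simp
  qed
  obtain xs where xs: "set xs \<subseteq> Irr G" "\<And>x. x \<in> carrier G \<Longrightarrow> mat_trace (R x) = (\<Sum>\<chi>\<leftarrow>xs. \<chi> x)"
    using rep_trace_decomposition[OF R] by blast
  have count: "of_nat (count_list xs \<psi>) = \<psi> \<one>" if \<psi>: "\<psi> \<in> Irr G" for \<psi>
  proof -
    have "of_nat (count_list xs \<psi>) = char_inner G (\<lambda>x. mat_trace (R x)) \<psi>"
      using char_inner_Irr_list[OF xs(1) \<psi>] char_inner_cong[OF xs(2)] by simp
    also have "\<dots> = (\<Sum>x\<in>carrier G. if x = \<one> then of_nat ?N * \<psi> \<one> else 0) / of_nat ?N"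
      unfolding char_inner_Irr[OF \<psi>] by (intro arg_cong2[where f="(/)"] sum.cong refl) (auto simp: tr)
    also have "\<dots> = \<psi> \<one>" using finite_carrier card_carrier_pos one_closed by (auto simp: sum.delta)
    finally show ?thesis .
  qed
  have "Irr G \<subseteq> set xs"
  proof
    fix \<psi> assume \<psi>: "\<psi> \<in> Irr G"
    obtain n where "n > 0" "\<psi> \<one> = of_nat n" using Irr_one_pos[OF \<psi>] .
    then have "count_list xs \<psi> \<noteq> 0" using count[OF \<psi>] by (metis less_irrefl of_nat_eq_iff)
    then show "\<psi> \<in> set xs" by (meson count_list_0_iff)
  qed
  then have set_xs: "set xs = Irr G" using xs(1) by auto
  show "finite (Irr G)" unfolding set_xs[symmetric] by simp
  assume x: "x \<in> carrier G"
  have "(\<Sum>\<chi>\<in>Irr G. \<chi> \<one> * \<chi> x) = (\<Sum>\<chi>\<in>set xs. of_nat (count_list xs \<chi>) * \<chi> x)"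
    unfolding set_xs by (intro sum.cong refl) (simp add: count)
  also have "\<dots> = (\<Sum>\<chi>\<leftarrow>xs. \<chi> x)"
    by (simp add: sum_list_map_eq_sum_of_nat_count[of xs "set xs"])
  finally show "(\<Sum>\<chi>\<in>Irr G. \<chi> \<one> * \<chi> x) = (if x = \<one> then of_nat ?N else 0)"
    using xs(2)[OF x] tr[OF x] by simp
qed

end

section \<open>The Glauberman correspondence for an involution\<close>

text \<open>A commuting involution \<open>U\<close> extends \<open>\<rho>\<close> to the direct
  product of \<open>G\<close> with a group of order 2. On each irreducible constituent of the
  extension the central generator of that group is, by Schur's lemma, a scalar \<open>z\<close> with
  \<open>z^2 = 1\<close>; being scalar, it does not disturb irreducibility under \<open>G\<close>. A
  pair \<open>(\<psi>,z)\<close> records a constituent together with this sign.\<close>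

lemma (in fin_group) rep_involution_decomposition:
  assumes \<rho>: "matrix_rep G n \<rho>" and U: "U \<in> carrier_mat n n" "U * U = 1\<^sub>m n"
    and comm: "\<And>x. x \<in> carrier G \<Longrightarrow> \<rho> x * U = U * \<rho> x"
  obtains zs :: "(('a \<Rightarrow> complex) \<times> int) list" where "\<And>\<psi> z. (\<psi>,z) \<in> set zs \<Longrightarrow> \<psi> \<in> Irr G \<and> (z = 1 \<or> z = -1)"
    "\<And>x. x \<in> carrier G \<Longrightarrow> mat_trace (\<rho> x) = (\<Sum>(\<psi>,z)\<leftarrow>zs. \<psi> x)"
    "\<And>x. x \<in> carrier G \<Longrightarrow> mat_trace (\<rho> x * U) = (\<Sum>(\<psi>,z)\<leftarrow>zs. of_int z * \<psi> x)"
proof -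
  note r = matrix_repD[OF \<rho>]
  define Z2 :: "bool monoid" where "Z2 = \<lparr>carrier = UNIV, mult = (\<noteq>), one = False\<rparr>"
  define D where "D = G \<times>\<times> Z2"
  have Z2: "group Z2" by (rule groupI) (auto simp: Z2_def)
  have D_group: "group D" unfolding D_def by (rule DirProd_group[OF is_group Z2])
  have carD: "carrier D = carrier G \<times> UNIV" by (simp add: D_def DirProd_def Z2_def)
  have multD: "(x,b) \<otimes>\<^bsub>D\<^esub> (y,c) = (x \<otimes> y, b \<noteq> c)" for x y b c
    by (simp add: D_def DirProd_def Z2_def)
  have oneD: "\<one>\<^bsub>D\<^esub> = (\<one>, False)" by (simp add: D_def DirProd_def Z2_def)
  define R where "R = (\<lambda>(x,b). if b then \<rho> x * U else \<rho> x)"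
  have R: "matrix_rep D n R"
    unfolding matrix_rep_def
  proof (intro conjI ballI)
    show "R p \<in> carrier_mat n n" if "p \<in> carrier D" for p
      using that r(1) U by (auto simp: carD R_def split: prod.splits intro: mult_carrier_mat)
    show "R \<one>\<^bsub>D\<^esub> = 1\<^sub>m n" by (simp add: oneD R_def r(2))
    fix p q assume pq: "p \<in> carrier D" "q \<in> carrier D"
    obtain x b y c where xy: "p = (x,b)" "q = (y,c)" by (cases p, cases q) auto
    have x: "x \<in> carrier G" and y: "y \<in> carrier G" using pq xy by (auto simp: carD)
    note car = r(1)[OF x] r(1)[OF y] U(1)
    have 1: "\<rho> x * U * \<rho> y = \<rho> x * \<rho> y * U"
      using car by (simp add: assoc_mult_mat[of _ n n _ n _ n] comm[OF y])
    have 2: "\<rho> x * U * (\<rho> y * U) = \<rho> x * \<rho> y"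
    proof -
      have "\<rho> x * U * (\<rho> y * U) = \<rho> x * U * \<rho> y * U"
        using car by (intro assoc_mult_mat[symmetric, of _ n n _ n _ n]) auto
      also have "\<dots> = \<rho> x * \<rho> y * (U * U)"
        unfolding 1 using car by (intro assoc_mult_mat[of _ n n _ n _ n]) auto
      finally show ?thesis using car U by (simp add: right_mult_one_mat[of _ n n])
    qed
    have 3: "\<rho> x * (\<rho> y * U) = \<rho> x * \<rho> y * U"
      using car by (intro assoc_mult_mat[symmetric, of _ n n _ n _ n]) auto
    show "R (p \<otimes>\<^bsub>D\<^esub> q) = R p * R q"
      unfolding xy multD using 1 2 3 by (auto simp: R_def r(3)[OF x y])
  qed
  have "\<exists>\<psi> z::int. \<psi> \<in> Irr G \<and> (z = 1 \<or> z = -1) \<and>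
      (\<forall>x\<in>carrier G. \<chi> (x, False) = \<psi> x \<and> \<chi> (x, True) = of_int z * \<psi> x)" if \<chi>: "\<chi> \<in> Irr D" for \<chi>
  proof -
    obtain m S where S: "irreducible_rep D m S" "\<chi> = rep_character D S" using Irr_cases[OF \<chi>] .
    note s = matrix_repD[OF irreducible_repD(1)[OF S(1)]]
    let ?Z = "S (\<one>,True)"
    have Zc: "?Z \<in> carrier_mat m m" using s(1) by (simp add: carD)
    define z where "z = mat_trace ?Z / of_nat m"
    have Z: "?Z = z \<cdot>\<^sub>m 1\<^sub>m m"
      unfolding z_def
    proof (rule schur_lemma_scalar[OF S(1) Zc])
      fix p assume "p \<in> carrier D"
      then obtain x b where "p = (x,b)" "x \<in> carrier G" by (auto simp: carD)
      then show "S p * ?Z = ?Z * S p"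
        using s(3)[of p "(\<one>,True)"] s(3)[of "(\<one>,True)" p] by (auto simp: carD multD)
    qed
    have m: "m > 0" using irreducible_repD(2)[OF S(1)] .
    have SxT: "S (x,True) = z \<cdot>\<^sub>m S (x,False)" if x: "x \<in> carrier G" for x
    proof -
      have sx: "S (x,False) \<in> carrier_mat m m" using s(1) x by (simp add: carD)
      have "S (x,True) = S (x,False) * ?Z" using s(3)[of "(x,False)" "(\<one>,True)"] x by (auto simp: carD multD)
      also have "\<dots> = z \<cdot>\<^sub>m S (x,False)"
        unfolding Z using sx mult_smult_distrib[OF sx, of "1\<^sub>m m" m z] by simp
      finally show ?thesis .
    qed
    have "?Z * ?Z = 1\<^sub>m m"
      using s(3)[of "(\<one>,True)" "(\<one>,True)"] s(2) by (auto simp: carD multD oneD)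
    moreover have "?Z * ?Z = (z * z) \<cdot>\<^sub>m 1\<^sub>m m"
      unfolding Z by (rule eq_matI) (auto simp: scalar_prod_def if_distrib[of "\<lambda>x. _ * x"] sum.delta' cong: if_cong)
    ultimately have "((z * z) \<cdot>\<^sub>m 1\<^sub>m m) $$ (0,0) = (1\<^sub>m m :: complex mat) $$ (0,0)" by simp
    then have "z * z = 1" using m by simp
    then have z: "z = 1 \<or> z = -1" by (simp add: square_eq_1_iff)
    let ?S = "\<lambda>x. S (x,False)"
    have rep: "matrix_rep G m ?S"
      using s s(3)[of "(_,False)" "(_,False)"] by (auto simp: matrix_rep_def carD multD oneD)
    have irr: "irreducible_rep G m ?S"
      unfolding irreducible_rep_def
    proof (intro conjI allI impI rep m)
      fix W assume W: "vec_subspace m W"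
        "\<forall>x\<in>carrier G. \<forall>w\<in>W. ?S x *\<^sub>v w \<in> W"
      show "W = {0\<^sub>v m} \<or> W = carrier_vec m"
      proof (rule irreducible_repD(3)[OF S(1) W(1)])
        fix p w assume pw: "p \<in> carrier D" "w \<in> W"
        then obtain x b where p: "p = (x,b)" "x \<in> carrier G" by (auto simp: carD)
        have sx: "?S x \<in> carrier_mat m m" using s(1) p by (simp add: carD)
        have wc: "w \<in> carrier_vec m" using subspace_vecD(1)[OF W(1)] pw by auto
        have "S (x,True) *\<^sub>v w = z \<cdot>\<^sub>v (?S x *\<^sub>v w)"
          unfolding SxT[OF p(2)] using sx wc by (intro eq_vecI) (auto simp: scalar_prod_def sum_distrib_left mult_ac)
        moreover have "z \<cdot>\<^sub>v (?S x *\<^sub>v w) \<in> W" using subspace_vecD(4)[OF W(1)] W(2) p pw by auto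
        ultimately show "S p *\<^sub>v w \<in> W" using p W(2) pw by (cases b) auto
      qed
    qed
    have "\<chi> (x,False) = rep_character G ?S x \<and> \<chi> (x,True) = z * rep_character G ?S x" if x: "x \<in> carrier G" for x
    proof -
      have sx: "?S x \<in> carrier_mat m m" using s(1) x by (simp add: carD)
      show ?thesis using x SxT[OF x] mat_trace_smult[OF sx, of z] by (simp add: S(2) rep_character_def carD)
    qed
    moreover have "rep_character G ?S \<in> Irr G" by (rule rep_character_mem_Irr[OF irr])
    ultimately show ?thesis using z
      by (intro exI[of _ "rep_character G ?S"] exI[of _ "if z = 1 then 1 else -1 :: int"]) auto
  qed
  then obtain F E where FE: "\<And>\<chi>. \<chi> \<in> Irr D \<Longrightarrow> F \<chi> \<in> Irr G \<and> (E \<chi> = (1::int) \<or> E \<chi> = -1) \<and>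
      (\<forall>x\<in>carrier G. \<chi> (x, False) = F \<chi> x \<and> \<chi> (x, True) = of_int (E \<chi>) * F \<chi> x)" by metis
  obtain xs where xs: "set xs \<subseteq> Irr D" "\<And>p. p \<in> carrier D \<Longrightarrow> mat_trace (R p) = (\<Sum>\<chi>\<leftarrow>xs. \<chi> p)"
    using rep_trace_decomposition[OF R] by blast
  let ?zs = "map (\<lambda>\<chi>. (F \<chi>, E \<chi>)) xs"
  show ?thesis
  proof (rule that[of ?zs])
    show "\<psi> \<in> Irr G \<and> (z = 1 \<or> z = -1)" if "(\<psi>,z) \<in> set ?zs" for \<psi> z using that FE xs(1) by auto
    fix x assume x: "x \<in> carrier G"
    have "mat_trace (\<rho> x) = (\<Sum>\<chi>\<leftarrow>xs. \<chi> (x,False))" using xs(2)[of "(x,False)"] x by (simp add: carD R_def)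
    also have "\<dots> = (\<Sum>\<chi>\<leftarrow>xs. F \<chi> x)"
      by (rule arg_cong[where f=sum_list], rule map_cong[OF refl]) (use xs(1) FE x in auto)
    finally show "mat_trace (\<rho> x) = (\<Sum>(\<psi>,z)\<leftarrow>?zs. \<psi> x)" by (simp add: comp_def)
    have "mat_trace (\<rho> x * U) = (\<Sum>\<chi>\<leftarrow>xs. \<chi> (x,True))" using xs(2)[of "(x,True)"] x by (simp add: carD R_def)
    also have "\<dots> = (\<Sum>\<chi>\<leftarrow>xs. of_int (E \<chi>) * F \<chi> x)"
      by (rule arg_cong[where f=sum_list], rule map_cong[OF refl]) (use xs(1) FE x in auto)
    finally show "mat_trace (\<rho> x * U) = (\<Sum>(\<psi>,z)\<leftarrow>?zs. of_int z * \<psi> x)" by (simp add: comp_def)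
  qed
qed

text \<open>Taking \<open>f z = z\<close> gives the signed multiplicities in the trace against
  \<open>U\<close>, and \<open>f z = 1\<close> the ordinary multiplicities in the
  restriction.\<close>

lemma (in fin_group) char_inner_signed_list:
  assumes "\<And>\<psi> z. (\<psi>,z) \<in> set zs \<Longrightarrow> \<psi> \<in> Irr G" "\<phi> \<in> Irr G"
  shows "char_inner G (\<lambda>x. \<Sum>(\<psi>,z)\<leftarrow>zs. of_int (f z) * \<psi> x) \<phi> =
    of_int (\<Sum>(\<psi>,z)\<leftarrow>zs. if \<psi> = \<phi> then f z else 0)"
  using assms(1)
proof (induction zs)
  case Nil
  then show ?case by (simp add: char_inner_def)
next
  case (Cons p zs)
  obtain \<psi> z where p: "p = (\<psi>,z)" by (cases p)
  have \<psi>: "\<psi> \<in> Irr G" using Cons.prems[of \<psi> z] p by simp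
  have "char_inner G (\<lambda>x. \<Sum>(\<psi>,z)\<leftarrow>p # zs. of_int (f z) * \<psi> x) \<phi> =
      of_int (f z) * char_inner G \<psi> \<phi> + char_inner G (\<lambda>x. \<Sum>(\<psi>,z)\<leftarrow>zs. of_int (f z) * \<psi> x) \<phi>"
    by (simp add: p char_inner_def distrib_right sum.distrib add_divide_distrib sum_distrib_left mult.assoc)
  moreover have "char_inner G (\<lambda>x. \<Sum>(\<psi>,z)\<leftarrow>zs. of_int (f z) * \<psi> x) \<phi> =
    of_int (\<Sum>(\<psi>,z)\<leftarrow>zs. if \<psi> = \<phi> then f z else 0)"
    by (rule Cons.IH) (use Cons.prems in auto)
  ultimately show ?case by (simp add: p Irr_orthonormal[OF \<psi> assms(2)])
qed

lemma sum_squares_eq_1: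
  fixes a :: "'b \<Rightarrow> int"
  assumes "finite X" "(\<Sum>x\<in>X. (a x)\<^sup>2) = 1"
  obtains x where "x \<in> X" "a x = 1 \<or> a x = -1" "\<And>y. y \<in> X \<Longrightarrow> y \<noteq> x \<Longrightarrow> a y = 0"
proof -
  have "\<exists>x\<in>X. a x \<noteq> 0" by (rule ccontr) (use assms(2) in auto)
  then obtain x where x: "x \<in> X" "a x \<noteq> 0" by blast
  have s: "(a x)\<^sup>2 + (\<Sum>y\<in>X - {x}. (a y)\<^sup>2) = 1" using sum.remove[OF assms(1) x(1), of "\<lambda>x. (a x)\<^sup>2"] assms(2) by simp
  have nn: "(\<Sum>y\<in>X - {x}. (a y)\<^sup>2) \<ge> 0" by (intro sum_nonneg) simp
  have "(a x)\<^sup>2 > 0" using x(2) by simp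
  then have "(a x)\<^sup>2 = 1" "(\<Sum>y\<in>X - {x}. (a y)\<^sup>2) = 0" using s nn by linarith+
  then show ?thesis using that[of x] x assms(1)
    by (auto simp: power2_eq_1_iff sum_nonneg_eq_0_iff)
qed

text \<open>Signs are odd numbers, so a signed count and a plain count agree modulo 2. This is the
  link between the trace against \<open>U\<close> and odd multiplicity.\<close>

lemma even_sum_odd_list:
  fixes zs :: "('b \<times> int) list"
  assumes "\<And>p. p \<in> set zs \<Longrightarrow> odd (snd p)"
  shows "even (\<Sum>(\<psi>,z)\<leftarrow>zs. if \<psi> = \<phi> then z else 0) \<longleftrightarrow> even (length (filter (\<lambda>p. fst p = \<phi>) zs))"
  using assms
proof (induction zs)
  case (Cons p zs)
  have "odd (snd p)" using Cons.prems by simp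
  moreover have "even (\<Sum>(\<psi>,z)\<leftarrow>zs. if \<psi> = \<phi> then z else 0) \<longleftrightarrow> even (length (filter (\<lambda>p. fst p = \<phi>) zs))"
    by (rule Cons.IH) (use Cons.prems in auto)
  ultimately show ?case by (cases p) auto
qed simp

section \<open>Twisted conjugation in a group of odd order with an involution\<close>

locale odd_involution_group = fin_group +
  fixes \<tau> :: "'a \<Rightarrow> 'a"
  assumes odd_order: "odd (card (carrier G))"
    and \<tau>_closed [simp, intro]: "x \<in> carrier G \<Longrightarrow> \<tau> x \<in> carrier G"
    and \<tau>_mult: "x \<in> carrier G \<Longrightarrow> y \<in> carrier G \<Longrightarrow> \<tau> (x \<otimes> y) = \<tau> x \<otimes> \<tau> y"
    and \<tau>_\<tau> [simp]: "x \<in> carrier G \<Longrightarrow> \<tau> (\<tau> x) = x"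
begin

abbreviation C :: "('a, 'b) monoid_scheme" where
  "C \<equiv> G\<lparr>carrier := {x \<in> carrier G. \<tau> x = x}\<rparr>"

lemma \<tau>_one [simp]: "\<tau> \<one> = \<one>"
proof -
  have "\<tau> \<one> \<otimes> \<tau> \<one> = \<tau> \<one>" using \<tau>_mult[of \<one> \<one>] by simp
  then show ?thesis using l_cancel_one[of "\<tau> \<one>" "\<tau> \<one>"] by simp
qed

lemma \<tau>_inv: "x \<in> carrier G \<Longrightarrow> \<tau> (inv x) = inv (\<tau> x)"
  using \<tau>_mult[of "inv x" x] by (intro inv_equality[symmetric]) auto

lemma subgroup_C: "subgroup {x \<in> carrier G. \<tau> x = x} G"
  by (rule subgroupI) (auto simp: \<tau>_mult \<tau>_inv intro: exI[of _ \<one>])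

lemma fin_group_C: "fin_group C"
proof -
  interpret C: group C by (rule subgroup.subgroup_is_group[OF subgroup_C is_group])
  show ?thesis by unfold_locales (use finite_carrier in simp)
qed

lemma inv_C: "x \<in> carrier G \<Longrightarrow> \<tau> x = x \<Longrightarrow> inv\<^bsub>C\<^esub> x = inv x"
  by (rule m_inv_consistent[OF subgroup_C]) simp

text \<open>If \<open>|G| = 2k + 1\<close>, then raising to the power \<open>k + 1\<close> undoes
  squaring, since \<open>z\<close> to the power \<open>|G| + 1\<close> is \<open>z\<close>.\<close>

lemma square_inj:
  assumes x: "x \<in> carrier G" and y: "y \<in> carrier G" and eq: "x \<otimes> x = y \<otimes> y"
  shows "x = y"
proof -
  obtain k where k: "card (carrier G) = 2 * k + 1" using odd_order by (rule oddE)
  have "(z \<otimes> z) [^] (k + 1) = z" if z: "z \<in> carrier G" for z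
  proof -
    have "z \<otimes> z = z [^] (2::nat)" using z by (simp add: numeral_2_eq_2)
    then have "(z \<otimes> z) [^] (k + 1) = z [^] (2 * (k + 1))" using nat_pow_pow[OF z, of 2 "k + 1"] by simp
    also have "2 * (k + 1) = Suc (order G)" using k by (simp add: order_def)
    also have "z [^] Suc (order G) = z" using z pow_order_eq_1[OF z] by simp
    finally show ?thesis .
  qed
  from this[OF x] this[OF y] show ?thesis using eq by simp
qed

text \<open>Put \<open>y = x'^-1 x\<close>. In the semidirect product \<open>y\<close> conjugates
  \<open>c \<tau>\<close> to \<open>c' \<tau>\<close>. Squaring removes \<open>\<tau>\<close>,
  because \<open>c\<close> and \<open>c'\<close> are fixed, and gives
  \<open>y c^2 y^-1 = c'^2\<close>. Squares have unique roots in odd order, so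
  \<open>y c y^-1 = c'\<close>, and comparison with the original equation yields
  \<open>\<tau> y = y\<close>.\<close>

lemma twisted_fibre:
  assumes x: "x \<in> carrier G" "x' \<in> carrier G" and c: "c \<in> carrier C" "c' \<in> carrier C"
    and eq: "x \<otimes> c \<otimes> inv (\<tau> x) = x' \<otimes> c' \<otimes> inv (\<tau> x')"
  shows "inv x' \<otimes> x \<in> carrier C"
proof -
  have cc: "c \<in> carrier G" "\<tau> c = c" "c' \<in> carrier G" "\<tau> c' = c'" using c by auto
  define y where "y = inv x' \<otimes> x"
  have y: "y \<in> carrier G" using x by (simp add: y_def)
  have x_eq: "x = x' \<otimes> y" using x by (simp add: y_def m_assoc[symmetric])
  have "x' \<otimes> (y \<otimes> c \<otimes> inv (\<tau> y)) \<otimes> inv (\<tau> x') = x' \<otimes> c' \<otimes> inv (\<tau> x')"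
    using eq x y cc unfolding x_eq by (simp add: \<tau>_mult inv_mult_group m_assoc)
  then have "y \<otimes> c \<otimes> inv (\<tau> y) = c'" using x y cc by simp
  then have 1: "y \<otimes> c = c' \<otimes> \<tau> y" using inv_solve_right[of c' "y \<otimes> c" "\<tau> y"] y cc by simp
  have "\<tau> (y \<otimes> c) = \<tau> (c' \<otimes> \<tau> y)" using 1 by simp
  then have 2: "\<tau> y \<otimes> c = c' \<otimes> y" using y cc by (simp add: \<tau>_mult)
  have "inv y \<otimes> (y \<otimes> (c \<otimes> inv y)) = c \<otimes> inv y" using y cc by (simp add: m_assoc[symmetric])
  then have "y \<otimes> c \<otimes> inv y \<otimes> (y \<otimes> c \<otimes> inv y) = y \<otimes> c \<otimes> c \<otimes> inv y"
    using y cc by (simp add: m_assoc)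
  also have "\<dots> = c' \<otimes> (\<tau> y \<otimes> c) \<otimes> inv y" unfolding 1 using y cc by (simp add: m_assoc)
  also have "\<dots> = c' \<otimes> c'" unfolding 2 using y cc by (simp add: m_assoc)
  finally have "y \<otimes> c \<otimes> inv y = c'" by (rule square_inj[rotated 2]) (use y cc in auto)
  then have "y \<otimes> c = c' \<otimes> y" using inv_solve_right[of c' "y \<otimes> c" y] y cc by simp
  then have "c' \<otimes> \<tau> y = c' \<otimes> y" using 1 by simp
  then show ?thesis using y cc by (simp add: y_def)
qed

text \<open>Every element of the coset \<open>G\<tau>\<close> of the semidirect product is conjugate to some \<open>c\<tau>\<close> with \<open>c\<close>
  fixed by \<open>\<tau>\<close>, and this sums a function over that coset along the conjugates.\<close>

lemma sum_twisted:
  fixes f :: "'a \<Rightarrow> complex"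
  shows "(\<Sum>x\<in>carrier G. \<Sum>c\<in>carrier C. f (x \<otimes> c \<otimes> inv (\<tau> x))) =
    of_nat (card (carrier C)) * (\<Sum>g\<in>carrier G. f g)"
proof -
  define h where "h = (\<lambda>(x,c). x \<otimes> c \<otimes> inv (\<tau> x))"
  let ?S = "carrier G \<times> carrier C"
  let ?F = "\<lambda>g. {p \<in> ?S. h p = g}"
  have fC: "finite (carrier C)" using finite_carrier by simp
  have fin: "finite ?S" using finite_carrier by simp
  have h_im: "h ` ?S \<subseteq> carrier G" by (auto simp: h_def)
  \<comment> \<open>Surjectivity is obtained by counting: each of the \<open>|G|\<close> fibres has
    at most \<open>|C|\<close> elements, and together they have \<open>|G| |C|\<close>, so all
    fibres have exactly \<open>|C|\<close> elements.\<close>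
  have le: "card (?F g) \<le> card (carrier C)" for g
  proof (cases "?F g = {}")
    case False
    then obtain x0 c0 where 0: "x0 \<in> carrier G" "c0 \<in> carrier C" "h (x0,c0) = g" by auto
    show ?thesis
    proof (rule card_inj_on_le[OF _ _ fC])
      show "(\<lambda>p. inv x0 \<otimes> fst p) ` ?F g \<subseteq> carrier C"
      proof
        fix y assume "y \<in> (\<lambda>p. inv x0 \<otimes> fst p) ` ?F g"
        then obtain x c where xc: "x \<in> carrier G" "c \<in> carrier C" "h (x,c) = g" "y = inv x0 \<otimes> x" by auto
        show "y \<in> carrier C" unfolding xc(4)
          by (rule twisted_fibre[OF xc(1) 0(1) xc(2) 0(2)]) (use xc 0 in \<open>simp add: h_def\<close>)
      qed
      show "inj_on (\<lambda>p. inv x0 \<otimes> fst p) (?F g)"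
      proof (rule inj_onI)
        fix p q assume p: "p \<in> ?F g" and q: "q \<in> ?F g" and eq: "inv x0 \<otimes> fst p = inv x0 \<otimes> fst q"
        obtain x c x' c' where pq: "p = (x,c)" "q = (x',c')" by (cases p, cases q)
        have mem: "x \<in> carrier G" "x' \<in> carrier G" "c \<in> carrier G" "c' \<in> carrier G" using p q pq by auto
        have "x = x'" using eq mem 0(1) pq by simp
        moreover have "x \<otimes> c \<otimes> inv (\<tau> x) = x' \<otimes> c' \<otimes> inv (\<tau> x')" using p q pq by (simp add: h_def)
        ultimately show "p = q" using mem pq by simp
      qed
    qed
  next
    case True
    then show ?thesis by (simp only: card.empty le0)
  qed
  have tot: "(\<Sum>g\<in>carrier G. card (?F g)) = card (carrier G) * card (carrier C)"
  proof -
    have "(\<Sum>g\<in>carrier G. card (?F g)) = (\<Sum>g\<in>carrier G. \<Sum>p\<in>?F g. 1)" by simp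
    also have "\<dots> = (\<Sum>p\<in>?S. 1)" by (rule sum.group[OF fin finite_carrier h_im])
    finally show ?thesis by (simp add: card_cartesian_product)
  qed
  have eq: "card (?F g) = card (carrier C)" if g: "g \<in> carrier G" for g
  proof (rule ccontr)
    assume "card (?F g) \<noteq> card (carrier C)"
    then have "card (?F g) < card (carrier C)" using le[of g] by simp
    then have "(\<Sum>g\<in>carrier G. card (?F g)) < (\<Sum>g\<in>carrier G. card (carrier C))"
      using le g finite_carrier by (intro sum_strict_mono_ex1) auto
    then show False using tot by simp
  qed
  have "(\<Sum>x\<in>carrier G. \<Sum>c\<in>carrier C. f (x \<otimes> c \<otimes> inv (\<tau> x))) = (\<Sum>p\<in>?S. f (h p))"
    by (simp add: sum.cartesian_product h_def case_prod_unfold)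
  also have "\<dots> = (\<Sum>g\<in>carrier G. \<Sum>p\<in>?F g. f (h p))" by (rule sum.group[symmetric, OF fin finite_carrier h_im])
  also have "\<dots> = (\<Sum>g\<in>carrier G. of_nat (card (carrier C)) * f g)"
  proof (rule sum.cong[OF refl])
    fix g assume g: "g \<in> carrier G"
    have "(\<Sum>p\<in>?F g. f (h p)) = (\<Sum>p\<in>?F g. f g)" by (intro sum.cong) auto
    then show "(\<Sum>p\<in>?F g. f (h p)) = of_nat (card (carrier C)) * f g" using eq[OF g] by simp
  qed
  finally show ?thesis by (simp add: sum_distrib_left)
qed

lemma irreducible_rep_twist:
  assumes "irreducible_rep G n \<rho>"
  shows "irreducible_rep G n (\<lambda>x. \<rho> (\<tau> x))"
  unfolding irreducible_rep_def
proof (intro conjI allI impI)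
  note r = matrix_repD[OF irreducible_repD(1)[OF assms]]
  show "matrix_rep G n (\<lambda>x. \<rho> (\<tau> x))" using r by (auto simp: matrix_rep_def \<tau>_mult)
  show "n > 0" using irreducible_repD(2)[OF assms] .
  fix W assume W: "vec_subspace n W"
    "\<forall>x\<in>carrier G. \<forall>w\<in>W. \<rho> (\<tau> x) *\<^sub>v w \<in> W"
  show "W = {0\<^sub>v n} \<or> W = carrier_vec n"
  proof (rule irreducible_repD(3)[OF assms W(1)])
    fix x w assume "x \<in> carrier G" "w \<in> W"
    then show "\<rho> x *\<^sub>v w \<in> W" using W(2)[rule_format, of "\<tau> x" w] by simp
  qed
qed

text \<open>\<open>U\<close> is the image of \<open>\<tau>\<close> in an extension of
  \<open>\<rho>\<close> to the semidirect product of \<open>G\<close> with the group generated by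
  \<open>\<tau>\<close>. Thus \<open>mat_trace (\<rho> g * U)\<close> is the extended character at
  \<open>g \<tau>\<close>, and the semidirect product itself need not be formed.\<close>

definition twister :: "nat \<Rightarrow> ('a \<Rightarrow> complex mat) \<Rightarrow> complex mat \<Rightarrow> bool" where
  "twister n \<rho> U \<longleftrightarrow> U \<in> carrier_mat n n \<and> U * U = 1\<^sub>m n \<and> (\<forall>x\<in>carrier G. \<rho> x * U = U * \<rho> (\<tau> x))"

text \<open>Invariance of the character provides an invertible intertwiner \<open>T\<close> from
  \<open>\<rho>\<close> to its twist. Applying the relation twice shows that \<open>T * T\<close>
  commutes with \<open>\<rho>\<close>, so it is a nonzero scalar \<open>c\<close>; dividing
  \<open>T\<close> by a square root of \<open>c\<close> makes it an involution.\<close>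

lemma twister_exists:
  assumes \<rho>: "irreducible_rep G n \<rho>"
    and inv: "\<And>x. x \<in> carrier G \<Longrightarrow> rep_character G \<rho> (\<tau> x) = rep_character G \<rho> x"
  obtains U where "twister n \<rho> U"
proof -
  note r = matrix_repD[OF irreducible_repD(1)[OF \<rho>]]
  have "rep_character G \<rho> = rep_character G (\<lambda>x. \<rho> (\<tau> x))"
    using inv by (auto simp: rep_character_def fun_eq_iff split: if_splits)
  then obtain T where T: "T \<in> carrier_mat n n" "T \<noteq> 0\<^sub>m n n"
    "\<And>x. x \<in> carrier G \<Longrightarrow> \<rho> x * T = T * \<rho> (\<tau> x)"
    using eq_character_imp_intertwiner[OF \<rho> irreducible_rep_twist[OF \<rho>]] by metis
  obtain S where S: "S \<in> carrier_mat n n" "T * S = 1\<^sub>m n" "S * T = 1\<^sub>m n"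
    using schur_lemma[OF \<rho> irreducible_rep_twist[OF \<rho>] T] by metis
  define c where "c = mat_trace (T * T) / of_nat n"
  have TT: "T * T = c \<cdot>\<^sub>m 1\<^sub>m n"
    unfolding c_def
  proof (rule schur_lemma_scalar[OF \<rho>])
    fix x assume x: "x \<in> carrier G"
    have "\<rho> x * (T * T) = \<rho> x * T * T"
      using T(1) r(1)[OF x] by (intro assoc_mult_mat[symmetric, of _ n n _ n _ n]) auto
    also have "\<dots> = T * (\<rho> (\<tau> x) * T)"
      unfolding T(3)[OF x] using T(1) r(1)[of "\<tau> x"] x by (intro assoc_mult_mat[of _ n n _ n _ n]) auto
    also have "\<dots> = T * (T * \<rho> x)" using T(3)[of "\<tau> x"] x by simp
    also have "\<dots> = T * T * \<rho> x"
      using T(1) r(1)[OF x] by (intro assoc_mult_mat[symmetric, of _ n n _ n _ n]) auto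
    finally show "\<rho> x * (T * T) = T * T * \<rho> x" .
  qed (use T in auto)
  have "c \<noteq> 0"
  proof
    assume "c = 0"
    then have "T * T = 0\<^sub>m n n" using TT by (auto intro!: eq_matI)
    then have "S * (T * T) = 0\<^sub>m n n" using S(1) by simp
    moreover have "S * (T * T) = T"
      using assoc_mult_mat[OF S(1) T(1) T(1)] S(3) T(1) by simp
    ultimately show False using T(2) by simp
  qed
  define d where "d = inverse (csqrt c)"
  have d: "d * d * c = 1"
    using \<open>c \<noteq> 0\<close> power2_csqrt[of c] by (simp add: d_def power2_eq_square field_simps)
  have "twister n \<rho> (d \<cdot>\<^sub>m T)"
    unfolding twister_def
  proof (intro conjI ballI)
    have "(d \<cdot>\<^sub>m T) * (d \<cdot>\<^sub>m T) = d \<cdot>\<^sub>m (d \<cdot>\<^sub>m (T * T))"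
      using T(1) mult_smult_assoc_mat[OF T(1), of "d \<cdot>\<^sub>m T" n d] mult_smult_distrib[OF T(1) T(1), of d] by simp
    also have "\<dots> = 1\<^sub>m n" unfolding TT using d by (intro eq_matI) (auto simp: mult.assoc)
    finally show "(d \<cdot>\<^sub>m T) * (d \<cdot>\<^sub>m T) = 1\<^sub>m n" .
    fix x assume x: "x \<in> carrier G"
    show "\<rho> x * (d \<cdot>\<^sub>m T) = d \<cdot>\<^sub>m T * \<rho> (\<tau> x)"
      using T(3)[OF x] mult_smult_distrib[OF r(1)[OF x] T(1), of d] mult_smult_assoc_mat[OF T(1) r(1)[of "\<tau> x"], of d] x
      by simp
  qed (use T in simp)
  then show ?thesis using that by blast
qed

text \<open>In the semidirect product \<open>x c \<tau>(x)^-1 \<tau>\<close> is the conjugate of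
  \<open>c \<tau>\<close> by \<open>x\<close>, so this is conjugation invariance of the extended
  character.\<close>

lemma twisted_trace:
  assumes \<rho>: "matrix_rep G n \<rho>" and U: "twister n \<rho> U"
    and x: "x \<in> carrier G" and c: "c \<in> carrier G"
  shows "mat_trace (\<rho> (x \<otimes> c \<otimes> inv (\<tau> x)) * U) = mat_trace (\<rho> c * U)"
proof -
  note r = matrix_repD[OF \<rho>]
  have U: "U \<in> carrier_mat n n" "\<And>x. x \<in> carrier G \<Longrightarrow> \<rho> x * U = U * \<rho> (\<tau> x)" using U by (auto simp: twister_def)
  note car = r(1)[OF x] r(1)[OF c] r(1)[of "inv x"] r(1)[of "inv (\<tau> x)"] U(1)
  have "\<rho> (x \<otimes> c \<otimes> inv (\<tau> x)) * U = \<rho> x * \<rho> c * \<rho> (inv (\<tau> x)) * U" using x c by (simp add: r(3))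
  also have "\<dots> = \<rho> x * \<rho> c * (\<rho> (inv (\<tau> x)) * U)"
    using car x by (intro assoc_mult_mat[of _ n n _ n _ n]) auto
  also have "\<rho> (inv (\<tau> x)) * U = U * \<rho> (inv x)" using U(2)[of "inv (\<tau> x)"] x by (simp add: \<tau>_inv)
  also have "\<rho> x * \<rho> c * (U * \<rho> (inv x)) = \<rho> x * (\<rho> c * U) * \<rho> (inv x)"
    using car x by (simp add: assoc_mult_mat[of _ n n _ n _ n])
  finally show ?thesis using mat_trace_similar[of "\<rho> c * U" n "\<rho> x" n "\<rho> (inv x)"] car x rep_inv[OF \<rho> x] by simp
qed

text \<open>The product of the two traces is constant along twisted conjugation, so
  \<open>sum_twisted\<close> moves the sum from all of \<open>G\<close> to the fixed
  subgroup.\<close>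

lemma twisted_orthogonality:
  assumes \<rho>: "matrix_rep G n \<rho>" and U: "twister n \<rho> U"
    and \<rho>': "matrix_rep G m \<rho>'" and U': "twister m \<rho>' U'"
  shows "of_nat (card (carrier C)) * (\<Sum>g\<in>carrier G. mat_trace (\<rho> g * U) * mat_trace (\<rho>' (inv g) * U')) =
    of_nat (card (carrier G)) * (\<Sum>c\<in>carrier C. mat_trace (\<rho> c * U) * mat_trace (\<rho>' (inv c) * U'))"
proof -
  have "of_nat (card (carrier C)) * (\<Sum>g\<in>carrier G. mat_trace (\<rho> g * U) * mat_trace (\<rho>' (inv g) * U')) =
     (\<Sum>x\<in>carrier G. \<Sum>c\<in>carrier C. mat_trace (\<rho> (x \<otimes> c \<otimes> inv (\<tau> x)) * U) * mat_trace (\<rho>' (inv (x \<otimes> c \<otimes> inv (\<tau> x))) * U'))"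
    by (rule sum_twisted[symmetric])
  also have "\<dots> = (\<Sum>x\<in>carrier G. \<Sum>c\<in>carrier C. mat_trace (\<rho> c * U) * mat_trace (\<rho>' (inv c) * U'))"
  proof (intro sum.cong refl)
    fix x c assume x: "x \<in> carrier G" and c: "c \<in> carrier C"
    \<comment> \<open>The inverse is again a twisted conjugate, of \<open>inv c\<close> by
      \<open>\<tau> x\<close>; this is what makes \<open>twisted_trace\<close> applicable to the
      second factor too.\<close>
    have "inv (x \<otimes> c \<otimes> inv (\<tau> x)) = \<tau> x \<otimes> inv c \<otimes> inv (\<tau> (\<tau> x))"
      using x c by (simp add: inv_mult_group m_assoc)
    then show "mat_trace (\<rho> (x \<otimes> c \<otimes> inv (\<tau> x)) * U) * mat_trace (\<rho>' (inv (x \<otimes> c \<otimes> inv (\<tau> x))) * U') =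
        mat_trace (\<rho> c * U) * mat_trace (\<rho>' (inv c) * U')"
      using twisted_trace[OF \<rho> U x, of c] twisted_trace[OF \<rho>' U', of "\<tau> x" "inv c"] x c by simp
  qed
  finally show ?thesis by simp
qed

lemma char_inner_C:
  assumes "\<phi> \<in> Irr C"
  shows "char_inner C f \<phi> = (\<Sum>c\<in>carrier C. f c * \<phi> (inv c)) / of_nat (card (carrier C))"
  unfolding fin_group.char_inner_Irr[OF fin_group_C assms]
  by (intro arg_cong2[where f="(/)"] sum.cong refl) (simp add: inv_C)

text \<open>On \<open>C\<close>, the trace of \<open>\<rho>\<close> against \<open>U\<close> is the difference of the characters of the two eigenspaces
  of \<open>U\<close>, and the restriction of the character of \<open>\<rho>\<close> is their sum. The difference has norm 1, so it is
  irreducible up to sign, and it agrees with the sum modulo 2.\<close>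

lemma twisted_character:
  assumes \<rho>: "irreducible_rep G n \<rho>" and U: "twister n \<rho> U"
  obtains \<phi> and e :: int where "\<phi> \<in> Irr C" "e = 1 \<or> e = -1"
    "\<And>c. c \<in> carrier C \<Longrightarrow> mat_trace (\<rho> c * U) = of_int e * \<phi> c"
    "\<And>\<psi>. odd_constituent C \<psi> (char_restrict C (rep_character G \<rho>)) \<longleftrightarrow> \<psi> = \<phi>"
proof -
  note m = irreducible_repD(1)[OF \<rho>]
  note r = matrix_repD[OF m]
  interpret C: fin_group C by (rule fin_group_C)
  have U': "U \<in> carrier_mat n n" "U * U = 1\<^sub>m n" "\<And>x. x \<in> carrier G \<Longrightarrow> \<rho> x * U = U * \<rho> (\<tau> x)"
    using U by (auto simp: twister_def)
  have repC: "matrix_rep C n \<rho>" using m by (auto simp: matrix_rep_def)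
  have "\<rho> c * U = U * \<rho> c" if "c \<in> carrier C" for c using U'(3)[of c] that by simp
  then obtain zs :: "(('a \<Rightarrow> complex) \<times> int) list" where
    zs: "\<And>\<psi> z. (\<psi>,z) \<in> set zs \<Longrightarrow> \<psi> \<in> Irr C \<and> (z = 1 \<or> z = -1)"
    "\<And>x. x \<in> carrier C \<Longrightarrow> mat_trace (\<rho> x) = (\<Sum>(\<psi>,z)\<leftarrow>zs. \<psi> x)"
    "\<And>x. x \<in> carrier C \<Longrightarrow> mat_trace (\<rho> x * U) = (\<Sum>(\<psi>,z)\<leftarrow>zs. of_int z * \<psi> x)"
    using C.rep_involution_decomposition[OF repC U'(1,2)] by blast
  define a where "a \<phi> = (\<Sum>(\<psi>,z)\<leftarrow>zs. if \<psi> = \<phi> then z else 0)" for \<phi>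
  define k where "k \<phi> = length (filter (\<lambda>p. fst p = \<phi>) zs)" for \<phi>
  have parity: "even (a \<phi>) \<longleftrightarrow> even (k \<phi>)" for \<phi>
    unfolding a_def k_def by (rule even_sum_odd_list) (use zs(1) in force)
  have k: "char_inner C (char_restrict C (rep_character G \<rho>)) \<phi> = of_nat (k \<phi>)" if \<phi>: "\<phi> \<in> Irr C" for \<phi>
  proof -
    have "char_inner C (char_restrict C (rep_character G \<rho>)) \<phi> =
        char_inner C (\<lambda>x. \<Sum>(\<psi>,z)\<leftarrow>zs. of_int 1 * \<psi> x) \<phi>"
      by (rule C.char_inner_cong) (use zs(2) in \<open>auto simp: char_restrict_def rep_character_def\<close>)
    also have "\<dots> = of_int (\<Sum>(\<psi>,z)\<leftarrow>zs. if \<psi> = \<phi> then 1 else 0)"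
      using C.char_inner_signed_list[of zs \<phi> "\<lambda>_. 1"] zs(1) \<phi> by blast
    also have "(\<Sum>(\<psi>,z)\<leftarrow>zs. if \<psi> = \<phi> then 1 else 0) = int (k \<phi>)"
      unfolding k_def by (induction zs) auto
    finally show ?thesis by simp
  qed
  have theta: "mat_trace (\<rho> c * U) = (\<Sum>\<phi>\<in>Irr C. of_int (a \<phi>) * \<phi> c)" if c: "c \<in> carrier C" for c
  proof -
    have "(\<Sum>(\<psi>,z)\<leftarrow>zs. of_int z * \<psi> c) = (\<Sum>\<phi>\<in>Irr C. of_int (a \<phi>) * \<phi> c)"
      unfolding a_def using zs(1)
    proof (induction zs)
      case (Cons p zs)
      obtain \<psi> z where p: "p = (\<psi>,z)" by (cases p)
      have \<psi>: "\<psi> \<in> Irr C" using Cons.prems[of \<psi> z] p by simp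
      have "(\<Sum>\<phi>\<in>Irr C. of_int (\<Sum>(\<psi>,z)\<leftarrow>p # zs. if \<psi> = \<phi> then z else 0) * \<phi> c) =
        (\<Sum>\<phi>\<in>Irr C. (if \<phi> = \<psi> then of_int z * \<phi> c else 0) + of_int (\<Sum>(\<psi>,z)\<leftarrow>zs. if \<psi> = \<phi> then z else 0) * \<phi> c)"
        by (intro sum.cong refl) (simp add: p distrib_right)
      also have "\<dots> = of_int z * \<psi> c + (\<Sum>\<phi>\<in>Irr C. of_int (\<Sum>(\<psi>,z)\<leftarrow>zs. if \<psi> = \<phi> then z else 0) * \<phi> c)"
        using C.regular_character(1) \<psi> by (simp add: sum.distrib sum.delta)
      also have "(\<Sum>\<phi>\<in>Irr C. of_int (\<Sum>(\<psi>,z)\<leftarrow>zs. if \<psi> = \<phi> then z else 0) * \<phi> c) = (\<Sum>(\<psi>,z)\<leftarrow>zs. of_int z * \<psi> c)"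
        by (rule Cons.IH[symmetric]) (use Cons.prems in auto)
      finally show ?case by (simp add: p)
    qed simp
    then show ?thesis using zs(3)[OF c] by simp
  qed
  let ?NC = "of_nat (card (carrier C)) :: complex"
  let ?NG = "of_nat (card (carrier G)) :: complex"
  have NC: "?NC \<noteq> 0" using C.card_carrier_pos by simp
  have NG: "?NG \<noteq> 0" using card_carrier_pos by simp
  \<comment> \<open>Norm of the twisted trace on \<open>C\<close>, computed on \<open>G\<close>: the
    orthogonality relation with \<open>A = B = U\<close> gives \<open>|G|\<close>, because
    \<open>U * U\<close> is the identity and has trace \<open>n\<close>.\<close>
  have "?NC * (?NG * mat_trace (U * U) / of_nat n) = ?NG * (\<Sum>c\<in>carrier C. mat_trace (\<rho> c * U) * mat_trace (\<rho> (inv c) * U))"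
    using twisted_orthogonality[OF m U m U] trace_orthogonality_same[OF \<rho> U'(1) U'(1)] by simp
  then have "?NC = (\<Sum>c\<in>carrier C. mat_trace (\<rho> c * U) * mat_trace (\<rho> (inv c) * U))"
    using NG U'(2) irreducible_repD(2)[OF \<rho>] by simp
  also have "\<dots> = (\<Sum>c\<in>carrier C. mat_trace (\<rho> c * U) * (\<Sum>\<phi>\<in>Irr C. of_int (a \<phi>) * \<phi> (inv c)))"
    by (intro sum.cong refl) (subst theta[of "inv _"], auto simp: \<tau>_inv)
  also have "\<dots> = (\<Sum>\<phi>\<in>Irr C. of_int (a \<phi>) * (\<Sum>c\<in>carrier C. mat_trace (\<rho> c * U) * \<phi> (inv c)))"
    by (simp only: sum_distrib_left, subst sum.swap) (simp only: mult_ac)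
  also have "\<dots> = (\<Sum>\<phi>\<in>Irr C. of_int (a \<phi>) * (?NC * of_int (a \<phi>)))"
  proof (intro sum.cong refl)
    fix \<phi> assume \<phi>: "\<phi> \<in> Irr C"
    have "char_inner C (\<lambda>c. mat_trace (\<rho> c * U)) \<phi> = char_inner C (\<lambda>x. \<Sum>(\<psi>,z)\<leftarrow>zs. of_int z * \<psi> x) \<phi>"
      by (rule C.char_inner_cong) (use zs(3) in auto)
    also have "\<dots> = of_int (a \<phi>)" unfolding a_def
      using C.char_inner_signed_list[of zs \<phi> "\<lambda>z. z"] zs(1) \<phi> by blast
    finally have "(\<Sum>c\<in>carrier C. mat_trace (\<rho> c * U) * \<phi> (inv c)) = ?NC * of_int (a \<phi>)"
      unfolding char_inner_C[OF \<phi>] using NC by (simp add: field_simps)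
    then show "of_int (a \<phi>) * (\<Sum>c\<in>carrier C. mat_trace (\<rho> c * U) * \<phi> (inv c)) = of_int (a \<phi>) * (?NC * of_int (a \<phi>))" by simp
  qed
  also have "\<dots> = ?NC * of_int (\<Sum>\<phi>\<in>Irr C. (a \<phi>)\<^sup>2)"
    by (simp add: sum_distrib_left power2_eq_square mult_ac)
  finally have "of_int (\<Sum>\<phi>\<in>Irr C. (a \<phi>)\<^sup>2) = (1::complex)" using NC by simp
  then have "(\<Sum>\<phi>\<in>Irr C. (a \<phi>)\<^sup>2) = 1" by (simp only: of_int_eq_1_iff)
  then obtain \<phi> where \<phi>: "\<phi> \<in> Irr C" "a \<phi> = 1 \<or> a \<phi> = -1" "\<And>\<psi>. \<psi> \<in> Irr C \<Longrightarrow> \<psi> \<noteq> \<phi> \<Longrightarrow> a \<psi> = 0"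
    using sum_squares_eq_1[OF C.regular_character(1), of a] by blast
  show ?thesis
  proof (rule that[OF \<phi>(1,2)])
    show "mat_trace (\<rho> c * U) = of_int (a \<phi>) * \<phi> c" if c: "c \<in> carrier C" for c
    proof -
      have "(\<Sum>\<psi>\<in>Irr C. of_int (a \<psi>) * \<psi> c) = (\<Sum>\<psi>\<in>Irr C. if \<psi> = \<phi> then of_int (a \<phi>) * \<phi> c else 0)"
        by (intro sum.cong refl) (auto simp: \<phi>(3))
      then show ?thesis using theta[OF c] \<phi>(1) C.regular_character(1) by (simp add: sum.delta)
    qed
    fix \<psi>
    have "odd_constituent C \<psi> (char_restrict C (rep_character G \<rho>)) \<longleftrightarrow> \<psi> \<in> Irr C \<and> odd (k \<psi>)"
    proof (cases "\<psi> \<in> Irr C")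
      case True
      then show ?thesis unfolding odd_constituent_def k[OF True] of_nat_eq_iff by blast
    qed (simp add: odd_constituent_def)
    also have "\<dots> \<longleftrightarrow> \<psi> = \<phi>"
    proof -
      have "odd (k \<phi>)" using parity[of \<phi>] \<phi>(2) by auto
      moreover have "even (k \<psi>)" if "\<psi> \<in> Irr C" "\<psi> \<noteq> \<phi>" using parity[of \<psi>] \<phi>(3)[OF that] by simp
      ultimately show ?thesis using \<phi>(1) by blast
    qed
    finally show "odd_constituent C \<psi> (char_restrict C (rep_character G \<rho>)) \<longleftrightarrow> \<psi> = \<phi>" .
  qed
qed

text \<open>Injectivity: for distinct invariant characters the twisted traces are orthogonal over
  \<open>G\<close>, hence over \<open>C\<close>, where they are the correspondents up to sign.
  Surjectivity: for given \<open>\<psi>\<close> some irreducible \<open>\<rho>\<close> does not kill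
  the twisted average of \<open>\<psi>\<close>. That average intertwines \<open>\<rho>\<close> with
  its twist, so the character of \<open>\<rho>\<close> is invariant, and its correspondent has to be
  \<open>\<psi>\<close>.\<close>

theorem glauberman_bij:
  "bij_betw (\<lambda>\<chi>. THE \<psi>. odd_constituent C \<psi> (char_restrict C \<chi>))
     {\<chi> \<in> Irr G. \<forall>x\<in>carrier G. \<chi> (\<tau> x) = \<chi> x} (Irr C)" (is "bij_betw ?\<pi> ?I _")
proof -
  interpret C: fin_group C by (rule fin_group_C)
  let ?NC = "of_nat (card (carrier C)) :: complex"
  let ?NG = "of_nat (card (carrier G)) :: complex"
  have NC: "?NC \<noteq> 0" using C.card_carrier_pos by simp
  have NG: "?NG \<noteq> 0" using card_carrier_pos by simp
  have inner: "(\<Sum>c\<in>carrier C. \<phi> c * \<psi> (inv c)) = (if \<phi> = \<psi> then ?NC else 0)" if "\<phi> \<in> Irr C" "\<psi> \<in> Irr C" for \<phi> \<psi>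
    using C.Irr_orthonormal[OF that] char_inner_C[OF that(2), of \<phi>] NC by (simp split: if_splits)
  have data: "\<exists>n \<rho> U \<phi> e. irreducible_rep G n \<rho> \<and> \<chi> = rep_character G \<rho> \<and> twister n \<rho> U \<and> \<phi> \<in> Irr C \<and>
      (e = (1::int) \<or> e = -1) \<and> (\<forall>c\<in>carrier C. mat_trace (\<rho> c * U) = of_int e * \<phi> c) \<and> ?\<pi> \<chi> = \<phi>" if "\<chi> \<in> ?I" for \<chi>
  proof -
    obtain n \<rho> where \<rho>: "irreducible_rep G n \<rho>" "\<chi> = rep_character G \<rho>" using Irr_cases \<open>\<chi> \<in> ?I\<close> by blast
    have "rep_character G \<rho> (\<tau> x) = rep_character G \<rho> x" if "x \<in> carrier G" for x
      using \<open>\<chi> \<in> ?I\<close> \<rho>(2) that by simp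
    then obtain U where U: "twister n \<rho> U" by (rule twister_exists[OF \<rho>(1)])
    obtain \<phi> and e :: int where \<phi>: "\<phi> \<in> Irr C" "e = 1 \<or> e = -1"
      "\<And>c. c \<in> carrier C \<Longrightarrow> mat_trace (\<rho> c * U) = of_int e * \<phi> c"
      "\<And>\<psi>. odd_constituent C \<psi> (char_restrict C (rep_character G \<rho>)) \<longleftrightarrow> \<psi> = \<phi>"
      using twisted_character[OF \<rho>(1) U] by blast
    have "?\<pi> \<chi> = \<phi>" unfolding \<rho>(2) \<phi>(4) by simp
    then show ?thesis using \<rho> U \<phi> by blast
  qed
  show ?thesis
    unfolding bij_betw_def
  proof (intro conjI subset_antisym)
    show "?\<pi> ` ?I \<subseteq> Irr C" using data by blast
    show "inj_on ?\<pi> ?I"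
    proof (rule inj_onI, rule ccontr)
      fix \<chi> \<chi>' assume \<chi>: "\<chi> \<in> ?I" and \<chi>': "\<chi>' \<in> ?I" and eq: "?\<pi> \<chi> = ?\<pi> \<chi>'" and ne: "\<chi> \<noteq> \<chi>'"
      obtain n \<rho> U \<phi> e where 1: "irreducible_rep G n \<rho>" "\<chi> = rep_character G \<rho>" "twister n \<rho> U" "\<phi> \<in> Irr C"
        "e = (1::int) \<or> e = -1" "\<forall>c\<in>carrier C. mat_trace (\<rho> c * U) = of_int e * \<phi> c" "?\<pi> \<chi> = \<phi>"
        using data[OF \<chi>] by blast
      obtain n' \<rho>' U' \<phi>' e' where 2: "irreducible_rep G n' \<rho>'" "\<chi>' = rep_character G \<rho>'" "twister n' \<rho>' U'" "\<phi>' \<in> Irr C"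
        "e' = (1::int) \<or> e' = -1" "\<forall>c\<in>carrier C. mat_trace (\<rho>' c * U') = of_int e' * \<phi>' c" "?\<pi> \<chi>' = \<phi>'"
        using data[OF \<chi>'] by blast
      have \<phi>': "\<phi>' = \<phi>" using 1(7) 2(7) eq by simp
      have "(\<Sum>g\<in>carrier G. mat_trace (\<rho> g * U) * mat_trace (\<rho>' (inv g) * U')) = 0"
        by (rule trace_orthogonality_distinct[OF 1(1) 2(1)])
          (use ne 1(2,3) 2(2,3) intertwiner_imp_eq_character[OF 1(1) 2(1)] in \<open>auto simp: twister_def\<close>)
      then have "(\<Sum>c\<in>carrier C. mat_trace (\<rho> c * U) * mat_trace (\<rho>' (inv c) * U')) = 0"
        using twisted_orthogonality[OF irreducible_repD(1)[OF 1(1)] 1(3) irreducible_repD(1)[OF 2(1)] 2(3)] NG by simp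
      also have "(\<Sum>c\<in>carrier C. mat_trace (\<rho> c * U) * mat_trace (\<rho>' (inv c) * U')) =
         (\<Sum>c\<in>carrier C. of_int (e * e') * (\<phi> c * \<phi> (inv c)))"
      proof (intro sum.cong refl)
        fix c assume c: "c \<in> carrier C"
        then have "inv c \<in> carrier C" by (auto simp: \<tau>_inv)
        then show "mat_trace (\<rho> c * U) * mat_trace (\<rho>' (inv c) * U') = of_int (e * e') * (\<phi> c * \<phi> (inv c))"
          using 1(6) 2(6) \<phi>' c by simp
      qed
      also have "\<dots> = of_int (e * e') * ?NC" using inner[OF 1(4) 1(4)] by (simp only: sum_distrib_left[symmetric]) simp
      finally show False using NC 1(5) 2(5) by auto
    qed
    show "Irr C \<subseteq> ?\<pi> ` ?I"
    proof
      fix \<psi> assume \<psi>: "\<psi> \<in> Irr C"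
      let ?h = "\<lambda>x c. x \<otimes> c \<otimes> inv (\<tau> x)"
      \<comment> \<open>Weighting with degrees brings in the regular character, which lives at the
        identity. By \<open>twisted_fibre\<close>, \<open>?h x c\<close> is the identity only for
        \<open>c = \<one>\<close> and \<open>x\<close> in \<open>C\<close>. The total is therefore
        nonzero, and so is the summand of some \<open>\<chi>\<close>.\<close>
      have "(\<Sum>\<chi>\<in>Irr G. \<chi> \<one> * (\<Sum>x\<in>carrier G. \<Sum>c\<in>carrier C. \<psi> (inv c) * \<chi> (?h x c))) =
        (\<Sum>x\<in>carrier G. \<Sum>c\<in>carrier C. \<psi> (inv c) * (\<Sum>\<chi>\<in>Irr G. \<chi> \<one> * \<chi> (?h x c)))"
        by (simp only: sum_distrib_left sum.swap[where A="Irr G"] mult_ac)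
      also have "\<dots> = (\<Sum>x\<in>carrier G. \<Sum>c\<in>carrier C. if c = \<one> \<and> x \<in> carrier C then \<psi> \<one> * ?NG else 0)"
      proof (intro sum.cong refl)
        fix x c assume x: "x \<in> carrier G" and c: "c \<in> carrier C"
        have "?h x c = \<one> \<longleftrightarrow> c = \<one> \<and> x \<in> carrier C"
        proof
          assume h: "?h x c = \<one>"
          have "inv \<one> \<otimes> x \<in> carrier C"
            by (rule twisted_fibre[OF x one_closed c]) (use h in auto)
          then have xC: "x \<in> carrier C" using x by simp
          then have "x \<otimes> c \<otimes> inv x = \<one>" using h by simp
          then have "x \<otimes> c = x" using inv_solve_right[of \<one> "x \<otimes> c" x] x c by simp
          then show "c = \<one> \<and> x \<in> carrier C" using xC x c by simp
        next
          assume "c = \<one> \<and> x \<in> carrier C"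
          then show "?h x c = \<one>" using x by simp
        qed
        moreover have "?h x c \<in> carrier G" using x c by simp
        ultimately show "\<psi> (inv c) * (\<Sum>\<chi>\<in>Irr G. \<chi> \<one> * \<chi> (?h x c)) = (if c = \<one> \<and> x \<in> carrier C then \<psi> \<one> * ?NG else 0)"
          using regular_character(2)[of "?h x c"] by auto
      qed
      also have "\<dots> = (\<Sum>x\<in>carrier G. if x \<in> carrier C then \<psi> \<one> * ?NG else 0)"
      proof (intro sum.cong refl)
        fix x
        have "(\<Sum>c\<in>carrier C. if c = \<one> \<and> x \<in> carrier C then \<psi> \<one> * ?NG else 0) =
          (\<Sum>c\<in>carrier C. if c = \<one> then (if x \<in> carrier C then \<psi> \<one> * ?NG else 0) else 0)" by (intro sum.cong) auto
        also have "\<dots> = (if x \<in> carrier C then \<psi> \<one> * ?NG else 0)" using finite_carrier by (subst sum.delta) auto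
        finally show "(\<Sum>c\<in>carrier C. if c = \<one> \<and> x \<in> carrier C then \<psi> \<one> * ?NG else 0) = (if x \<in> carrier C then \<psi> \<one> * ?NG else 0)" .
      qed
      also have "\<dots> = (\<Sum>x\<in>carrier C. \<psi> \<one> * ?NG)"
        using finite_carrier by (intro sum.mono_neutral_cong_right) auto
      also have "\<dots> = ?NC * (\<psi> \<one> * ?NG)" by simp
      finally have "(\<Sum>\<chi>\<in>Irr G. \<chi> \<one> * (\<Sum>x\<in>carrier G. \<Sum>c\<in>carrier C. \<psi> (inv c) * \<chi> (?h x c))) = ?NC * (\<psi> \<one> * ?NG)" .
      moreover have "?NC * (\<psi> \<one> * ?NG) \<noteq> 0"
      proof -
        obtain d where "d > 0" "\<psi> \<one>\<^bsub>C\<^esub> = of_nat d" using C.Irr_one_pos[OF \<psi>] .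
        then have "\<psi> \<one> \<noteq> 0" by simp
        then show ?thesis using NC NG by (simp only: mult_eq_0_iff) simp
      qed
      ultimately obtain \<chi> where \<chi>: "\<chi> \<in> Irr G" and nz: "(\<Sum>x\<in>carrier G. \<Sum>c\<in>carrier C. \<psi> (inv c) * \<chi> (?h x c)) \<noteq> 0"
        by (metis (no_types, lifting) mult_zero_right sum.neutral)
      obtain n \<rho> where \<rho>: "irreducible_rep G n \<rho>" "\<chi> = rep_character G \<rho>" using Irr_cases[OF \<chi>] .
      note m = irreducible_repD(1)[OF \<rho>(1)]
      note r = matrix_repD[OF m]
      let ?A = "\<lambda>x. mat_sum n n (\<lambda>c. \<psi> (inv c) \<cdot>\<^sub>m \<rho> (?h x c)) (carrier C)"
      \<comment> \<open>The twisted average of \<open>\<psi>\<close> in the representation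
        \<open>\<rho>\<close>. Its trace is the nonzero summand just found, and the substitution of
        \<open>y \<otimes> x\<close> for \<open>x\<close> shows that it intertwines
        \<open>\<rho>\<close> with its twist.\<close>
      define T where "T = mat_sum n n ?A (carrier G)"
      have T: "T \<in> carrier_mat n n" by (simp add: T_def)
      have "mat_trace T = (\<Sum>x\<in>carrier G. \<Sum>c\<in>carrier C. \<psi> (inv c) * mat_trace (\<rho> (?h x c)))"
        unfolding T_def
      proof (subst mat_trace_mat_sum, simp, rule sum.cong[OF refl])
        fix x assume x: "x \<in> carrier G"
        show "mat_trace (?A x) = (\<Sum>c\<in>carrier C. \<psi> (inv c) * mat_trace (\<rho> (?h x c)))"
          using x r(1) by (subst mat_trace_mat_sum) (auto intro!: sum.cong mat_trace_smult[of _ n])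
      qed
      also have "\<dots> = (\<Sum>x\<in>carrier G. \<Sum>c\<in>carrier C. \<psi> (inv c) * \<chi> (?h x c))"
        unfolding \<rho>(2) by (intro sum.cong refl) (simp add: rep_character_def)
      finally have "mat_trace T \<noteq> 0" using nz by simp
      then have T0: "T \<noteq> 0\<^sub>m n n" by (auto simp: mat_trace_def)
      have comm: "\<rho> y * T = T * \<rho> (\<tau> y)" if y: "y \<in> carrier G" for y
      proof -
        have "\<rho> y * T = mat_sum n n (\<lambda>x. \<rho> y * ?A x) (carrier G)"
          unfolding T_def using r(1)[OF y] by (intro mult_mat_sum) auto
        also have "\<dots> = mat_sum n n (\<lambda>x. ?A (y \<otimes> x) * \<rho> (\<tau> y)) (carrier G)"
        proof (rule mat_sum_cong)
          fix x assume x: "x \<in> carrier G"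
          have "\<rho> y * ?A x = mat_sum n n (\<lambda>c. \<rho> y * (\<psi> (inv c) \<cdot>\<^sub>m \<rho> (?h x c))) (carrier C)"
            using r(1) x y by (intro mult_mat_sum) auto
          also have "\<dots> = mat_sum n n (\<lambda>c. (\<psi> (inv c) \<cdot>\<^sub>m \<rho> (?h (y \<otimes> x) c)) * \<rho> (\<tau> y)) (carrier C)"
          proof (rule mat_sum_cong)
            fix c assume c: "c \<in> carrier C"
            have h1: "?h x c \<in> carrier G" and h2: "?h (y \<otimes> x) c \<in> carrier G" using x y c by auto
            have "y \<otimes> ?h x c = ?h (y \<otimes> x) c \<otimes> \<tau> y"
              using x y c by (simp add: \<tau>_mult inv_mult_group m_assoc)
            then have "\<rho> y * \<rho> (?h x c) = \<rho> (?h (y \<otimes> x) c) * \<rho> (\<tau> y)"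
              using r(3)[OF y h1] r(3)[OF h2 \<tau>_closed[OF y]] by simp
            then show "\<rho> y * (\<psi> (inv c) \<cdot>\<^sub>m \<rho> (?h x c)) = (\<psi> (inv c) \<cdot>\<^sub>m \<rho> (?h (y \<otimes> x) c)) * \<rho> (\<tau> y)"
              using mult_smult_distrib[OF r(1)[OF y] r(1)[OF h1]] mult_smult_assoc_mat[OF r(1)[OF h2] r(1)[OF \<tau>_closed[OF y]]]
              by simp
          qed
          also have "\<dots> = ?A (y \<otimes> x) * \<rho> (\<tau> y)"
            using r(1) x y by (intro mat_sum_mult[symmetric]) auto
          finally show "\<rho> y * ?A x = ?A (y \<otimes> x) * \<rho> (\<tau> y)" .
        qed
        also have "\<dots> = mat_sum n n (\<lambda>x. ?A x * \<rho> (\<tau> y)) (carrier G)"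
          by (rule mat_sum_reindex_bij_betw[OF bij_betw_left_mult[OF y], where f="\<lambda>x. ?A x * \<rho> (\<tau> y)"])
        also have "\<dots> = T * \<rho> (\<tau> y)"
          unfolding T_def using r(1) y by (intro mat_sum_mult[symmetric]) auto
        finally show ?thesis .
      qed
      have \<chi>_twist: "\<chi> = rep_character G (\<lambda>x. \<rho> (\<tau> x))"
        unfolding \<rho>(2) by (rule intertwiner_imp_eq_character[OF \<rho>(1) irreducible_rep_twist[OF \<rho>(1)] T T0 comm])
      have "\<chi> (\<tau> x) = \<chi> x" if "x \<in> carrier G" for x
      proof -
        have "\<chi> x = mat_trace (\<rho> (\<tau> x))" using fun_cong[OF \<chi>_twist, of x] that by (simp add: rep_character_def)
        moreover have "\<chi> (\<tau> x) = mat_trace (\<rho> (\<tau> x))" unfolding \<rho>(2) using that by (simp add: rep_character_def)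
        ultimately show ?thesis by simp
      qed
      then have \<chi>I: "\<chi> \<in> ?I" using \<chi> by simp
      have "rep_character G \<rho> (\<tau> x) = rep_character G \<rho> x" if "x \<in> carrier G" for x
        using \<chi>I \<rho>(2) that by simp
      then obtain U where U: "twister n \<rho> U" by (rule twister_exists[OF \<rho>(1)])
      obtain \<phi> and e :: int where \<phi>: "\<phi> \<in> Irr C" "e = 1 \<or> e = -1"
        "\<And>c. c \<in> carrier C \<Longrightarrow> mat_trace (\<rho> c * U) = of_int e * \<phi> c"
        "\<And>\<psi>. odd_constituent C \<psi> (char_restrict C (rep_character G \<rho>)) \<longleftrightarrow> \<psi> = \<phi>"
        using twisted_character[OF \<rho>(1) U] by blast
      have U': "U \<in> carrier_mat n n" "U * U = 1\<^sub>m n" "\<And>x. x \<in> carrier G \<Longrightarrow> \<rho> x * U = U * \<rho> (\<tau> x)"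
        using U by (auto simp: twister_def)
      \<comment> \<open>\<open>T * U\<close> commutes with \<open>\<rho>\<close>, so it is scalar,
        and its trace is a multiple of the scalar product of \<open>\<phi>\<close> and
        \<open>\<psi>\<close>. If these differed, \<open>T * U\<close> and hence \<open>T\<close>
        would vanish.\<close>
      have "\<phi> = \<psi>"
      proof (rule ccontr)
        assume ne: "\<phi> \<noteq> \<psi>"
        let ?B = "\<lambda>x. mat_sum n n (\<lambda>c. (\<psi> (inv c) \<cdot>\<^sub>m \<rho> (?h x c)) * U) (carrier C)"
        have "T * U = mat_sum n n ?B (carrier G)"
          unfolding T_def
        proof (subst mat_sum_mult[OF U'(1)], simp, rule mat_sum_cong)
          fix x assume x: "x \<in> carrier G"
          show "?A x * U =
              ?B x"
            using r(1) x by (intro mat_sum_mult[OF U'(1)]) auto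
        qed
        then have "mat_trace (T * U) = (\<Sum>x\<in>carrier G. mat_trace (?B x))"
          by (simp add: mat_trace_mat_sum)
        also have "\<dots> = (\<Sum>x\<in>carrier G. \<Sum>c\<in>carrier C. of_int e * (\<phi> c * \<psi> (inv c)))"
        proof (rule sum.cong[OF refl])
          fix x assume x: "x \<in> carrier G"
          have hx: "\<rho> (?h x c) \<in> carrier_mat n n" if "c \<in> carrier C" for c using r(1) x that by simp
          have "mat_trace (?B x) =
            (\<Sum>c\<in>carrier C. mat_trace ((\<psi> (inv c) \<cdot>\<^sub>m \<rho> (?h x c)) * U))"
            by (rule mat_trace_mat_sum) (use hx U'(1) in \<open>auto intro!: mult_carrier_mat smult_carrier_mat\<close>)
          also have "\<dots> = (\<Sum>c\<in>carrier C. of_int e * (\<phi> c * \<psi> (inv c)))"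
          proof (rule sum.cong[OF refl])
            fix c assume c: "c \<in> carrier C"
            have "mat_trace ((\<psi> (inv c) \<cdot>\<^sub>m \<rho> (?h x c)) * U) = \<psi> (inv c) * mat_trace (\<rho> (?h x c) * U)"
              using mult_smult_assoc_mat[OF hx[OF c] U'(1)] mat_trace_smult[of "\<rho> (?h x c) * U" n] hx[OF c] U'(1) by simp
            also have "mat_trace (\<rho> (?h x c) * U) = of_int e * \<phi> c"
              using twisted_trace[OF m U x, of c] c \<phi>(3)[OF c] by simp
            finally show "mat_trace ((\<psi> (inv c) \<cdot>\<^sub>m \<rho> (?h x c)) * U) = of_int e * (\<phi> c * \<psi> (inv c))"
              by (simp add: mult_ac)
          qed
          finally show "mat_trace (?B x) =
            (\<Sum>c\<in>carrier C. of_int e * (\<phi> c * \<psi> (inv c)))" .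
        qed
        also have "\<dots> = 0" using inner[OF \<phi>(1) \<psi>] ne by (simp only: sum_distrib_left[symmetric]) simp
        finally have tr0: "mat_trace (T * U) = 0" .
        have "T * U = (mat_trace (T * U) / of_nat n) \<cdot>\<^sub>m 1\<^sub>m n"
        proof (rule schur_lemma_scalar[OF \<rho>(1)])
          fix x assume x: "x \<in> carrier G"
          note car = T U'(1) r(1)[OF x] r(1)[OF \<tau>_closed[OF x]]
          have "\<rho> x * (T * U) = T * \<rho> (\<tau> x) * U"
            using assoc_mult_mat[OF car(3,1,2)] comm[OF x] by simp
          also have "\<dots> = T * (U * \<rho> x)"
            using assoc_mult_mat[OF car(1,4,2)] U'(3)[of "\<tau> x"] x by simp
          also have "\<dots> = T * U * \<rho> x" using assoc_mult_mat[OF car(1,2,3)] by simp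
          finally show "\<rho> x * (T * U) = T * U * \<rho> x" .
        qed (use T U' in auto)
        then have "T * U = 0\<^sub>m n n" unfolding tr0 by (auto intro!: eq_matI)
        then have "T * U * U = 0\<^sub>m n n" using U'(1) by simp
        then have "T = 0\<^sub>m n n" using assoc_mult_mat[OF T U'(1) U'(1)] U'(2) T by simp
        then show False using T0 by simp
      qed
      moreover have "?\<pi> \<chi> = \<phi>" unfolding \<rho>(2) \<phi>(4) by simp
      ultimately show "\<psi> \<in> ?\<pi> ` ?I" using \<chi>I by blast
    qed
  qed
qed

end

section \<open>Fixed points by parity, and central characters\<close>

text \<open>Each pair \<open>x\<close>, \<open>f x\<close> contributes \<open>2 * w x\<close>. The
  weight is 1 when elements of \<open>J\<close> or of an orbit are counted, and a squared degree
  when characters are counted.\<close>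

lemma even_sum_involution:
  fixes w :: "'b \<Rightarrow> nat"
  assumes "finite A" "\<And>x. x \<in> A \<Longrightarrow> f x \<in> A \<and> f (f x) = x \<and> f x \<noteq> x \<and> w (f x) = w x"
  shows "even (sum w A)"
  using assms
proof (induction "card A" arbitrary: A rule: less_induct)
  case less
  show ?case
  proof (cases "A = {}")
    case False
    then obtain x where x: "x \<in> A" by blast
    let ?B = "A - {x, f x}"
    have A: "A = insert x (insert (f x) ?B)" using x less.prems(2) by auto
    have fx: "f x \<noteq> x" "w (f x) = w x" using less.prems(2)[OF x] by auto
    have "even (sum w ?B)"
    proof (rule less.hyps)
      show "card ?B < card A" using x less.prems(1) by (intro psubset_card_mono) auto
      show "finite ?B" using less.prems(1) by simp
      fix y assume y: "y \<in> ?B"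
      have "f y \<noteq> x" "f y \<noteq> f x" using less.prems(2)[of y] less.prems(2)[OF x] y by (metis DiffE insertCI)+
      then show "f y \<in> ?B \<and> f (f y) = y \<and> f y \<noteq> y \<and> w (f y) = w y" using less.prems(2)[of y] y by auto
    qed
    moreover have "sum w A = w x + (w (f x) + sum w ?B)"
      using less.prems(1) fx by (subst A) (simp add: sum.insert_if)
    ultimately show ?thesis using fx by simp
  qed simp
qed

lemma odd_sum_involution_fixpoint:
  fixes w :: "'b \<Rightarrow> nat"
  assumes "finite A" "\<And>x. x \<in> A \<Longrightarrow> f x \<in> A \<and> f (f x) = x \<and> w (f x) = w x" "odd (sum w A)"
  obtains x where "x \<in> A" "f x = x"
proof (rule ccontr)
  note fixpoint = that
  assume "\<not> thesis"
  then have "f x \<noteq> x" if "x \<in> A" for x using fixpoint that by metis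
  then have "even (sum w A)" using assms(1,2) by (intro even_sum_involution[where f=f]) auto
  then show False using assms(3) by simp
qed

context fin_group
begin

text \<open>Since \<open>f\<close> is a class function, the sum of \<open>f(y) \<rho>(y^-1)\<close>
  commutes with \<open>\<rho>\<close> and is a scalar \<open>t\<close>; both sides equal
  \<open>t \<chi>(1) \<chi>(x)\<close>.\<close>

lemma central_character:
  assumes \<chi>: "\<chi> \<in> Irr G" and x: "x \<in> carrier G"
    and f: "\<And>x y. x \<in> carrier G \<Longrightarrow> y \<in> carrier G \<Longrightarrow> f (y \<otimes> x \<otimes> inv y) = f x"
  shows "(\<Sum>y\<in>carrier G. f y * \<chi> (x \<otimes> inv y)) * \<chi> \<one> = (\<Sum>y\<in>carrier G. f y * \<chi> (inv y)) * \<chi> x"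
proof -
  obtain n \<rho> where \<rho>: "irreducible_rep G n \<rho>" "\<chi> = rep_character G \<rho>" using Irr_cases[OF \<chi>] .
  note r = matrix_repD[OF irreducible_repD(1)[OF \<rho>(1)]]
  define M where "M = mat_sum n n (\<lambda>y. f y \<cdot>\<^sub>m \<rho> (inv y)) (carrier G)"
  have M: "M \<in> carrier_mat n n" by (simp add: M_def)
  define t where "t = mat_trace M / of_nat n"
  have "M = t \<cdot>\<^sub>m 1\<^sub>m n"
    unfolding t_def
  proof (rule schur_lemma_scalar[OF \<rho>(1) M])
    fix z assume z: "z \<in> carrier G"
    have "\<rho> z * M = mat_sum n n (\<lambda>y. \<rho> z * (f y \<cdot>\<^sub>m \<rho> (inv y))) (carrier G)"
      unfolding M_def using r(1) z by (intro mult_mat_sum) auto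
    also have "\<dots> = mat_sum n n (\<lambda>y. (f (z \<otimes> y \<otimes> inv z) \<cdot>\<^sub>m \<rho> (inv (z \<otimes> y \<otimes> inv z))) * \<rho> z) (carrier G)"
    proof (rule mat_sum_cong)
      fix y assume y: "y \<in> carrier G"
      let ?y = "z \<otimes> y \<otimes> inv z"
      have "z \<otimes> inv y = inv ?y \<otimes> z" using y z by (simp add: inv_mult_group m_assoc)
      then have "\<rho> z * \<rho> (inv y) = \<rho> (inv ?y) * \<rho> z"
        using r(3)[of z "inv y"] r(3)[of "inv ?y" z] y z by simp
      then show "\<rho> z * (f y \<cdot>\<^sub>m \<rho> (inv y)) = (f ?y \<cdot>\<^sub>m \<rho> (inv ?y)) * \<rho> z"
        using mult_smult_distrib[OF r(1)[OF z] r(1)[of "inv y"]] mult_smult_assoc_mat[OF r(1)[of "inv ?y"] r(1)[OF z]] y z f[OF y z]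
        by simp
    qed
    also have "\<dots> = mat_sum n n (\<lambda>y. (f y \<cdot>\<^sub>m \<rho> (inv y)) * \<rho> z) (carrier G)"
    proof (rule mat_sum_reindex_bij_betw[where f="\<lambda>y. (f y \<cdot>\<^sub>m \<rho> (inv y)) * \<rho> z"])
      show "bij_betw (\<lambda>y. z \<otimes> y \<otimes> inv z) (carrier G) (carrier G)"
        using bij_betw_trans[OF bij_betw_left_mult[OF z] bij_betw_right_mult[OF inv_closed[OF z]]] by (simp add: comp_def)
    qed
    also have "\<dots> = M * \<rho> z" unfolding M_def using r(1) z by (intro mat_sum_mult[symmetric]) auto
    finally show "\<rho> z * M = M * \<rho> z" .
  qed
  note M_eq = this
  have n: "\<chi> \<one> = of_nat n" by (simp add: \<rho>(2) rep_character_def r(2))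
  have "(\<Sum>y\<in>carrier G. f y * \<chi> (x \<otimes> inv y)) = mat_trace (\<rho> x * M)"
  proof -
    have "\<rho> x * M = mat_sum n n (\<lambda>y. \<rho> x * (f y \<cdot>\<^sub>m \<rho> (inv y))) (carrier G)"
      unfolding M_def using r(1) x by (intro mult_mat_sum) auto
    also have "\<dots> = mat_sum n n (\<lambda>y. f y \<cdot>\<^sub>m \<rho> (x \<otimes> inv y)) (carrier G)"
    proof (rule mat_sum_cong)
      fix y assume y: "y \<in> carrier G"
      show "\<rho> x * (f y \<cdot>\<^sub>m \<rho> (inv y)) = f y \<cdot>\<^sub>m \<rho> (x \<otimes> inv y)"
        using mult_smult_distrib[OF r(1)[OF x] r(1)[of "inv y"]] r(3)[OF x, of "inv y"] y by simp
    qed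
    finally have "mat_trace (\<rho> x * M) = (\<Sum>y\<in>carrier G. mat_trace (f y \<cdot>\<^sub>m \<rho> (x \<otimes> inv y)))"
      using r(1) x by (simp add: mat_trace_mat_sum)
    also have "\<dots> = (\<Sum>y\<in>carrier G. f y * \<chi> (x \<otimes> inv y))"
      using r(1) x by (intro sum.cong refl) (simp add: mat_trace_smult[of _ n] \<rho>(2) rep_character_def)
    finally show ?thesis ..
  qed
  also have "\<rho> x * M = t \<cdot>\<^sub>m \<rho> x"
    unfolding M_eq using mult_smult_distrib[OF r(1)[OF x], of "1\<^sub>m n" n t] r(1)[OF x] by simp
  finally have 1: "(\<Sum>y\<in>carrier G. f y * \<chi> (x \<otimes> inv y)) = t * \<chi> x"
    using x by (simp add: mat_trace_smult[OF r(1)[OF x]] \<rho>(2) rep_character_def)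
  have "(\<Sum>y\<in>carrier G. f y * \<chi> (inv y)) = mat_trace M"
    unfolding M_def using r(1)
    by (subst mat_trace_mat_sum) (auto intro!: sum.cong simp: mat_trace_smult[of _ n] \<rho>(2) rep_character_def)
  also have "\<dots> = t * \<chi> \<one>" using irreducible_repD(2)[OF \<rho>(1)] by (simp add: t_def n)
  finally show ?thesis using 1 by simp
qed

end

lemma (in odd_involution_group) Irr_twist:
  assumes "\<chi> \<in> Irr G"
  shows "(\<lambda>x. if x \<in> carrier G then \<chi> (\<tau> x) else 0) \<in> Irr G"
proof -
  obtain n \<rho> where \<rho>: "irreducible_rep G n \<rho>" "\<chi> = rep_character G \<rho>" using Irr_cases[OF assms] .
  have "(\<lambda>x. if x \<in> carrier G then \<chi> (\<tau> x) else 0) = rep_character G (\<lambda>x. \<rho> (\<tau> x))"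
    by (auto simp: \<rho>(2) rep_character_def)
  then show ?thesis using rep_character_mem_Irr[OF irreducible_rep_twist[OF \<rho>(1)]] by simp
qed

lemma (in odd_involution_group) bij_betw_\<tau>: "bij_betw \<tau> (carrier G) (carrier G)"
  by (rule bij_betwI[where g=\<tau>]) auto

section \<open>Duals of finite additive groups\<close>

locale additive_subgroup =
  fixes J :: "'a::ab_group_add set"
  assumes finite_J: "finite J" and zero_J [simp]: "0 \<in> J"
    and add_J: "a \<in> J \<Longrightarrow> b \<in> J \<Longrightarrow> a + b \<in> J"
    and uminus_J: "a \<in> J \<Longrightarrow> - a \<in> J"
begin

abbreviation additive_group :: "'a monoid" where
  "additive_group \<equiv> \<lparr>carrier = J, mult = (+), one = 0\<rparr>"

lemma fin_group_additive: "fin_group additive_group"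
proof -
  interpret group additive_group
    by (rule groupI) (auto simp: add_J add.assoc intro: bexI[of _ "- _"] uminus_J)
  show ?thesis by unfold_locales (simp add: finite_J)
qed

lemma inv_additive: "a \<in> J \<Longrightarrow> inv\<^bsub>additive_group\<^esub> a = - a"
proof -
  interpret A: fin_group additive_group by (rule fin_group_additive)
  show "a \<in> J \<Longrightarrow> inv\<^bsub>additive_group\<^esub> a = - a" using A.inv_equality[of "- a" a] by (simp add: uminus_J)
qed

end

locale additive_subgroup_ring = additive_subgroup J for J :: "'a::ring set"
begin

lemma dual_zero: "\<mu> \<in> dual J \<Longrightarrow> \<mu> 0 = 1"
proof -
  assume "\<mu> \<in> dual J"
  then have "\<mu> (0 + 0) = \<mu> 0 * \<mu> 0" "\<mu> 0 \<noteq> 0" unfolding dual_def using zero_J by blast+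
  then show ?thesis by simp
qed

text \<open>This makes the orthogonality relations and the regular character available for linear
  characters of \<open>J\<close>. In an abelian group every \<open>\<rho> a\<close> commutes with
  all of \<open>\<rho>\<close> and is scalar by Schur's lemma, so irreducibility forces degree
  1.\<close>

lemma Irr_additive: "Irr additive_group = dual J"
proof (intro subset_antisym subsetI)
  interpret A: fin_group additive_group by (rule fin_group_additive)
  fix \<chi> assume "\<chi> \<in> Irr additive_group"
  then obtain n \<rho> where \<rho>: "irreducible_rep additive_group n \<rho>" "\<chi> = rep_character additive_group \<rho>" by (rule Irr_cases)
  note r = matrix_repD[OF irreducible_repD(1)[OF \<rho>(1)]]
  have n: "n > 0" using irreducible_repD(2)[OF \<rho>(1)] .
  have scalar: "\<rho> a = (mat_trace (\<rho> a) / of_nat n) \<cdot>\<^sub>m 1\<^sub>m n" if a: "a \<in> J" for a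
  proof (rule schur_lemma_scalar[OF \<rho>(1)])
    fix b assume "b \<in> carrier additive_group"
    then show "\<rho> b * \<rho> a = \<rho> a * \<rho> b" using r(3)[of a b] r(3)[of b a] a by (simp add: add.commute)
  qed (use r(1) a in simp)
  \<comment> \<open>The line through the first unit vector is invariant because all
    \<open>\<rho> a\<close> are scalar; by irreducibility it is the whole space.\<close>
  let ?W = "{c \<cdot>\<^sub>v unit_vec n 0 | c :: complex. True}"
  have "?W = {0\<^sub>v n} \<or> ?W = carrier_vec n"
  proof (rule irreducible_repD(3)[OF \<rho>(1)])
    show "vec_subspace n ?W"
    proof (rule subspace_vecI)
      show "0\<^sub>v n \<in> ?W" by (auto intro!: exI[of _ 0])
      show "v + w \<in> ?W" if vw: "v \<in> ?W" "w \<in> ?W" for v w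
      proof -
        obtain c d where "v = c \<cdot>\<^sub>v unit_vec n 0" "w = d \<cdot>\<^sub>v unit_vec n 0" using vw by auto
        then have "v + w = (c + d) \<cdot>\<^sub>v unit_vec n 0" by (simp add: add_smult_distrib_vec)
        then show ?thesis by blast
      qed
      show "c \<cdot>\<^sub>v v \<in> ?W" if "v \<in> ?W" for c v
        using that by (auto simp: smult_smult_assoc)
    qed auto
    fix a w assume a: "a \<in> carrier additive_group" and w: "w \<in> ?W"
    then obtain c where c: "w = c \<cdot>\<^sub>v unit_vec n 0" by auto
    let ?t = "mat_trace (\<rho> a) / of_nat n"
    have "\<rho> a *\<^sub>v w = (?t * c) \<cdot>\<^sub>v unit_vec n 0"
    proof -
      have "a \<in> J" using a by simp
      show ?thesis unfolding c by (subst scalar[OF \<open>a \<in> J\<close>], rule eq_vecI)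
        (auto simp: scalar_prod_def unit_vec_def if_distrib[of "\<lambda>x. _ * x"] if_distribR sum.delta sum.delta' cong: if_cong)
    qed
    then show "\<rho> a *\<^sub>v w \<in> ?W" by blast
  qed
  moreover have "?W \<noteq> {0\<^sub>v n}"
  proof
    assume "?W = {0\<^sub>v n}"
    then have "1 \<cdot>\<^sub>v unit_vec n 0 \<in> {0\<^sub>v n :: complex vec}" by blast
    then have "unit_vec n 0 $ 0 = (0::complex)" using n by simp
    then show False using n by simp
  qed
  ultimately have W: "?W = carrier_vec n" by blast
  have n1: "n = 1"
  proof (rule ccontr)
    assume "n \<noteq> 1"
    then have n: "1 < n" using n by simp
    have "unit_vec n 1 \<in> ?W" unfolding W by simp
    then obtain c :: complex where "unit_vec n 1 = c \<cdot>\<^sub>v unit_vec n 0" by blast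
    then have "unit_vec n 1 $ 1 = (c \<cdot>\<^sub>v unit_vec n 0) $ 1" by simp
    then show False using n by simp
  qed
  have tr: "\<chi> a = \<rho> a $$ (0,0)" if "a \<in> J" for a
    using that r(1)[of a] n1 by (simp add: \<rho>(2) rep_character_def mat_trace_def)
  have mult: "\<chi> (a + b) = \<chi> a * \<chi> b" if "a \<in> J" "b \<in> J" for a b
    using that r(1)[of a] r(1)[of b] r(3)[of a b] n1 by (simp add: tr add_J scalar_prod_def)
  have one: "\<chi> 0 = 1" using tr[of 0] r(2) n1 by simp
  have "\<chi> a \<noteq> 0" if a: "a \<in> J" for a
    using mult[OF a uminus_J[OF a]] one by auto
  then show "\<chi> \<in> dual J" using mult by (auto simp: dual_def \<rho>(2) rep_character_def)
next
  fix \<mu> assume \<mu>: "\<mu> \<in> dual J"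
  define \<rho> where "\<rho> a = mat 1 1 (\<lambda>_. \<mu> a)" for a
  have "irreducible_rep additive_group 1 \<rho>"
    unfolding irreducible_rep_def
  proof (intro conjI allI impI)
    show "matrix_rep additive_group 1 \<rho>"
      using \<mu> dual_zero[OF \<mu>] unfolding matrix_rep_def
      by (auto simp: \<rho>_def dual_def scalar_prod_def intro!: eq_matI)
    fix W :: "complex vec set"
    assume W: "vec_subspace 1 W"
    note Wc = subspace_vecD[OF W]
    show "W = {0\<^sub>v 1} \<or> W = carrier_vec 1"
    proof (cases "W \<subseteq> {0\<^sub>v 1}")
      case True
      then show ?thesis using Wc(2) by auto
    next
      case False
      then obtain w where w: "w \<in> W" "w \<noteq> 0\<^sub>v 1" by auto
      have wc: "w \<in> carrier_vec 1" using w Wc(1) by auto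
      have w0: "w $ 0 \<noteq> 0"
      proof
        assume "w $ 0 = 0"
        then have "w = 0\<^sub>v 1" using wc by (intro eq_vecI) auto
        then show False using w(2) by simp
      qed
      have "v \<in> W" if v: "v \<in> carrier_vec 1" for v
      proof -
        have "v = (v $ 0 / w $ 0) \<cdot>\<^sub>v w" using v wc w0 by (intro eq_vecI) auto
        then show ?thesis using Wc(4)[OF w(1)] by metis
      qed
      then show ?thesis using Wc(1) by auto
    qed
  qed simp
  then have "rep_character additive_group \<rho> \<in> Irr additive_group" by (rule rep_character_mem_Irr)
  moreover have "rep_character additive_group \<rho> = \<mu>"
    using \<mu> by (auto simp: rep_character_def \<rho>_def mat_trace_def dual_def fun_eq_iff)
  ultimately show "\<mu> \<in> Irr additive_group" by simp
qed

lemma finite_dual: "finite (dual J)"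
  using fin_group.regular_character(1)[OF fin_group_additive] by (simp add: Irr_additive)

lemma sum_dual:
  assumes "a \<in> J"
  shows "(\<Sum>\<mu>\<in>dual J. \<mu> a) = (if a = 0 then of_nat (card J) else 0)"
proof -
  have "(\<Sum>\<mu>\<in>dual J. \<mu> 0 * \<mu> a) = (if a = 0 then of_nat (card J) else 0)"
    using fin_group.regular_character(2)[OF fin_group_additive, of a] assms by (simp add: Irr_additive)
  then show ?thesis by (simp add: dual_zero cong: sum.cong)
qed

lemma dual_orthogonal:
  assumes "\<mu> \<in> dual J" "\<nu> \<in> dual J" "\<mu> \<noteq> \<nu>"
  shows "(\<Sum>a\<in>J. \<mu> a * \<nu> (- a)) = 0"
proof -
  interpret A: fin_group additive_group by (rule fin_group_additive)
  have "char_inner additive_group \<mu> \<nu> = 0"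
    using A.Irr_orthonormal[of \<mu> \<nu>] assms by (simp add: Irr_additive)
  moreover have "char_inner additive_group \<mu> \<nu> = (\<Sum>a\<in>J. \<mu> a * \<nu> (- a)) / of_nat (card J)"
    using A.char_inner_Irr[of \<nu> \<mu>] assms by (simp add: Irr_additive inv_additive cong: sum.cong)
  moreover have "card J > 0" using A.card_carrier_pos by simp
  ultimately show ?thesis by simp
qed

end

section \<open>Blocks of an algebra group\<close>

lemma geometric_sum:
  fixes c :: "'a::{ring,monoid_mult}"
  shows "(1 - c) * (\<Sum>i<n. c ^ i) = 1 - c ^ n" "(\<Sum>i<n. c ^ i) * (1 - c) = 1 - c ^ n"
proof -
  have "(1 - c) * (\<Sum>i<n. c ^ i) = 1 - c ^ n \<and> (\<Sum>i<n. c ^ i) * (1 - c) = 1 - c ^ n"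
  proof (induction n)
    case (Suc n)
    have "(1 - c) * c ^ n = c ^ n - c ^ Suc n" "c ^ n * (1 - c) = c ^ n - c ^ Suc n"
      by (simp_all add: left_diff_distrib right_diff_distrib power_commutes)
    then show ?case using Suc by (simp only: sum.lessThan_Suc distrib_left distrib_right) simp
  qed simp
  then show "(1 - c) * (\<Sum>i<n. c ^ i) = 1 - c ^ n" "(\<Sum>i<n. c ^ i) * (1 - c) = 1 - c ^ n" by auto
qed

lemma uinv_eqI:
  fixes x y :: "'a::monoid_mult"
  assumes "x * y = 1" "y * x = 1"
  shows "uinv x = y"
  unfolding m_inv_def
proof (rule the_equality)
  fix z assume "z \<in> carrier mult_monoid \<and> x \<otimes>\<^bsub>mult_monoid\<^esub> z = \<one>\<^bsub>mult_monoid\<^esub> \<and> z \<otimes>\<^bsub>mult_monoid\<^esub> x = \<one>\<^bsub>mult_monoid\<^esub>"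
  then have "z * x = 1" by simp
  have "z = z * (x * y)" using assms by simp
  also have "\<dots> = (z * x) * y" by (simp add: mult.assoc)
  finally show "z = y" using \<open>z * x = 1\<close> by simp
qed (use assms in auto)

text \<open>The two-sided action with the inverses removed. Inversion permutes \<open>P\<close>, so
  the orbits are those of \<open>left_act\<close> and \<open>right_act\<close>, while calculations
  stay free of \<open>uinv\<close>.\<close>

definition shift :: "'a::monoid_mult \<Rightarrow> 'a \<Rightarrow> ('a \<Rightarrow> complex) \<Rightarrow> 'a \<Rightarrow> complex" where
  "shift x y \<mu> = (\<lambda>a. \<mu> (x * a * y))"

lemma shift_shift: "shift x y (shift x' y' \<mu>) = shift (x' * x) (y * y') \<mu>"
  by (simp add: shift_def mult.assoc)

lemma shift_one [simp]: "shift 1 1 \<mu> = \<mu>"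
  by (simp add: shift_def)

locale nilpotent_algebra = vector_space scale
  for scale :: "'k::{field,finite} \<Rightarrow> 'a::{ring,monoid_mult} \<Rightarrow> 'a" +
  fixes J :: "'a set"
  assumes odd_CHAR: "odd CHAR('k)"
    and finite_dim: "\<exists>B. finite B \<and> span B = UNIV"
    and scale_left: "scale c a * b = scale c (a * b)"
    and scale_right: "a * scale c b = scale c (a * b)"
    and nilpotent: "nilpotent_subalgebra scale J"
begin

lemma finite_algebra: "finite (UNIV :: 'a set)"
proof -
  obtain B where B: "finite B" "span B = UNIV" using finite_dim by blast
  have "(UNIV :: 'a set) \<subseteq> (\<lambda>u. \<Sum>v\<in>B. scale (u v) v) ` (B \<rightarrow>\<^sub>E UNIV)"
  proof
    fix a :: 'a
    have "a \<in> range (\<lambda>u. \<Sum>v\<in>B. scale (u v) v)" using B span_finite by auto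
    then obtain u where "a = (\<Sum>v\<in>B. scale (u v) v)" by blast
    then have "a = (\<Sum>v\<in>B. scale (restrict u B v) v)" by (simp cong: sum.cong)
    then show "a \<in> (\<lambda>u. \<Sum>v\<in>B. scale (u v) v) ` (B \<rightarrow>\<^sub>E UNIV)"
      by (intro image_eqI[where x="restrict u B"]) auto
  qed
  then show ?thesis by (rule finite_subset) (intro finite_imageI finite_PiE B finite)
qed

lemma subspace_J: "subspace J" using nilpotent by (simp add: nilpotent_subalgebra_def)

lemma mult_J: "a \<in> J \<Longrightarrow> b \<in> J \<Longrightarrow> a * b \<in> J"
  using nilpotent by (simp add: nilpotent_subalgebra_def)

lemma power_J: "0 < n \<Longrightarrow> a \<in> J \<Longrightarrow> a ^ n \<in> J"
  by (induction n rule: nat_induct_non_zero) (auto simp: mult_J)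

lemma nilpotent_power:
  obtains n where "0 < n" "\<And>a. a \<in> J \<Longrightarrow> a ^ n = 0"
proof -
  obtain n where n: "0 < n" "\<And>as. length as = n \<Longrightarrow> set as \<subseteq> J \<Longrightarrow> prod_list as = 0"
    using nilpotent unfolding nilpotent_subalgebra_def by blast
  have "a ^ n = 0" if "a \<in> J" for a
  proof -
    have "set (replicate n a) \<subseteq> J" using that by auto
    then show ?thesis using n(2)[of "replicate n a"] by (simp add: prod_list_replicate)
  qed
  then show ?thesis using that n(1) by blast
qed

sublocale additive_subgroup_ring J
  using subspace_0[OF subspace_J] subspace_add[OF subspace_J] subspace_neg[OF subspace_J]
    finite_subset[OF subset_UNIV finite_algebra]
  by unfold_locales auto

lemma two_neq_0: "(1 + 1 :: 'k) \<noteq> 0"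
proof
  assume "(1 + 1 :: 'k) = 0"
  then have "of_nat 2 = (0 :: 'k)" by simp
  then have "CHAR('k) dvd 2" by (simp only: of_nat_eq_0_iff_char_dvd)
  then have "CHAR('k) = 1 \<or> CHAR('k) = 2" using prime_nat_iff two_is_prime_nat by blast
  then show False using odd_CHAR of_nat_CHAR[where 'a='k] by auto
qed

text \<open>Division by 2. The scalar is written \<open>1 + 1\<close>, invertible in odd
  characteristic, and bilinearity of the product lets \<open>half\<close> move across factors on
  either side.\<close>

definition half :: "'a \<Rightarrow> 'a" where
  "half = scale (inverse (1 + 1))"

lemma half_add_half [simp]: "half a + half a = a"
proof -
  have "half a + half a = scale (inverse (1 + 1) * (1 + 1)) a"
    by (simp add: half_def scale_left_distrib[symmetric] distrib_left)
  then show ?thesis using two_neq_0 by simp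
qed

lemma half_J: "a \<in> J \<Longrightarrow> half a \<in> J"
  unfolding half_def using subspace_scale[OF subspace_J] .

lemma half_add: "half (a + b) = half a + half b"
  by (simp add: half_def scale_right_distrib)

lemma half_minus: "half (- a) = - half a"
  by (simp add: half_def)

lemma half_diff: "half (a - b) = half a - half b"
  by (simp add: half_def scale_right_diff_distrib)

lemma half_mult: "half (a * b) = half a * b" "half (a * b) = a * half b"
  by (simp_all add: half_def scale_left scale_right)

text \<open>Halving is determined by addition alone. Hence it commutes with the additive map
  \<open>\<sigma>\<close>, which need not be linear over the field, and identities with
  \<open>half\<close> can be checked by doubling.\<close>

lemma halfI: "b + b = a \<Longrightarrow> half a = b"
  by (auto simp: half_add)

lemma half_zero [simp]: "half 0 = 0" by (simp add: half_def)

text \<open>Negation pairs off the nonzero elements, as \<open>a = - a\<close> would mean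
  \<open>a + a = 0\<close> and hence \<open>a = 0\<close>.\<close>

lemma odd_card_J: "odd (card J)"
proof -
  have "even (sum (\<lambda>_. 1::nat) (J - {0}))"
  proof (rule even_sum_involution[where f=uminus])
    fix a assume a: "a \<in> J - {0}"
    have "- a \<noteq> a"
    proof
      assume "- a = a"
      then have "a + a = 0" by (metis add.right_inverse)
      then show False using halfI[of a 0] a by simp
    qed
    then show "- a \<in> J - {0} \<and> - (- a) = a \<and> - a \<noteq> a \<and> (1::nat) = 1" using a uminus_J by auto
  qed (simp add: finite_J)
  then have "even (card (J - {0}))" by simp
  moreover have "card J = Suc (card (J - {0}))" by (rule card.remove) (auto simp: finite_J)
  ultimately show ?thesis by (simp only: even_Suc not_not)
qed

abbreviation P :: "'a monoid" where "P \<equiv> algebra_group J"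

lemma mem_P: "x \<in> carrier P \<longleftrightarrow> x - 1 \<in> J"
proof
  assume "x \<in> carrier P"
  then show "x - 1 \<in> J" by (auto simp: algebra_group_def)
next
  assume "x - 1 \<in> J"
  then show "x \<in> carrier P" by (auto simp: algebra_group_def intro!: exI[of _ "x - 1"])
qed

lemma P_simps [simp]: "mult P = (*)" "one P = 1"
  by (simp_all add: algebra_group_def)

lemma one_P: "1 \<in> carrier P" by (simp add: mem_P)

lemma mult_P: "x \<in> carrier P \<Longrightarrow> y \<in> carrier P \<Longrightarrow> x * y \<in> carrier P"
proof -
  assume x: "x \<in> carrier P" and y: "y \<in> carrier P"
  have "x * y - 1 = (x - 1) * (y - 1) + (x - 1) + (y - 1)" by (simp add: algebra_simps)
  also have "\<dots> \<in> J" using x y unfolding mem_P by (intro add_J mult_J)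
  finally show ?thesis unfolding mem_P .
qed

text \<open>With \<open>c = 1 - x\<close> in \<open>J\<close>, the inverse is the geometric series
  in \<open>c\<close>, which stops because \<open>c\<close> is nilpotent; its terms after the first
  lie in \<open>J\<close>.\<close>

lemma inverse_P_exists:
  assumes "x \<in> carrier P"
  shows "\<exists>y\<in>carrier P. x * y = 1 \<and> y * x = 1"
proof -
  obtain n where n: "0 < n" "\<And>a. a \<in> J \<Longrightarrow> a ^ n = 0" using nilpotent_power by blast
  define c where "c = 1 - x"
  have c: "c \<in> J" using assms uminus_J[of "x - 1"] by (simp add: mem_P c_def)
  have "(\<Sum>i<n. c ^ i) - 1 \<in> J"
    using n(1)
  proof (induction n rule: nat_induct_non_zero)
    case (Suc n)
    have "(\<Sum>i<Suc n. c ^ i) - 1 = ((\<Sum>i<n. c ^ i) - 1) + c ^ n" by simp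
    then show ?case using Suc power_J[OF _ c, of n] add_J by metis
  qed simp
  then have "(\<Sum>i<n. c ^ i) \<in> carrier P" by (simp add: mem_P)
  moreover have "1 - c = x" by (simp add: c_def)
  ultimately show ?thesis using geometric_sum[of c n] n(2)[OF c] by auto
qed

lemma uinv_P:
  assumes "x \<in> carrier P"
  shows "uinv x \<in> carrier P" "x * uinv x = 1" "uinv x * x = 1"
proof -
  obtain y where "y \<in> carrier P" "x * y = 1" "y * x = 1" using inverse_P_exists[OF assms] by blast
  then show "uinv x \<in> carrier P" "x * uinv x = 1" "uinv x * x = 1" using uinv_eqI[of x y] by auto
qed

lemma uinv_uinv: "x \<in> carrier P \<Longrightarrow> uinv (uinv x) = x"
  by (intro uinv_eqI uinv_P)

lemma uinv_mult: "x \<in> carrier P \<Longrightarrow> y \<in> carrier P \<Longrightarrow> uinv (x * y) = uinv y * uinv x"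
proof (rule uinv_eqI)
  assume x: "x \<in> carrier P" and y: "y \<in> carrier P"
  have "x * y * (uinv y * uinv x) = x * (y * uinv y) * uinv x" by (simp only: mult.assoc)
  then show "x * y * (uinv y * uinv x) = 1" using x y by (simp add: uinv_P)
  have "uinv y * uinv x * (x * y) = uinv y * (uinv x * x) * y" by (simp only: mult.assoc)
  then show "uinv y * uinv x * (x * y) = 1" using x y by (simp add: uinv_P)
qed

lemma bij_betw_J_P: "bij_betw (\<lambda>a. 1 + a) J (carrier P)"
  by (rule bij_betwI[where g="\<lambda>x. x - 1"]) (auto simp: mem_P)

lemma bij_betw_P_J_half: "bij_betw (\<lambda>x. half (x - 1)) (carrier P) J"
  by (rule bij_betwI[where g="\<lambda>a. 1 + (a + a)"]) (auto simp: mem_P half_J half_add add_J)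

lemma card_P: "card (carrier P) = card J"
  using bij_betw_same_card[OF bij_betw_J_P] by simp

sublocale P: fin_group P
proof -
  interpret group P
  proof (rule groupI)
    fix x assume "x \<in> carrier P"
    then show "\<exists>y\<in>carrier P. y \<otimes>\<^bsub>P\<^esub> x = \<one>\<^bsub>P\<^esub>" by (intro bexI[of _ "uinv x"]) (simp_all add: uinv_P)
  qed (simp_all add: mult_P one_P mult.assoc)
  show "fin_group P" by unfold_locales (use bij_betw_finite[OF bij_betw_J_P] finite_J in simp)
qed

lemma inv_P [simp]: "x \<in> carrier P \<Longrightarrow> inv\<^bsub>P\<^esub> x = uinv x"
  using P.inv_equality[of "uinv x" x] uinv_P[of x] by simp

lemma mult_P_J:
  assumes x: "x \<in> carrier P" and y: "y \<in> carrier P"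
  shows "x * a * y \<in> J \<longleftrightarrow> a \<in> J"
proof -
  have *: "x * a * y \<in> J" if "a \<in> J" "x \<in> carrier P" "y \<in> carrier P" for a x y
  proof -
    have "x * a * y = (x - 1) * a * (y - 1) + (x - 1) * a + a * (y - 1) + a" by (simp add: algebra_simps)
    also have "\<dots> \<in> J" using that unfolding mem_P by (intro add_J mult_J)
    finally show ?thesis .
  qed
  have "uinv x * (x * a * y) * uinv y = (uinv x * x) * a * (y * uinv y)" by (simp only: mult.assoc)
  then have "uinv x * (x * a * y) * uinv y = a" using x y by (simp add: uinv_P)
  then show ?thesis using *[of "x * a * y" "uinv x" "uinv y"] *[of a x y] x y by (auto simp: uinv_P)
qed

section \<open>Two-sided orbits of linear characters\<close>

lemma double_orbit_eq: "double_orbit J \<mu> = (\<lambda>(x,y). shift x y \<mu>) ` (carrier P \<times> carrier P)"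
proof -
  have eq: "double_orbit J \<mu> = {shift (uinv x) (uinv y) \<mu> | x y. x \<in> carrier P \<and> y \<in> carrier P}"
    unfolding double_orbit_def right_act_def[abs_def] left_act_def shift_def by (simp add: mult.assoc)
  show ?thesis
  proof (intro subset_antisym subsetI)
    fix \<nu> assume "\<nu> \<in> double_orbit J \<mu>"
    then obtain x y where "x \<in> carrier P" "y \<in> carrier P" "\<nu> = shift (uinv x) (uinv y) \<mu>" unfolding eq by blast
    then show "\<nu> \<in> (\<lambda>(x,y). shift x y \<mu>) ` (carrier P \<times> carrier P)"
      using uinv_P(1) by (intro image_eqI[where x="(uinv x, uinv y)"]) auto
  next
    fix \<nu> assume "\<nu> \<in> (\<lambda>(x,y). shift x y \<mu>) ` (carrier P \<times> carrier P)"
    then obtain x y where xy: "x \<in> carrier P" "y \<in> carrier P" "\<nu> = shift x y \<mu>" by auto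
    then have "\<nu> = shift (uinv (uinv x)) (uinv (uinv y)) \<mu>" by (simp add: uinv_uinv)
    then show "\<nu> \<in> double_orbit J \<mu>" unfolding eq using uinv_P(1) xy(1,2) by blast
  qed
qed

lemma mem_double_orbit: "\<mu> \<in> double_orbit J \<nu> \<longleftrightarrow> (\<exists>x\<in>carrier P. \<exists>y\<in>carrier P. \<mu> = shift x y \<nu>)"
  unfolding double_orbit_eq by auto

lemma double_orbit_refl: "\<mu> \<in> double_orbit J \<mu>"
  unfolding mem_double_orbit by (intro bexI[of _ 1]) (auto simp: one_P)

lemma shift_double_orbit:
  assumes "x \<in> carrier P" "y \<in> carrier P" "\<mu> \<in> double_orbit J \<nu>"
  shows "shift x y \<mu> \<in> double_orbit J \<nu>"
proof -
  obtain x' y' where "x' \<in> carrier P" "y' \<in> carrier P" "\<mu> = shift x' y' \<nu>"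
    using assms(3) unfolding mem_double_orbit by blast
  then have "shift x y \<mu> = shift (x' * x) (y * y') \<nu>" "x' * x \<in> carrier P" "y * y' \<in> carrier P"
    using assms(1,2) by (simp_all add: shift_shift mult_P)
  then show ?thesis unfolding mem_double_orbit by blast
qed

lemma shift_inverse:
  "x \<in> carrier P \<Longrightarrow> y \<in> carrier P \<Longrightarrow> shift (uinv x) (uinv y) (shift x y \<mu>) = \<mu>"
  by (simp add: shift_shift uinv_P)

lemma double_orbit_cong:
  assumes "\<mu> \<in> double_orbit J \<nu>"
  shows "double_orbit J \<mu> = double_orbit J \<nu>"
proof
  obtain x y where xy: "x \<in> carrier P" "y \<in> carrier P" "\<mu> = shift x y \<nu>"
    using assms unfolding mem_double_orbit by blast
  have "\<nu> \<in> double_orbit J \<mu>"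
    unfolding mem_double_orbit using xy shift_inverse[OF xy(1,2), of \<nu>] uinv_P(1) by metis
  then show "double_orbit J \<nu> \<subseteq> double_orbit J \<mu>"
    using shift_double_orbit unfolding double_orbit_eq[of \<nu>] by auto
  show "double_orbit J \<mu> \<subseteq> double_orbit J \<nu>"
    using shift_double_orbit[OF _ _ assms] unfolding double_orbit_eq[of \<mu>] by auto
qed

lemma finite_double_orbit: "finite (double_orbit J \<mu>)"
  unfolding double_orbit_eq using P.finite_carrier by simp

lemma double_orbit_dual:
  assumes "\<nu> \<in> dual J"
  shows "double_orbit J \<nu> \<subseteq> dual J"
proof
  fix \<mu> assume "\<mu> \<in> double_orbit J \<nu>"
  then obtain x y where xy: "x \<in> carrier P" "y \<in> carrier P" "\<mu> = shift x y \<nu>" unfolding mem_double_orbit by blast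
  have "shift x y \<nu> (a + b) = shift x y \<nu> a * shift x y \<nu> b" if "a \<in> J" "b \<in> J" for a b
    using assms that mult_P_J[OF xy(1,2)] by (simp add: shift_def dual_def distrib_left distrib_right)
  moreover have "shift x y \<nu> a \<noteq> 0" if "a \<in> J" for a
    using assms that mult_P_J[OF xy(1,2)] by (simp add: shift_def dual_def)
  moreover have "shift x y \<nu> a = 0" if "a \<notin> J" for a
    using assms that mult_P_J[OF xy(1,2)] by (simp add: shift_def dual_def)
  ultimately show "\<mu> \<in> dual J" unfolding xy(3) dual_def by blast
qed

text \<open>Orbit-stabiliser for \<open>P x P\<close>: translation by one preimage maps the fibre
  over \<open>\<mu>\<close> bijectively onto the fibre over any other point, so the orbit size
  divides the odd number \<open>|J|^2\<close>.\<close>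

lemma odd_card_double_orbit: "odd (card (double_orbit J \<mu>))"
proof -
  let ?S = "carrier P \<times> carrier P"
  let ?f = "\<lambda>(x,y). shift x y \<mu>"
  let ?F = "\<lambda>\<nu>. {p \<in> ?S. ?f p = \<nu>}"
  have fin: "finite ?S" using P.finite_carrier by simp
  have fibre: "card (?F \<nu>) = card (?F \<mu>)" if \<nu>: "\<nu> \<in> double_orbit J \<mu>" for \<nu>
  proof -
    obtain x0 y0 where 0: "x0 \<in> carrier P" "y0 \<in> carrier P" "\<nu> = shift x0 y0 \<mu>"
      using \<nu> unfolding mem_double_orbit by blast
    have "bij_betw (\<lambda>(x,y). (x * x0, y0 * y)) (?F \<mu>) (?F \<nu>)"
    proof (rule bij_betwI[where g="\<lambda>(x,y). (x * uinv x0, uinv y0 * y)"])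
      show "(\<lambda>(x,y). (x * x0, y0 * y)) \<in> ?F \<mu> \<rightarrow> ?F \<nu>"
      proof
        fix p assume p: "p \<in> ?F \<mu>"
        obtain x y where xy: "p = (x,y)" by (cases p)
        have "shift x y \<mu> = \<mu>" using p xy by simp
        then have "shift (x * x0) (y0 * y) \<mu> = \<nu>" using shift_shift[of x0 y0 x y \<mu>] 0(3) by simp
        then show "(case p of (x,y) \<Rightarrow> (x * x0, y0 * y)) \<in> ?F \<nu>" using p xy 0 by (simp add: mult_P)
      qed
      show "(\<lambda>(x,y). (x * uinv x0, uinv y0 * y)) \<in> ?F \<nu> \<rightarrow> ?F \<mu>"
      proof
        fix p assume p: "p \<in> ?F \<nu>"
        obtain x y where xy: "p = (x,y)" by (cases p)
        have "shift x y \<mu> = \<nu>" using p xy by simp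
        then have "shift (uinv x0) (uinv y0) (shift x y \<mu>) = \<mu>" using shift_inverse[OF 0(1,2)] 0(3) by simp
        then have "shift (x * uinv x0) (uinv y0 * y) \<mu> = \<mu>" by (simp add: shift_shift)
        then show "(case p of (x,y) \<Rightarrow> (x * uinv x0, uinv y0 * y)) \<in> ?F \<mu>" using p xy 0 by (simp add: mult_P uinv_P)
      qed
      have cancel: "x * x0 * uinv x0 = x" "x * uinv x0 * x0 = x" "uinv y0 * (y0 * y) = y" "y0 * (uinv y0 * y) = y" for x y
        using 0 by (simp_all add: mult.assoc uinv_P) (simp_all add: mult.assoc[symmetric] uinv_P)
      show "(case case p of (x,y) \<Rightarrow> (x * x0, y0 * y) of (x,y) \<Rightarrow> (x * uinv x0, uinv y0 * y)) = p" for p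
        by (cases p) (simp add: cancel)
      show "(case case p of (x,y) \<Rightarrow> (x * uinv x0, uinv y0 * y) of (x,y) \<Rightarrow> (x * x0, y0 * y)) = p" for p
        by (cases p) (simp add: cancel)
    qed
    then show ?thesis by (rule bij_betw_same_card[symmetric])
  qed
  have "card ?S = (\<Sum>p\<in>?S. 1)" by simp
  also have "\<dots> = (\<Sum>\<nu>\<in>double_orbit J \<mu>. \<Sum>p\<in>?F \<nu>. 1)"
    by (rule sum.group[symmetric, OF fin finite_double_orbit]) (simp add: double_orbit_eq)
  also have "\<dots> = (\<Sum>\<nu>\<in>double_orbit J \<mu>. card (?F \<mu>))" by (intro sum.cong refl) (simp only: sum_constant fibre, simp)
  finally have total: "card J * card J = card (double_orbit J \<mu>) * card (?F \<mu>)" by (simp add: card_cartesian_product card_P)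
  have "odd (card J * card J)" using odd_card_J by simp
  then have "odd (card (double_orbit J \<mu>) * card (?F \<mu>))" unfolding total .
  then show ?thesis unfolding even_mult_iff by blast
qed

section \<open>Orbit sums and the blocks they define\<close>

definition orbit_sum :: "('a \<Rightarrow> complex) \<Rightarrow> 'a \<Rightarrow> complex" where
  "orbit_sum \<mu> a = (\<Sum>\<nu>\<in>double_orbit J \<mu>. \<nu> a)"

lemma orbit_sum_mult:
  assumes x: "x \<in> carrier P" and y: "y \<in> carrier P"
  shows "orbit_sum \<mu> (x * a * y) = orbit_sum \<mu> a"
proof -
  have "bij_betw (shift x y) (double_orbit J \<mu>) (double_orbit J \<mu>)"
  proof (rule bij_betwI[where g="shift (uinv x) (uinv y)"])
    show "shift x y (shift (uinv x) (uinv y) \<nu>) = \<nu>" for \<nu>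
      by (simp only: shift_shift uinv_P[OF x] uinv_P[OF y] shift_one)
    show "shift (uinv x) (uinv y) (shift x y \<nu>) = \<nu>" for \<nu> by (rule shift_inverse[OF x y])
    show "shift x y \<in> double_orbit J \<mu> \<rightarrow> double_orbit J \<mu>" using shift_double_orbit[OF x y] by blast
    show "shift (uinv x) (uinv y) \<in> double_orbit J \<mu> \<rightarrow> double_orbit J \<mu>"
      using shift_double_orbit[OF uinv_P(1)[OF x] uinv_P(1)[OF y]] by blast
  qed
  then have "(\<Sum>\<nu>\<in>double_orbit J \<mu>. shift x y \<nu> a) = (\<Sum>\<nu>\<in>double_orbit J \<mu>. \<nu> a)"
    by (rule sum.reindex_bij_betw)
  then show ?thesis by (simp add: orbit_sum_def shift_def)
qed

text \<open>Since \<open>\<Psi>(x)\<close> differs from \<open>(x - 1)/2\<close> by a factor in \<open>P\<close>, the two give the same orbit sum, and only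
  the latter behaves well under translation.\<close>

lemma orbit_sum_cayley_inv:
  assumes x: "x \<in> carrier P"
  shows "orbit_sum \<mu> (cayley_inv x) = orbit_sum \<mu> (half (x - 1))"
proof -
  \<comment> \<open>\<open>w\<close> is \<open>(x + 1)/2\<close> written so that it visibly lies in
    \<open>P\<close>. Hence the inverse of \<open>x + 1\<close> is half of \<open>uinv w\<close>,
    and \<open>cayley_inv x\<close> is \<open>(x - 1)/2\<close> times the factor
    \<open>uinv w\<close> from \<open>P\<close>.\<close>
  define w where "w = 1 + half (x - 1)"
  have w: "w \<in> carrier P" using x by (simp add: w_def mem_P half_J)
  have ww: "w + w = x + 1"
  proof -
    have "w + w = 1 + 1 + (half (x - 1) + half (x - 1))" by (simp only: w_def add_ac)
    then show ?thesis by (simp add: algebra_simps)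
  qed
  have "(x + 1) * half (uinv w) = half ((w + w) * uinv w)" by (simp add: ww half_mult(2))
  also have "\<dots> = 1" using w by (intro halfI) (simp add: distrib_right uinv_P)
  finally have 1: "(x + 1) * half (uinv w) = 1" .
  have "half (uinv w) * (x + 1) = half (uinv w * (w + w))" by (simp add: ww half_mult(1))
  also have "\<dots> = 1" using w by (intro halfI) (simp add: distrib_left uinv_P)
  finally have "uinv (x + 1) = half (uinv w)" using 1 by (intro uinv_eqI)
  then have "cayley_inv x = 1 * half (x - 1) * uinv w"
    by (simp add: cayley_inv_def half_mult[symmetric])
  then show ?thesis using orbit_sum_mult[OF one_P uinv_P(1)[OF w]] by simp
qed

text \<open>The function \<open>s\<close> of the overview; the supercharacter without its positive
  factor.\<close>

definition block_fun :: "('a \<Rightarrow> complex) \<Rightarrow> 'a \<Rightarrow> complex" where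
  "block_fun \<mu> x = orbit_sum \<mu> (half (x - 1))"

lemma block_fun_class:
  assumes "x \<in> carrier P" "y \<in> carrier P"
  shows "block_fun \<mu> (y * x * uinv y) = block_fun \<mu> x"
proof -
  have "y * x * uinv y - 1 = y * (x - 1) * uinv y" using assms by (simp add: right_diff_distrib left_diff_distrib uinv_P)
  then have "half (y * x * uinv y - 1) = y * half (x - 1) * uinv y"
    by (simp only: half_mult(1)[of "y * (x - 1)" "uinv y"] half_mult(2)[of y "x - 1"])
  then show ?thesis unfolding block_fun_def using orbit_sum_mult[OF assms(2) uinv_P(1)[OF assms(2)]] by simp
qed

text \<open>From \<open>z x^-1 - 1 = (z - x) x^-1\<close> the factor \<open>x^-1\<close> is dropped,
  and \<open>z - x\<close> is the difference of \<open>z - 1\<close> and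
  \<open>x - 1\<close>.\<close>

lemma block_fun_translate:
  assumes "x \<in> carrier P"
  shows "block_fun \<mu> (z * uinv x) = orbit_sum \<mu> (half (z - 1) - half (x - 1))"
proof -
  have "z * uinv x - 1 = 1 * (z - x) * uinv x" using assms by (simp add: left_diff_distrib uinv_P)
  then have "half (z * uinv x - 1) = 1 * (half (z - 1) - half (x - 1)) * uinv x"
    by (simp add: half_mult(1) flip: half_diff)
  then show ?thesis unfolding block_fun_def using orbit_sum_mult[OF one_P uinv_P(1)[OF assms]] by simp
qed

text \<open>By \<open>block_fun_translate\<close> this is a convolution on the additive group
  \<open>J\<close>. Different orbits have no linear character in common, so orthogonality of the
  characters of \<open>J\<close> kills every term.\<close>

lemma block_fun_convolution:
  assumes \<mu>: "\<mu> \<in> dual J" and \<nu>: "\<nu> \<in> dual J" and ne: "double_orbit J \<mu> \<noteq> double_orbit J \<nu>"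
    and z: "z \<in> carrier P"
  shows "(\<Sum>x\<in>carrier P. block_fun \<mu> x * block_fun \<nu> (z * uinv x)) = 0"
proof -
  let ?z = "half (z - 1)"
  have zJ: "?z \<in> J" using z by (simp add: mem_P half_J)
  have "(\<Sum>x\<in>carrier P. block_fun \<mu> x * block_fun \<nu> (z * uinv x)) =
      (\<Sum>x\<in>carrier P. orbit_sum \<mu> (half (x - 1)) * orbit_sum \<nu> (?z - half (x - 1)))"
    by (intro sum.cong refl) (simp add: block_fun_translate, simp add: block_fun_def)
  also have "\<dots> = (\<Sum>a\<in>J. orbit_sum \<mu> a * orbit_sum \<nu> (?z - a))"
    by (rule sum.reindex_bij_betw[OF bij_betw_P_J_half])
  also have "\<dots> = (\<Sum>a\<in>J. \<Sum>\<mu>'\<in>double_orbit J \<mu>. \<Sum>\<nu>'\<in>double_orbit J \<nu>. \<nu>' ?z * (\<mu>' a * \<nu>' (- a)))"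
  proof (rule sum.cong[OF refl])
    fix a assume a: "a \<in> J"
    have "\<nu>' (?z - a) = \<nu>' ?z * \<nu>' (- a)" if "\<nu>' \<in> double_orbit J \<nu>" for \<nu>'
    proof -
      have "\<nu>' \<in> dual J" using double_orbit_dual[OF \<nu>] that by blast
      then have "\<nu>' (?z + - a) = \<nu>' ?z * \<nu>' (- a)" using zJ uminus_J[OF a] unfolding dual_def by blast
      then show ?thesis by simp
    qed
    then show "orbit_sum \<mu> a * orbit_sum \<nu> (?z - a) =
        (\<Sum>\<mu>'\<in>double_orbit J \<mu>. \<Sum>\<nu>'\<in>double_orbit J \<nu>. \<nu>' ?z * (\<mu>' a * \<nu>' (- a)))"
      unfolding orbit_sum_def sum_product by (intro sum.cong refl) (simp add: mult_ac)
  qed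
  also have "\<dots> = (\<Sum>\<mu>'\<in>double_orbit J \<mu>. \<Sum>\<nu>'\<in>double_orbit J \<nu>. \<nu>' ?z * (\<Sum>a\<in>J. \<mu>' a * \<nu>' (- a)))"
    by (simp only: sum.swap[where A=J] sum_distrib_left)
  also have "\<dots> = 0"
  proof (intro sum.neutral ballI)
    fix \<mu>' \<nu>' assume *: "\<mu>' \<in> double_orbit J \<mu>" "\<nu>' \<in> double_orbit J \<nu>"
    have "\<mu>' \<noteq> \<nu>'" using * double_orbit_cong ne by metis
    then show "\<nu>' ?z * (\<Sum>a\<in>J. \<mu>' a * \<nu>' (- a)) = 0"
      using dual_orthogonal[of \<mu>' \<nu>'] * double_orbit_dual[OF \<mu>] double_orbit_dual[OF \<nu>] by auto
  qed
  finally show ?thesis .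
qed

text \<open>The scalar product of \<open>block_fun\<close> with an irreducible
  \<open>\<chi>\<close>, multiplied by \<open>|P|\<close>; divided by the degree it is the scalar by
  which \<open>block_fun\<close> acts in the representation.\<close>

definition block_coeff :: "('a \<Rightarrow> complex) \<Rightarrow> ('a \<Rightarrow> complex) \<Rightarrow> complex" where
  "block_coeff \<mu> \<chi> = (\<Sum>x\<in>carrier P. block_fun \<mu> x * \<chi> (uinv x))"

lemma superchar_eq:
  assumes "x \<in> carrier P"
  shows "superchar J \<mu> x = of_nat (card (left_orbit J \<mu>)) / of_nat (card (double_orbit J \<mu>)) * block_fun \<mu> x"
  using assms orbit_sum_cayley_inv[OF assms, of \<mu>] by (simp add: superchar_def block_fun_def orbit_sum_def)

lemma constituent_superchar:
  assumes "\<chi> \<in> Irr P"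
  shows "constituent P \<chi> (superchar J \<mu>) \<longleftrightarrow> block_coeff \<mu> \<chi> \<noteq> 0"
proof -
  let ?c = "of_nat (card (left_orbit J \<mu>)) / of_nat (card (double_orbit J \<mu>)) :: complex"
  have "left_orbit J \<mu> = (\<lambda>x. left_act x \<mu>) ` carrier P" by (auto simp: left_orbit_def)
  then have "card (left_orbit J \<mu>) > 0" using P.finite_carrier one_P by (auto simp: card_gt_0_iff)
  moreover have "card (double_orbit J \<mu>) > 0"
    using finite_double_orbit double_orbit_refl[of \<mu>] by (auto simp: card_gt_0_iff)
  ultimately have c: "?c \<noteq> 0" by simp
  have "(\<Sum>x\<in>carrier P. superchar J \<mu> x * \<chi> (inv\<^bsub>P\<^esub> x)) = ?c * block_coeff \<mu> \<chi>"
    unfolding block_coeff_def sum_distrib_left by (intro sum.cong refl) (simp add: superchar_eq)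
  then have "char_inner P (superchar J \<mu>) \<chi> = ?c * block_coeff \<mu> \<chi> / of_nat (card (carrier P))"
    unfolding P.char_inner_Irr[OF assms] by simp
  then show ?thesis using c assms P.card_carrier_pos by (simp add: constituent_def)
qed

lemma block_coeff_cong: "double_orbit J \<mu> = double_orbit J \<nu> \<Longrightarrow> block_coeff \<mu> \<chi> = block_coeff \<nu> \<chi>"
  by (simp add: block_coeff_def block_fun_def orbit_sum_def)

text \<open>By \<open>central_character\<close> both functions act as scalars on the representation
  of \<open>\<chi>\<close>. The product of these scalars belongs to the convolution of the two
  functions, which is zero.\<close>

lemma block_disjoint:
  assumes \<mu>: "\<mu> \<in> dual J" and \<nu>: "\<nu> \<in> dual J" and ne: "double_orbit J \<mu> \<noteq> double_orbit J \<nu>"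
    and \<chi>: "\<chi> \<in> Irr P"
  shows "block_coeff \<mu> \<chi> * block_coeff \<nu> \<chi> = 0"
proof -
  have 1: "(\<Sum>y\<in>carrier P. block_fun \<nu> y * \<chi> (uinv x * uinv y)) * \<chi> 1 = block_coeff \<nu> \<chi> * \<chi> (uinv x)"
    if x: "x \<in> carrier P" for x
    using P.central_character[OF \<chi> uinv_P(1)[OF x], of "block_fun \<nu>"] block_fun_class
    by (simp add: block_coeff_def cong: sum.cong)
  let ?F = "\<lambda>x y. block_fun \<mu> x * block_fun \<nu> y * \<chi> (uinv x * uinv y) * \<chi> 1"
  let ?K = "\<lambda>x z. block_fun \<mu> x * block_fun \<nu> (z * uinv x) * \<chi> (uinv z) * \<chi> 1"
  have "block_coeff \<mu> \<chi> * block_coeff \<nu> \<chi> =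
      (\<Sum>x\<in>carrier P. block_fun \<mu> x * (block_coeff \<nu> \<chi> * \<chi> (uinv x)))"
    by (simp add: block_coeff_def[of \<mu>] sum_distrib_left sum_distrib_right mult_ac)
  also have "\<dots> = (\<Sum>x\<in>carrier P. \<Sum>y\<in>carrier P. ?F x y)"
    by (intro sum.cong refl) (simp only: 1[symmetric] sum_distrib_left sum_distrib_right mult.assoc)
  \<comment> \<open>Substitution \<open>z = y * x\<close>, after which \<open>\<chi>\<close> depends
    on \<open>z\<close> only and the inner sum over \<open>x\<close> becomes the convolution at
    \<open>z\<close>.\<close>
  also have "\<dots> = (\<Sum>x\<in>carrier P. \<Sum>z\<in>carrier P. ?K x z)"
  proof (rule sum.cong[OF refl])
    fix x assume x: "x \<in> carrier P"
    have "(\<Sum>y\<in>carrier P. ?F x y) =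
        (\<Sum>z\<in>carrier P. block_fun \<mu> x * block_fun \<nu> (z * uinv x) * \<chi> (uinv x * uinv (z * uinv x)) * \<chi> 1)"
      using sum.reindex_bij_betw[OF P.bij_betw_right_mult[OF uinv_P(1)[OF x]],
          of "?F x"] by simp
    also have "\<dots> = (\<Sum>z\<in>carrier P. ?K x z)"
    proof (rule sum.cong[OF refl])
      fix z assume z: "z \<in> carrier P"
      have "uinv x * uinv (z * uinv x) = uinv x * (x * uinv z)"
        using x z by (simp add: uinv_mult uinv_P uinv_uinv)
      also have "\<dots> = uinv x * x * uinv z" by (simp only: mult.assoc)
      finally have "uinv x * uinv (z * uinv x) = uinv z" using x by (simp add: uinv_P)
      then show "block_fun \<mu> x * block_fun \<nu> (z * uinv x) * \<chi> (uinv x * uinv (z * uinv x)) * \<chi> 1 =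
          ?K x z" by simp
    qed
    finally show "(\<Sum>y\<in>carrier P. ?F x y) =
        (\<Sum>z\<in>carrier P. ?K x z)" .
  qed
  also have "\<dots> = (\<Sum>z\<in>carrier P. (\<Sum>x\<in>carrier P. block_fun \<mu> x * block_fun \<nu> (z * uinv x)) * (\<chi> (uinv z) * \<chi> 1))"
    by (subst sum.swap) (simp add: sum_distrib_right mult.assoc)
  also have "\<dots> = 0" by (simp add: block_fun_convolution[OF \<mu> \<nu> ne])
  finally show ?thesis .
qed

text \<open>All orbit sums together are the sum over the whole dual, that is \<open>|J|\<close> at
  the identity and 0 elsewhere, so the coefficients of \<open>\<chi>\<close> add up to
  \<open>|J| \<chi>(1)\<close>, which is nonzero. By \<open>block_disjoint\<close> a single orbit is
  responsible and carries the full value.\<close>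

lemma block_exists:
  assumes \<chi>: "\<chi> \<in> Irr P"
  obtains \<mu> where "\<mu> \<in> dual J" "block_coeff \<mu> \<chi> = of_nat (card J) * \<chi> 1"
    "\<And>\<nu>. \<nu> \<in> dual J \<Longrightarrow> double_orbit J \<nu> \<noteq> double_orbit J \<mu> \<Longrightarrow> block_coeff \<nu> \<chi> = 0"
proof -
  let ?Orb = "double_orbit J ` dual J"
  \<comment> \<open>The coefficient is indexed by the orbit itself, so that in the sum over
    \<open>?Orb\<close> each orbit is counted once and no representatives have to be chosen.\<close>
  define t where "t R = (\<Sum>x\<in>carrier P. (\<Sum>\<nu>\<in>R. \<nu> (half (x - 1))) * \<chi> (uinv x))" for R
  have t: "block_coeff \<mu> \<chi> = t (double_orbit J \<mu>)" for \<mu>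
    by (simp add: t_def block_coeff_def block_fun_def orbit_sum_def)
  obtain d where "d > 0" "\<chi> \<one>\<^bsub>P\<^esub> = of_nat d" using P.Irr_one_pos[OF \<chi>] .
  then have one: "\<chi> 1 \<noteq> 0" by simp
  have total: "(\<Sum>R\<in>?Orb. t R) = of_nat (card J) * \<chi> 1"
  proof -
    have orb: "{\<nu> \<in> dual J. double_orbit J \<nu> = R} = R" if "R \<in> ?Orb" for R
    proof -
      obtain \<nu>' where "\<nu>' \<in> dual J" "R = double_orbit J \<nu>'" using \<open>R \<in> ?Orb\<close> by blast
      then show ?thesis using double_orbit_dual double_orbit_cong double_orbit_refl by auto
    qed
    have "(\<Sum>R\<in>?Orb. t R) = (\<Sum>x\<in>carrier P. (\<Sum>R\<in>?Orb. \<Sum>\<nu>\<in>R. \<nu> (half (x - 1))) * \<chi> (uinv x))"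
      unfolding t_def by (subst sum.swap) (simp add: sum_distrib_right)
    also have "\<dots> = (\<Sum>x\<in>carrier P. (\<Sum>\<nu>\<in>dual J. \<nu> (half (x - 1))) * \<chi> (uinv x))"
    proof (rule sum.cong[OF refl])
      fix x
      have "(\<Sum>R\<in>?Orb. \<Sum>\<nu>\<in>R. \<nu> (half (x - 1))) = (\<Sum>R\<in>?Orb. \<Sum>\<nu>\<in>{\<nu> \<in> dual J. double_orbit J \<nu> = R}. \<nu> (half (x - 1)))"
        by (intro sum.cong refl) (simp add: orb)
      also have "\<dots> = (\<Sum>\<nu>\<in>dual J. \<nu> (half (x - 1)))"
        by (rule sum.group) (auto simp: finite_dual)
      finally show "(\<Sum>R\<in>?Orb. \<Sum>\<nu>\<in>R. \<nu> (half (x - 1))) * \<chi> (uinv x) = (\<Sum>\<nu>\<in>dual J. \<nu> (half (x - 1))) * \<chi> (uinv x)" by simp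
    qed
    also have "\<dots> = (\<Sum>x\<in>carrier P. if x = 1 then of_nat (card J) * \<chi> 1 else 0)"
    proof (rule sum.cong[OF refl])
      fix x assume x: "x \<in> carrier P"
      have "x - 1 = 0" if "half (x - 1) = 0" using half_add_half[of "x - 1"] unfolding that by simp
      then have "half (x - 1) = 0 \<longleftrightarrow> x = 1" by auto
      moreover have "uinv 1 = (1::'a)" by (rule uinv_eqI) auto
      ultimately show "(\<Sum>\<nu>\<in>dual J. \<nu> (half (x - 1))) * \<chi> (uinv x) = (if x = 1 then of_nat (card J) * \<chi> 1 else 0)"
        using sum_dual[of "half (x - 1)"] x by (auto simp: mem_P half_J)
    qed
    also have "\<dots> = of_nat (card J) * \<chi> 1" using P.finite_carrier one_P by (simp add: sum.delta)
    finally show ?thesis .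
  qed
  have "card J > 0" using odd_card_J by (metis even_zero gr0I)
  then have "(\<Sum>R\<in>?Orb. t R) \<noteq> 0" using total one by simp
  then obtain R where "R \<in> ?Orb" "t R \<noteq> 0" by (meson sum.neutral)
  then obtain \<mu> where \<mu>: "\<mu> \<in> dual J" "t (double_orbit J \<mu>) \<noteq> 0" by blast
  have other: "block_coeff \<nu> \<chi> = 0" if "\<nu> \<in> dual J" "double_orbit J \<nu> \<noteq> double_orbit J \<mu>" for \<nu>
    using block_disjoint[OF that(1) \<mu>(1) that(2) \<chi>] \<mu>(2) t[of \<mu>] by simp
  have "(\<Sum>R\<in>?Orb. t R) = (\<Sum>R\<in>?Orb. if R = double_orbit J \<mu> then t R else 0)"
    using other t by (intro sum.cong refl) auto
  also have "\<dots> = t (double_orbit J \<mu>)" using \<mu>(1) finite_dual by (simp add: sum.delta)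
  finally have "block_coeff \<mu> \<chi> = of_nat (card J) * \<chi> 1" using total t[of \<mu>] by simp
  then show ?thesis using that \<mu>(1) other by blast
qed

lemma block_unique:
  assumes "\<chi> \<in> Irr P" "\<mu> \<in> dual J" "\<nu> \<in> dual J" "block_coeff \<mu> \<chi> \<noteq> 0" "block_coeff \<nu> \<chi> \<noteq> 0"
  shows "double_orbit J \<mu> = double_orbit J \<nu>"
  using block_disjoint[OF assms(2,3) _ assms(1)] assms(4,5) by auto

text \<open>The sum of \<open>\<chi>(1)\<close> times the coefficient of \<open>\<chi>\<close> is
  evaluated in two ways. The regular character leaves \<open>|J|\<close> times the value of
  \<open>block_fun\<close> at 1, which is the orbit size; by \<open>block_exists\<close> each
  nonzero coefficient is \<open>|J| \<chi>(1)\<close>.\<close>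

lemma block_degrees:
  assumes \<mu>: "\<mu> \<in> dual J"
  shows "(\<Sum>\<chi>\<in>{\<chi> \<in> Irr P. block_coeff \<mu> \<chi> \<noteq> 0}. (\<chi> 1)\<^sup>2) = of_nat (card (double_orbit J \<mu>))"
proof -
  let ?N = "of_nat (card J) :: complex"
  have N: "?N \<noteq> 0" using odd_card_J by (metis even_zero of_nat_eq_0_iff)
  have coeff: "block_coeff \<mu> \<chi> = ?N * \<chi> 1" if "\<chi> \<in> Irr P" "block_coeff \<mu> \<chi> \<noteq> 0" for \<chi>
    using block_exists[OF that(1)] block_coeff_cong \<mu> that(2) by metis
  have "(\<Sum>\<chi>\<in>Irr P. \<chi> 1 * block_coeff \<mu> \<chi>) = (\<Sum>x\<in>carrier P. block_fun \<mu> x * (\<Sum>\<chi>\<in>Irr P. \<chi> 1 * \<chi> (uinv x)))"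
    unfolding block_coeff_def by (simp only: sum_distrib_left sum.swap[where A="Irr P"] mult_ac)
  also have "\<dots> = (\<Sum>x\<in>carrier P. if x = 1 then block_fun \<mu> 1 * ?N else 0)"
  proof (rule sum.cong[OF refl])
    fix x assume x: "x \<in> carrier P"
    have "uinv x = 1 \<longleftrightarrow> x = 1" using uinv_P[OF x] by (metis mult_1_left)
    then show "block_fun \<mu> x * (\<Sum>\<chi>\<in>Irr P. \<chi> 1 * \<chi> (uinv x)) = (if x = 1 then block_fun \<mu> 1 * ?N else 0)"
      using P.regular_character(2)[OF uinv_P(1)[OF x]] by (simp add: card_P)
  qed
  also have "\<dots> = block_fun \<mu> 1 * ?N" using P.finite_carrier one_P by (simp add: sum.delta)
  also have "block_fun \<mu> 1 = of_nat (card (double_orbit J \<mu>))"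
    using double_orbit_dual[OF \<mu>] by (simp add: block_fun_def orbit_sum_def dual_zero subset_iff)
  finally have 1: "(\<Sum>\<chi>\<in>Irr P. \<chi> 1 * block_coeff \<mu> \<chi>) = of_nat (card (double_orbit J \<mu>)) * ?N" .
  have "(\<Sum>\<chi>\<in>Irr P. \<chi> 1 * block_coeff \<mu> \<chi>) = (\<Sum>\<chi>\<in>{\<chi> \<in> Irr P. block_coeff \<mu> \<chi> \<noteq> 0}. ?N * (\<chi> 1)\<^sup>2)"
  proof (rule sum.mono_neutral_cong_right)
    fix \<chi> assume "\<chi> \<in> {\<chi> \<in> Irr P. block_coeff \<mu> \<chi> \<noteq> 0}"
    then show "\<chi> 1 * block_coeff \<mu> \<chi> = ?N * (\<chi> 1)\<^sup>2" using coeff[of \<chi>] by (simp add: power2_eq_square)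
  qed (auto simp: P.regular_character(1))
  then show ?thesis using 1 N by (simp add: sum_distrib_left[symmetric] mult.commute)
qed

end

lemma (in fin_group) char_inner_Irr_sum:
  assumes "X \<subseteq> Irr G" "\<chi> \<in> Irr G"
  shows "char_inner G (\<lambda>x. \<Sum>\<psi>\<in>X. c \<psi> * \<psi> x) \<chi> = (if \<chi> \<in> X then c \<chi> else 0)"
proof -
  have fX: "finite X" using assms(1) regular_character(1) finite_subset by blast
  have "char_inner G (\<lambda>x. \<Sum>\<psi>\<in>X. c \<psi> * \<psi> x) \<chi> = (\<Sum>\<psi>\<in>X. c \<psi> * char_inner G \<psi> \<chi>)"
    unfolding char_inner_def
    by (simp add: sum_distrib_right sum_distrib_left sum_divide_distrib mult.assoc) (rule sum.swap)
  also have "\<dots> = (\<Sum>\<psi>\<in>X. if \<psi> = \<chi> then c \<psi> else 0)"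
    using assms by (intro sum.cong refl) (auto simp: Irr_orthonormal)
  finally show ?thesis using fX by (simp add: sum.delta)
qed

section \<open>Blocks fixed by the involution\<close>

locale nilpotent_involution_algebra = involution_algebra scale \<sigma>
  for scale :: "'k::{field,finite} \<Rightarrow> 'a::{ring,monoid_mult} \<Rightarrow> 'a" and \<sigma> +
  fixes J :: "'a set"
  assumes nilpotent_J: "nilpotent_subalgebra scale J"
    and \<sigma>_J: "\<sigma> ` J \<subseteq> J"
begin

sublocale nilpotent_algebra scale J
  by unfold_locales (fact odd_char finite_dimensional scale_mult_left scale_mult_right nilpotent_J)+

lemma \<sigma>_one [simp]: "\<sigma> 1 = 1"
  using \<sigma>_mult[of "\<sigma> 1" 1] by (simp add: \<sigma>_\<sigma>)

lemma \<sigma>_minus: "\<sigma> (- a) = - \<sigma> a"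
proof -
  have "\<sigma> 0 = 0" using \<sigma>_add[of 0 0] by simp
  then show ?thesis using \<sigma>_add[of a "- a"] by (simp add: eq_neg_iff_add_eq_0 add.commute)
qed

lemma \<sigma>_diff: "\<sigma> (a - b) = \<sigma> a - \<sigma> b"
  using \<sigma>_add[of a "- b"] by (simp add: \<sigma>_minus)

lemma \<sigma>_half: "\<sigma> (half a) = half (\<sigma> a)"
  using halfI[of "\<sigma> (half a)" "\<sigma> a"] \<sigma>_add[of "half a" "half a"] by simp

lemma \<sigma>_J_iff: "\<sigma> a \<in> J \<longleftrightarrow> a \<in> J"
  using \<sigma>_J \<sigma>_\<sigma> by (metis image_subset_iff)

lemma \<sigma>_P: "x \<in> carrier P \<Longrightarrow> \<sigma> x \<in> carrier P"
  using \<sigma>_diff[of x 1] \<sigma>_J_iff[of "x - 1"] by (simp add: mem_P)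

lemma uinv_\<sigma>: "x \<in> carrier P \<Longrightarrow> uinv (\<sigma> x) = \<sigma> (uinv x)"
  by (rule uinv_eqI) (simp_all add: \<sigma>_mult[symmetric] uinv_P)

text \<open>Inversion and \<open>\<sigma>\<close> both reverse products and commute on
  \<open>P\<close>, so their composite is an automorphism whose square is the identity.\<close>

sublocale I: odd_involution_group P "group_act \<sigma>"
proof unfold_locales
  show "odd (card (carrier P))" by (simp only: card_P odd_card_J not_False_eq_True)
  fix x y assume x: "x \<in> carrier P" and y: "y \<in> carrier P"
  show "group_act \<sigma> x \<in> carrier P" using x by (simp add: group_act_def \<sigma>_P uinv_P)
  show "group_act \<sigma> (x \<otimes>\<^bsub>P\<^esub> y) = group_act \<sigma> x \<otimes>\<^bsub>P\<^esub> group_act \<sigma> y"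
    using x y by (simp add: group_act_def uinv_mult \<sigma>_mult)
  show "group_act \<sigma> (group_act \<sigma> x) = x"
    using x by (simp add: group_act_def uinv_\<sigma> uinv_P uinv_uinv \<sigma>_\<sigma>)
qed

lemma fixed_group_eq: "fixed_group \<sigma> J = I.C"
  by (simp add: fixed_group_def)

lemma glauberman_bij_betw: "bij_betw (glauberman \<sigma> J) (Irr_fixed \<sigma> J) (Irr (fixed_group \<sigma> J))"
  using I.glauberman_bij unfolding glauberman_def[abs_def] Irr_fixed_def fixed_group_eq .

lemma dual_act_dual_act [simp]: "dual_act \<sigma> (dual_act \<sigma> \<mu>) = \<mu>"
  by (simp add: dual_act_def[abs_def] alg_act_def \<sigma>_minus \<sigma>_\<sigma>)

lemma dual_act_dual:
  assumes "\<mu> \<in> dual J"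
  shows "dual_act \<sigma> \<mu> \<in> dual J"
proof -
  have *: "- \<sigma> a \<in> J \<longleftrightarrow> a \<in> J" for a using uminus_J[of "- \<sigma> a"] uminus_J[of "\<sigma> a"] \<sigma>_J_iff[of a] by auto
  have "dual_act \<sigma> \<mu> (a + b) = dual_act \<sigma> \<mu> a * dual_act \<sigma> \<mu> b" if "a \<in> J" "b \<in> J" for a b
  proof -
    have "\<mu> (- \<sigma> a + - \<sigma> b) = \<mu> (- \<sigma> a) * \<mu> (- \<sigma> b)"
      using assms that *[of a] *[of b] unfolding dual_def by blast
    moreover have "- \<sigma> (a + b) = - \<sigma> a + - \<sigma> b" by (simp add: \<sigma>_add)
    ultimately show ?thesis by (simp only: dual_act_def alg_act_def)
  qed
  then show ?thesis using assms * by (simp add: dual_def dual_act_def alg_act_def)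
qed

text \<open>As an anti-automorphism \<open>\<sigma>\<close> interchanges the two sides of the
  action; it therefore carries two-sided orbits to two-sided orbits.\<close>

lemma dual_act_shift: "dual_act \<sigma> (shift x y \<mu>) = shift (\<sigma> y) (\<sigma> x) (dual_act \<sigma> \<mu>)"
  by (simp add: fun_eq_iff dual_act_def alg_act_def shift_def \<sigma>_mult \<sigma>_\<sigma> mult.assoc)

lemma dual_act_double_orbit:
  assumes "\<nu> \<in> double_orbit J \<mu>"
  shows "dual_act \<sigma> \<nu> \<in> double_orbit J (dual_act \<sigma> \<mu>)"
proof -
  obtain x y where "x \<in> carrier P" "y \<in> carrier P" "\<nu> = shift x y \<mu>"
    using assms unfolding mem_double_orbit by blast
  then show ?thesis unfolding mem_double_orbit using \<sigma>_P dual_act_shift by blast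
qed

text \<open>From \<open>\<sigma>(x^-1) - 1 = - \<sigma>(x - 1) \<sigma>(x^-1)\<close> the last
  factor lies in \<open>P\<close> and is absorbed by the orbit sum; what remains is
  \<open>alg_act\<close> applied to \<open>(x - 1)/2\<close>.\<close>

lemma block_fun_group_act:
  assumes x: "x \<in> carrier P"
  shows "block_fun \<mu> (group_act \<sigma> x) = block_fun (dual_act \<sigma> \<mu>) x"
proof -
  let ?b = "half (x - 1)"
  have "uinv x - 1 = - (uinv x * (x - 1))" using x by (simp add: right_diff_distrib uinv_P)
  then have "\<sigma> (uinv x) - 1 = - (\<sigma> (x - 1) * \<sigma> (uinv x))"
    using \<sigma>_diff[of "uinv x" 1] by (simp add: \<sigma>_minus \<sigma>_mult)
  then have eq: "half (\<sigma> (uinv x) - 1) = 1 * (- \<sigma> ?b) * \<sigma> (uinv x)"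
    by (simp add: half_minus half_mult(1) \<sigma>_half)
  have "block_fun \<mu> (group_act \<sigma> x) = orbit_sum \<mu> (- \<sigma> ?b)"
    unfolding block_fun_def group_act_def eq by (rule orbit_sum_mult[OF one_P \<sigma>_P[OF uinv_P(1)[OF x]]])
  also have "\<dots> = (\<Sum>\<nu>\<in>double_orbit J \<mu>. dual_act \<sigma> \<nu> ?b)"
    by (simp add: orbit_sum_def dual_act_def alg_act_def)
  also have "\<dots> = orbit_sum (dual_act \<sigma> \<mu>) ?b"
    unfolding orbit_sum_def
  proof (rule sum.reindex_bij_betw)
    show "bij_betw (dual_act \<sigma>) (double_orbit J \<mu>) (double_orbit J (dual_act \<sigma> \<mu>))"
      by (rule bij_betwI[where g="dual_act \<sigma>"])
        (use dual_act_double_orbit[of _ \<mu>] dual_act_double_orbit[of _ "dual_act \<sigma> \<mu>"] in auto)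
  qed
  finally show ?thesis by (simp only: block_fun_def)
qed

text \<open>Reindexing by the involution. The separate \<open>\<chi>'\<close> covers both an
  invariant character, with \<open>\<chi>' = \<chi>\<close>, and the twist of an arbitrary
  one.\<close>

lemma block_coeff_twist:
  assumes "\<And>x. x \<in> carrier P \<Longrightarrow> \<chi>' x = \<chi> (group_act \<sigma> x)"
  shows "block_coeff \<mu> \<chi>' = block_coeff (dual_act \<sigma> \<mu>) \<chi>"
proof -
  have "block_coeff \<mu> \<chi>' = (\<Sum>x\<in>carrier P. block_fun \<mu> x * \<chi> (group_act \<sigma> (uinv x)))"
    unfolding block_coeff_def by (intro sum.cong refl) (simp add: assms uinv_P)
  also have "\<dots> = (\<Sum>x\<in>carrier P. block_fun \<mu> (group_act \<sigma> x) * \<chi> (group_act \<sigma> (uinv (group_act \<sigma> x))))"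
    by (rule sum.reindex_bij_betw[symmetric, OF I.bij_betw_\<tau>])
  also have "\<dots> = block_coeff (dual_act \<sigma> \<mu>) \<chi>"
    unfolding block_coeff_def
  proof (rule sum.cong[OF refl])
    fix x assume x: "x \<in> carrier P"
    have "group_act \<sigma> (uinv (group_act \<sigma> x)) = uinv x"
      using I.\<tau>_inv[of "group_act \<sigma> x"] x I.\<tau>_closed[OF x] by simp
    then show "block_fun \<mu> (group_act \<sigma> x) * \<chi> (group_act \<sigma> (uinv (group_act \<sigma> x))) =
        block_fun (dual_act \<sigma> \<mu>) x * \<chi> (uinv x)"
      using block_fun_group_act[OF x] by simp
  qed
  finally show ?thesis .
qed

text \<open>An invariant \<open>\<chi>\<close> lies in the block of \<open>\<mu>\<close> and in that
  of its image under \<open>\<sigma>\<close>, so uniqueness of the block makes the orbit stable. The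
  orbit has odd size, hence contains a fixed point.\<close>

lemma fixed_dual_in_block:
  assumes \<chi>: "\<chi> \<in> Irr_fixed \<sigma> J"
  obtains l where "l \<in> fixed_dual \<sigma> J" "block_coeff l \<chi> \<noteq> 0"
proof -
  have \<chi>P: "\<chi> \<in> Irr P" using \<chi> by (simp add: Irr_fixed_def)
  obtain d where "d > 0" "\<chi> \<one>\<^bsub>P\<^esub> = of_nat d" using P.Irr_one_pos[OF \<chi>P] .
  moreover have "card J > 0" using odd_card_J by (metis even_zero gr0I)
  moreover obtain \<mu> where \<mu>: "\<mu> \<in> dual J" "block_coeff \<mu> \<chi> = of_nat (card J) * \<chi> 1"
    using block_exists[OF \<chi>P] by blast
  ultimately have nz: "block_coeff \<mu> \<chi> \<noteq> 0" by simp
  have "block_coeff (dual_act \<sigma> \<mu>) \<chi> = block_coeff \<mu> \<chi>"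
    using block_coeff_twist[of \<chi> \<chi> \<mu>] \<chi> by (simp add: Irr_fixed_def)
  then have orb: "double_orbit J (dual_act \<sigma> \<mu>) = double_orbit J \<mu>"
    using block_unique[OF \<chi>P dual_act_dual[OF \<mu>(1)] \<mu>(1)] nz by simp
  obtain l where l: "l \<in> double_orbit J \<mu>" "dual_act \<sigma> l = l"
  proof (rule odd_sum_involution_fixpoint[of "double_orbit J \<mu>" "dual_act \<sigma>" "\<lambda>_. 1"])
    show "odd (\<Sum>_\<in>double_orbit J \<mu>. 1)" using odd_card_double_orbit by simp
  qed (use finite_double_orbit dual_act_double_orbit[of _ \<mu>] orb in auto)
  have "l \<in> fixed_dual \<sigma> J" using l double_orbit_dual[OF \<mu>(1)] by (auto simp: fixed_dual_def)
  moreover have "block_coeff l \<chi> \<noteq> 0" using nz block_coeff_cong[OF double_orbit_cong[OF l(1)]] by simp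
  ultimately show ?thesis using that by blast
qed

text \<open>Twisting permutes the constituents and preserves degrees. The squared degrees add up to
  the odd orbit size, so some constituent is its own twist.\<close>

lemma Irr_fixed_in_block:
  assumes l: "l \<in> fixed_dual \<sigma> J"
  obtains \<chi> where "\<chi> \<in> Irr_fixed \<sigma> J" "block_coeff l \<chi> \<noteq> 0"
proof -
  have ld: "l \<in> dual J" "dual_act \<sigma> l = l" using l by (auto simp: fixed_dual_def)
  define A where "A = {\<chi> \<in> Irr P. block_coeff l \<chi> \<noteq> 0}"
  define f where "f \<chi> = (\<lambda>x. if x \<in> carrier P then \<chi> (group_act \<sigma> x) else 0)" for \<chi> :: "'a \<Rightarrow> complex"
  \<comment> \<open>The degree as a natural number: character values are complex, whereas the parity
    argument needs weights in \<open>nat\<close>.\<close>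
  define d where "d \<chi> = (SOME n. \<chi> 1 = of_nat n)" for \<chi> :: "'a \<Rightarrow> complex"
  have d: "\<chi> 1 = of_nat (d \<chi>)" if \<chi>: "\<chi> \<in> Irr P" for \<chi>
  proof -
    obtain n where "n > 0" "\<chi> \<one>\<^bsub>P\<^esub> = of_nat n" using P.Irr_one_pos[OF \<chi>] .
    then have "\<exists>n. \<chi> 1 = of_nat n" by auto
    then show ?thesis unfolding d_def by (rule someI_ex)
  qed
  have finA: "finite A" unfolding A_def using P.regular_character(1) by simp
  have "of_nat (\<Sum>\<chi>\<in>A. (d \<chi>)\<^sup>2) = (\<Sum>\<chi>\<in>A. (\<chi> 1)\<^sup>2)"
    unfolding of_nat_sum by (intro sum.cong refl) (simp add: d A_def)
  also have "\<dots> = of_nat (card (double_orbit J l))" unfolding A_def by (rule block_degrees[OF ld(1)])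
  finally have "(\<Sum>\<chi>\<in>A. (d \<chi>)\<^sup>2) = card (double_orbit J l)" by (simp only: of_nat_eq_iff)
  then have odd: "odd (\<Sum>\<chi>\<in>A. (d \<chi>)\<^sup>2)" using odd_card_double_orbit by simp
  obtain \<chi> where \<chi>: "\<chi> \<in> A" "f \<chi> = \<chi>"
  proof (rule odd_sum_involution_fixpoint[OF finA _ odd, of f])
    fix \<chi> assume \<chi>: "\<chi> \<in> A"
    then have \<chi>P: "\<chi> \<in> Irr P" by (simp add: A_def)
    have "f \<chi> \<in> Irr P" unfolding f_def by (rule I.Irr_twist[OF \<chi>P])
    moreover have "block_coeff l (f \<chi>) = block_coeff l \<chi>"
      using block_coeff_twist[of "f \<chi>" \<chi> l] ld(2) by (simp add: f_def)
    ultimately have "f \<chi> \<in> A" using \<chi> by (simp add: A_def)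
    moreover have "f (f \<chi>) = \<chi>"
      using Irr_outside[OF \<chi>P] by (auto simp: f_def fun_eq_iff)
    moreover have "d (f \<chi>) = d \<chi>"
      using I.\<tau>_one one_P by (simp add: d_def f_def)
    ultimately show "f \<chi> \<in> A \<and> f (f \<chi>) = \<chi> \<and> (d (f \<chi>))\<^sup>2 = (d \<chi>)\<^sup>2" by simp
  qed
  have "\<chi> (group_act \<sigma> x) = \<chi> x" if "x \<in> carrier P" for x
    using fun_cong[OF \<chi>(2), of x] that by (simp add: f_def)
  then show ?thesis using that[of \<chi>] \<chi>(1) by (simp add: Irr_fixed_def A_def)
qed

section \<open>Transfer to the fixed subgroup\<close>

definition glauberman_inv :: "('a \<Rightarrow> complex) \<Rightarrow> 'a \<Rightarrow> complex" where
  "glauberman_inv = the_inv_into (Irr_fixed \<sigma> J) (glauberman \<sigma> J)"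

lemma glauberman_inv_mem: "\<chi> \<in> Irr (fixed_group \<sigma> J) \<Longrightarrow> glauberman_inv \<chi> \<in> Irr_fixed \<sigma> J"
  unfolding glauberman_inv_def using glauberman_bij_betw
  by (intro the_inv_into_into) (auto simp: bij_betw_def)

lemma X_set_eq:
  "X_set \<sigma> J l = {\<chi> \<in> Irr (fixed_group \<sigma> J). block_coeff l (glauberman_inv \<chi>) \<noteq> 0}"
  unfolding X_set_def glauberman_inv_def[symmetric]
  using glauberman_inv_mem constituent_superchar by (auto simp: Irr_fixed_def)

lemma X_set_nonempty:
  assumes "l \<in> fixed_dual \<sigma> J"
  shows "X_set \<sigma> J l \<noteq> {}"
proof -
  obtain \<chi> where \<chi>: "\<chi> \<in> Irr_fixed \<sigma> J" "block_coeff l \<chi> \<noteq> 0" using Irr_fixed_in_block[OF assms] .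
  have "glauberman_inv (glauberman \<sigma> J \<chi>) = \<chi>"
    unfolding glauberman_inv_def using glauberman_bij_betw \<chi>(1) by (intro the_inv_into_f_f) (auto simp: bij_betw_def)
  moreover have "glauberman \<sigma> J \<chi> \<in> Irr (fixed_group \<sigma> J)"
    using glauberman_bij_betw \<chi>(1) by (auto simp: bij_betw_def)
  ultimately have "glauberman \<sigma> J \<chi> \<in> X_set \<sigma> J l" using \<chi>(2) by (simp add: X_set_eq)
  then show ?thesis by blast
qed

lemma X_set_cover:
  assumes "\<chi> \<in> Irr (fixed_group \<sigma> J)"
  obtains l where "l \<in> fixed_dual \<sigma> J" "\<chi> \<in> X_set \<sigma> J l"
  using fixed_dual_in_block[OF glauberman_inv_mem[OF assms]] assms by (auto simp: X_set_eq)

lemma X_set_cong: "double_orbit J l = double_orbit J m \<Longrightarrow> X_set \<sigma> J l = X_set \<sigma> J m"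
  by (simp add: X_set_eq block_coeff_cong[of l m])

lemma X_set_disjoint:
  assumes "l \<in> fixed_dual \<sigma> J" "m \<in> fixed_dual \<sigma> J" "\<chi> \<in> X_set \<sigma> J l" "\<chi> \<in> X_set \<sigma> J m"
  shows "double_orbit J l = double_orbit J m"
  by (rule block_unique[of "glauberman_inv \<chi>"])
    (use assms glauberman_inv_mem[of \<chi>] in \<open>auto simp: X_set_eq fixed_dual_def Irr_fixed_def\<close>)

text \<open>The coefficient of a member \<open>\<chi>\<close> of \<open>X_set\<close> is its degree,
  which is not zero; hence \<open>\<sigma>_char\<close> determines \<open>X_set\<close>.\<close>

lemma char_inner_\<sigma>_char:
  assumes "\<chi> \<in> Irr (fixed_group \<sigma> J)"
  shows "char_inner (fixed_group \<sigma> J) (\<sigma>_char \<sigma> J l) \<chi> \<noteq> 0 \<longleftrightarrow> \<chi> \<in> X_set \<sigma> J l"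
proof -
  interpret C: fin_group "fixed_group \<sigma> J" unfolding fixed_group_eq by (rule I.fin_group_C)
  have "X_set \<sigma> J l \<subseteq> Irr (fixed_group \<sigma> J)" by (auto simp: X_set_def)
  then have "char_inner (fixed_group \<sigma> J) (\<sigma>_char \<sigma> J l) \<chi> = (if \<chi> \<in> X_set \<sigma> J l then \<chi> 1 else 0)"
    using C.char_inner_Irr_sum[OF _ assms, of "X_set \<sigma> J l" "\<lambda>\<psi>. \<psi> 1"]
    unfolding \<sigma>_char_def[abs_def] by simp
  moreover obtain d where "d > 0" "\<chi> \<one>\<^bsub>fixed_group \<sigma> J\<^esub> = of_nat d" using C.Irr_one_pos[OF assms] .
  then have "\<chi> 1 \<noteq> 0" by (simp add: fixed_group_eq)
  ultimately show ?thesis by simp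
qed

text \<open>Equal functions have equal sets of constituents. Non-emptiness supplies a common
  \<open>\<chi>\<close>, and its block fixes the orbit. As \<open>m\<close> is fixed by
  \<open>\<sigma>\<close> already, lying in the orbit of \<open>l\<close> is all that
  \<open>Omega\<close> asks for.\<close>

lemma \<sigma>_char_eq_iff:
  assumes l: "l \<in> fixed_dual \<sigma> J" and m: "m \<in> fixed_dual \<sigma> J"
  shows "\<sigma>_char \<sigma> J l = \<sigma>_char \<sigma> J m \<longleftrightarrow> m \<in> Omega \<sigma> J l"
proof
  assume eq: "\<sigma>_char \<sigma> J l = \<sigma>_char \<sigma> J m"
  obtain \<chi> where \<chi>: "\<chi> \<in> X_set \<sigma> J l" using X_set_nonempty[OF l] by blast
  then have "\<chi> \<in> Irr (fixed_group \<sigma> J)" by (simp add: X_set_def)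
  then have "\<chi> \<in> X_set \<sigma> J m" using char_inner_\<sigma>_char[of \<chi> l] char_inner_\<sigma>_char[of \<chi> m] eq \<chi> by simp
  then have "double_orbit J l = double_orbit J m" using X_set_disjoint[OF l m \<chi>] by simp
  then show "m \<in> Omega \<sigma> J l"
    using m double_orbit_refl[of m] by (simp add: Omega_def fixed_dual_def)
next
  assume "m \<in> Omega \<sigma> J l"
  then have "double_orbit J m = double_orbit J l" by (intro double_orbit_cong) (simp add: Omega_def)
  then have "X_set \<sigma> J m = X_set \<sigma> J l" by (rule X_set_cong)
  then show "\<sigma>_char \<sigma> J l = \<sigma>_char \<sigma> J m" by (simp add: \<sigma>_char_def[abs_def])
qed

lemma partition_on_X_set:
  "partition_on (Irr (fixed_group \<sigma> J)) {X_set \<sigma> J l | l. l \<in> fixed_dual \<sigma> J}"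
proof (rule partition_onI)
  show "\<Union> {X_set \<sigma> J l | l. l \<in> fixed_dual \<sigma> J} = Irr (fixed_group \<sigma> J)"
  proof (intro subset_antisym subsetI)
    fix \<chi> assume "\<chi> \<in> Irr (fixed_group \<sigma> J)"
    then obtain l where "l \<in> fixed_dual \<sigma> J" "\<chi> \<in> X_set \<sigma> J l" by (rule X_set_cover)
    then show "\<chi> \<in> \<Union> {X_set \<sigma> J l | l. l \<in> fixed_dual \<sigma> J}" by blast
  qed (auto simp: X_set_def)
  show "{} \<notin> {X_set \<sigma> J l | l. l \<in> fixed_dual \<sigma> J}" using X_set_nonempty by fastforce
next
  fix p q assume p: "p \<in> {X_set \<sigma> J l | l. l \<in> fixed_dual \<sigma> J}"
    and q: "q \<in> {X_set \<sigma> J l | l. l \<in> fixed_dual \<sigma> J}" and ne: "p \<noteq> q"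
  obtain l m where lm: "l \<in> fixed_dual \<sigma> J" "m \<in> fixed_dual \<sigma> J" "p = X_set \<sigma> J l" "q = X_set \<sigma> J m"
    using p q by blast
  then show "disjnt p q"
    using ne X_set_disjoint[OF lm(1,2)] X_set_cong[of l m] by (auto simp: disjnt_iff)
qed

end

theorem theorem3p6:
  fixes scale :: "'k::{field,finite} \<Rightarrow> 'a::{ring,monoid_mult} \<Rightarrow> 'a"
    and \<sigma> :: "'a \<Rightarrow> 'a" and J :: "'a set"
  assumes "involution_algebra scale \<sigma>"
    and "nilpotent_subalgebra scale J"
    and "\<sigma> ` J \<subseteq> J"
  shows "partition_on (Irr (fixed_group \<sigma> J)) {X_set \<sigma> J l | l. l \<in> fixed_dual \<sigma> J} \<and>
    (\<forall>\<chi>\<in>Irr (fixed_group \<sigma> J). \<exists>l\<in>fixed_dual \<sigma> J.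
       constituent (fixed_group \<sigma> J) \<chi> (\<sigma>_char \<sigma> J l)) \<and>
    (\<forall>l\<in>fixed_dual \<sigma> J. \<forall>m\<in>fixed_dual \<sigma> J.
       \<sigma>_char \<sigma> J l = \<sigma>_char \<sigma> J m \<longleftrightarrow> m \<in> Omega \<sigma> J l)"
proof -
  interpret involution_algebra scale \<sigma> by fact
  interpret nilpotent_involution_algebra scale \<sigma> J by unfold_locales fact+
  have "\<exists>l\<in>fixed_dual \<sigma> J. constituent (fixed_group \<sigma> J) \<chi> (\<sigma>_char \<sigma> J l)"
    if \<chi>: "\<chi> \<in> Irr (fixed_group \<sigma> J)" for \<chi>
  proof -
    obtain l where l: "l \<in> fixed_dual \<sigma> J" "\<chi> \<in> X_set \<sigma> J l" using X_set_cover[OF \<chi>] .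
    then show ?thesis using char_inner_\<sigma>_char[OF \<chi>, of l] \<chi> by (auto simp: constituent_def)
  qed
  then show ?thesis using partition_on_X_set \<sigma>_char_eq_iff by blast
qed

end
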